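(* Let $\chi$ be a critical cluster on $\mathbb{R}^d$, let $c>0$, and let $(\overline{\xi}_n)_{n\ge 0}$ be a critical cluster cascade generated by $\mathcal{L}(\chi)$ with immigrant intensity $c$. Then the sequence of point processes $(\overline{\xi}_n)$ converges weakly to a point process $\overline{\xi}_\infty$ on $\mathbb{R}^d$.
   Context: Fix $d\in\mathbb{N}$. $\mathcal{N}_d$ is the set of locally finite counting measures on $(\mathbb{R}^d,\mathcal{B}(\mathbb{R}^d))$ with the $\sigma$-algebra generated by the sets $\{\mu\in\mathcal{N}_d:\mu B=k\}$, $k\in\mathbb{N}_0$, $B$ bounded Borel. A point process is a random element of $\mathcal{N}_d$. Write $\|\mu\|:=\mu\mathbb{R}^d$ and $\theta_x\mu:=\mu(\cdot-x)$. Point processes $\xi_n$ converge weakly to a point process $\xi_\infty$ if $\int f\,\mathrm{d}\xi_n\to\int f\,\mathrm{d}\xi_\infty$ in distribution for all nonnegative continuous $f$ on $\mathbb{R}^d$ with compact support. A critical cluster is a point process $\chi$ on $\mathbb{R}^d$ with $\mathbb{E}\|\chi\|=1$, $\mathrm{Var}\|\chi\|<\infty$, which is simple ($\mathbb{P}\{\chi\{x\}\le 1 \text{ for all } x\in\mathbb{R}^d\}=1$) and diffuse ($\mathbb{P}\{\chi\{x\}=0\}=1$ for every $x\in\mathbb{R}^d$). The critical cluster field is $(\chi^x)_{x\in\mathbb{R}^d}$, with $\chi^x$ distributed as $\theta_x\chi$, independent over $x$. For $x\in\mathbb{R}^d$ set $\chi^x_0:=\delta_x$, $\chi^x_k:=\int\chi^y\,\chi^x_{k-1}(\mathrm{d}y)$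 for $k\in\mathbb{N}$ (a critical branching random walk rooted at $x$) and $\overline{\chi}^x_n:=\sum_{k=0}^n\chi^x_k$. Let $\mu$ be a homogeneous Poisson process on $\mathbb{R}^d$ with intensity $c>0$, and let $\mu_n(\mathrm{d}x):=1\{U_x\le 1/(n+1)\}\,\mu(\mathrm{d}x)$, where the marks $U_x$ are i.i.d. uniform on $(0,1)$; $\mu$, the marks and the cluster field are independent. The critical cluster cascade is $\overline{\xi}_n:=\int\overline{\chi}^x_n\,\mu_n(\mathrm{d}x)$, $n\in\mathbb{N}_0$. *)

theory Defs
  imports "HOL-Probability.Probability"
begin

definition counting_measures :: "'a::euclidean_space measure set" where
  "counting_measures = {\<nu>. sets \<nu> = sets borel \<and>
     (\<forall>B\<in>sets borel. emeasure \<nu> B \<in> range of_nat \<union> {\<infinity>}) \<and>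
     (\<forall>B\<in>sets borel. bounded B \<longrightarrow> emeasure \<nu> B < \<infinity>)}"

definition config_space :: "'a::euclidean_space measure measure" where
  "config_space = sigma counting_measures
     {{\<nu>\<in>counting_measures. emeasure \<nu> B = of_nat k} | B k. B \<in> sets borel \<and> bounded B}"

definition point_process :: "'w measure \<Rightarrow> ('w \<Rightarrow> 'a::euclidean_space measure) \<Rightarrow> bool" where
  "point_process M \<xi> \<longleftrightarrow> prob_space M \<and> \<xi> \<in> M \<rightarrow>\<^sub>M config_space"

definition converges_weakly ::
  "'w measure \<Rightarrow> (nat \<Rightarrow> 'w \<Rightarrow> 'a::euclidean_space measure) \<Rightarrow>
   'v measure \<Rightarrow> ('v \<Rightarrow> 'a measure) \<Rightarrow> bool" where
  "converges_weakly M \<xi> Q \<eta> \<longleftrightarrow>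
     (\<forall>n. point_process M (\<xi> n)) \<and> point_process Q \<eta> \<and>
     (\<forall>f :: 'a \<Rightarrow> real. continuous_on UNIV f \<and> (\<forall>x. 0 \<le> f x) \<and> compact (closure {x. f x \<noteq> 0}) \<longrightarrow>
        weak_conv_m (\<lambda>n. distr M borel (\<lambda>\<omega>. \<integral>y. f y \<partial>\<xi> n \<omega>))
                    (distr Q borel (\<lambda>\<omega>. \<integral>y. f y \<partial>\<eta> \<omega>)))"

definition shift :: "'a::euclidean_space \<Rightarrow> 'a measure \<Rightarrow> 'a measure" where
  "shift x \<nu> = distr \<nu> borel (\<lambda>y. y + x)"

(* The total mass is used as an ennreal for the mean, so that infinite mass cannot hide; once the
   mean is 1 the mass is almost surely finite and agrees with its real version. *)
definition critical_cluster :: "'w measure \<Rightarrow> ('w \<Rightarrow> 'a::euclidean_space measure) \<Rightarrow> bool" where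
  "critical_cluster M X \<longleftrightarrow>
     point_process M X \<and>
     (\<integral>\<^sup>+\<omega>. emeasure (X \<omega>) UNIV \<partial>M) = 1 \<and>
     (\<integral>\<^sup>+\<omega>. ennreal ((measure (X \<omega>) UNIV - (\<integral>\<omega>'. measure (X \<omega>') UNIV \<partial>M))\<^sup>2) \<partial>M) < \<infinity> \<and>
     (AE \<omega> in M. \<forall>x. emeasure (X \<omega>) {x} \<le> 1) \<and>
     (\<forall>x. AE \<omega> in M. emeasure (X \<omega>) {x} = 0)"

definition poisson_process :: "'w measure \<Rightarrow> real \<Rightarrow> ('w \<Rightarrow> 'a::euclidean_space measure) \<Rightarrow> bool" where
  "poisson_process M c \<mu> \<longleftrightarrow>
     point_process M \<mu> \<and>
     (\<forall>B\<in>sets borel. bounded B \<longrightarrow>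
        (\<forall>k::nat. measure M {\<omega>\<in>space M. emeasure (\<mu> \<omega>) B = of_nat k} =
           exp (- (c * measure lborel B)) * (c * measure lborel B) ^ k / fact k)) \<and>
     (\<forall>(A :: nat \<Rightarrow> 'a set) m.
        (\<forall>i<m. A i \<in> sets borel \<and> bounded (A i)) \<and> disjoint_family_on A {..<m} \<longrightarrow>
        prob_space.indep_vars M (\<lambda>_. borel) (\<lambda>i \<omega>. emeasure (\<mu> \<omega>) (A i)) {..<m})"

(* The sum over j in J of the measures \<eta> j. Superpositions of point processes below are locally
   finite only almost surely; on the exceptional null event the sum is set to the zero
   configuration, so that the result is everywhere a locally finite counting measure. *)
definition superpose :: "nat set \<Rightarrow> (nat \<Rightarrow> 'a::euclidean_space measure) \<Rightarrow> 'a measure" where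
  "superpose J \<eta> =
     (let s = measure_of UNIV (sets borel) (\<lambda>B. \<integral>\<^sup>+j. emeasure (\<eta> j) B \<partial>count_space J)
      in if s \<in> counting_measures then s else null_measure borel)"

definition indices :: "'a::euclidean_space measure \<Rightarrow> nat set" where
  "indices \<nu> = {j. of_nat j < emeasure \<nu> UNIV}"

(* A measurable enumeration e 0 \<nu>, e 1 \<nu>, ... of the points of \<nu>, with multiplicity; e j \<nu> is
   irrelevant when j is not an index of \<nu>. *)
definition point_enumeration :: "(nat \<Rightarrow> 'a::euclidean_space measure \<Rightarrow> 'a) \<Rightarrow> bool" where
  "point_enumeration e \<longleftrightarrow>
     (\<forall>j. e j \<in> config_space \<rightarrow>\<^sub>M borel) \<and>
     (\<forall>\<nu>\<in>counting_measures. \<nu> = superpose (indices \<nu>) (\<lambda>j. return borel (e j \<nu>)))"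

(* An independent field of clusters indexed by all x in R^d cannot be evaluated measurably at random
   points. As usual for cluster processes, an independent copy of the cluster is attached to each
   point of the configuration instead: the j-th point y of generation k carries the cluster
   shift y (Z k j), distributed as the translate by y of the cluster. Since the cluster is diffuse,
   distinct individuals have distinct locations almost surely, so this realises the field along all
   points that occur. *)
fun branching_random_walk ::
  "(nat \<Rightarrow> 'a::euclidean_space measure \<Rightarrow> 'a) \<Rightarrow> (nat \<Rightarrow> nat \<Rightarrow> 'a measure) \<Rightarrow> 'a \<Rightarrow> nat \<Rightarrow> 'a measure"
where
  "branching_random_walk e Z x 0 = return borel x"
| "branching_random_walk e Z x (Suc k) =
     (let \<nu> = branching_random_walk e Z x k
      in superpose (indices \<nu>) (\<lambda>j. shift (e j \<nu>) (Z k j)))"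

definition total_progeny ::
  "(nat \<Rightarrow> 'a::euclidean_space measure \<Rightarrow> 'a) \<Rightarrow> (nat \<Rightarrow> nat \<Rightarrow> 'a measure) \<Rightarrow> 'a \<Rightarrow> nat \<Rightarrow> 'a measure"
where
  "total_progeny e Z x n = superpose {..n} (branching_random_walk e Z x)"

(* L is the law of the cluster. The i-th immigrant, located at e i (\<mu> \<omega>), has mark U i and the
   clusters Z (i, k, j) at its disposal; indep_sets is the mutual independence of the sigma-algebras
   generated by \<mu>, by all marks and by all clusters (indep_var needs equal value types). *)
definition critical_cluster_cascade ::
  "'w measure \<Rightarrow> 'a::euclidean_space measure measure \<Rightarrow> real \<Rightarrow> (nat \<Rightarrow> 'w \<Rightarrow> 'a measure) \<Rightarrow> bool"
where
  "critical_cluster_cascade M L c \<xi> \<longleftrightarrow>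
     prob_space M \<and>
     (\<exists>e \<mu> (U :: nat \<Rightarrow> 'w \<Rightarrow> real) (Z :: nat \<times> nat \<times> nat \<Rightarrow> 'w \<Rightarrow> 'a measure).
        point_enumeration e \<and>
        poisson_process M c \<mu> \<and>
        prob_space.indep_vars M (\<lambda>_. borel) U UNIV \<and>
        (\<forall>i. distr M borel (U i) = uniform_measure lborel {0<..<1}) \<and>
        prob_space.indep_vars M (\<lambda>_. config_space) Z UNIV \<and>
        (\<forall>t. distr M config_space (Z t) = L) \<and>
        prob_space.indep_sets M
          (\<lambda>l. [sets (vimage_algebra (space M) \<mu> config_space),
                 sets (vimage_algebra (space M) (\<lambda>\<omega> i. U i \<omega>) (PiM UNIV (\<lambda>_. borel))),
                 sets (vimage_algebra (space M) (\<lambda>\<omega> t. Z t \<omega>) (PiM UNIV (\<lambda>_. config_space)))] ! l)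
          {..<3} \<and>
        (\<forall>n. \<forall>\<omega>\<in>space M. \<xi> n \<omega> =
           superpose {i \<in> indices (\<mu> \<omega>). U i \<omega> \<le> 1 / (real n + 1)}
             (\<lambda>i. total_progeny e (\<lambda>k j. Z (i, k, j) \<omega>) (e i (\<mu> \<omega>)) n)))"

end

theory Submission
  imports Defs
begin

text \<open>
  Let \<open>G n x\<close> be the Laplace functional at f of the total progeny up to generation n of an individual
  at x, so that \<open>G (n + 1) x = exp (- f x) E (\<Prod>y. G n y)\<close> with the product over the cluster at x. The
  Laplace functional of the cascade is \<open>exp (- c / (n + 1) \<integral> (1 - G n x) dx)\<close>. Since products of
  numbers in [0, 1] are Lipschitz, the cluster has mean mass 1 and Lebesgue measure is translation
  invariant, the increments \<open>\<integral> (G n - G (n + 1)) dx\<close> decrease in n and are at most \<open>\<integral> f dx\<close>. Hence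
  \<open>1 / (n + 1) \<integral> (1 - G n x) dx\<close>, a Cesaro mean of a decreasing sequence, converges. This holds for
  every integrable measurable f, not only for continuous ones.

  Taking for f step functions on dyadic cells, the counts of the cascade on finitely many cells
  converge jointly in distribution (approximate functions of N by polynomials in \<open>exp (- N)\<close>). The
  Kolmogorov extension theorem gives a random family of limit counts that is almost surely additive,
  and following nested cells turns it into a locally finite counting measure. A continuous f with
  compact support is approximated by step functions, with an error in the Laplace functional of at
  most c times the \<open>L\<^sup>1\<close>-error. Convergence of all Laplace transforms yields weak convergence.
\<close>

section \<open>Exponentials of extended nonnegative reals\<close>


text \<open>One estimate carries most of the analysis: for every n, the Laplace functional of the
  cascade at f is at least \<open>nexp\<close> of c times the Lebesgue integral of f. With small
  multiples of indicators of balls it gives local finiteness of each stage, with indicators of cells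
  it gives tightness of the counts, and with the distance between f and its step approximation it
  gives an error uniform in n, so that two limits can be exchanged. Integrals over configurations
  may be infinite on null events, and products may have infinitely many factors. Both are handled by
  exponents in \<open>ennreal\<close>: \<open>nexp\<close> sends the infinite value to 0, series
  always converge, and expectations are taken of functions with values in [0, 1]. The limit
  configuration cannot be required to reproduce the limiting cell counts: cells are half-open, and
  points followed through nested cells may converge to a boundary point outside their cells. Only
  integrals of continuous functions are recovered, which is all that weak convergence asks
  for.\<close>

definition nexp :: "ennreal \<Rightarrow> real" where
  "nexp a = (if a = \<top> then 0 else exp (- enn2real a))"

text \<open>Inverse of \<open>nexp\<close> on [0, 1], so that an infinite product of numbers in
  [0, 1] can be written as \<open>nexp\<close> of a series in \<open>ennreal\<close>. A factor 0
  becomes an infinite summand.\<close>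

definition nlog :: "real \<Rightarrow> ennreal" where
  "nlog s = (if s \<le> 0 then \<top> else ennreal (- ln s))"

lemma nexp_nonneg [simp]: "0 \<le> nexp a"
  by (simp add: nexp_def)

lemma nexp_le_1 [simp]: "nexp a \<le> 1"
  by (simp add: nexp_def)

lemma nexp_0 [simp]: "nexp 0 = 1"
  by (simp add: nexp_def)

lemma nexp_top [simp]: "nexp \<top> = 0"
  by (simp add: nexp_def)

lemma nexp_ennreal: "0 \<le> x \<Longrightarrow> nexp (ennreal x) = exp (- x)"
  by (simp add: nexp_def)

lemma nexp_add: "nexp (a + b) = nexp a * nexp b"
  by (cases a; cases b) (auto simp: nexp_ennreal ennreal_plus[symmetric] exp_add[symmetric] simp del: ennreal_plus)

lemma nexp_sum: "finite I \<Longrightarrow> nexp (\<Sum>i\<in>I. f i) = (\<Prod>i\<in>I. nexp (f i))"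
  by (induction I rule: finite_induct) (auto simp: nexp_add)

lemma nexp_antimono: "a \<le> b \<Longrightarrow> nexp b \<le> nexp a"
  by (cases a; cases b) (auto simp: nexp_ennreal ennreal_top_neq_one top_unique)

lemma nexp_measurable [measurable]: "nexp \<in> borel_measurable borel"
  unfolding nexp_def by measurable

lemma tendsto_nexp: "(f \<longlongrightarrow> a) F \<Longrightarrow> ((\<lambda>x. nexp (f x)) \<longlongrightarrow> nexp a) F"
proof (cases a)
  case (real r)
  assume f: "(f \<longlongrightarrow> a) F"
  then have "eventually (\<lambda>x. f x < \<top>) F"
    using real by (intro order_tendstoD(2)) (auto simp: ennreal_less_top)
  then have ev: "eventually (\<lambda>x. exp (- enn2real (f x)) = nexp (f x)) F"
    by eventually_elim (auto simp: nexp_def)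
  have "((\<lambda>x. exp (- enn2real (f x))) \<longlongrightarrow> exp (- enn2real a)) F"
    using f real by (intro tendsto_intros tendsto_enn2real) (auto simp: ennreal_less_top)
  then show ?thesis
    using real by (subst (asm) tendsto_cong[OF ev]) (simp add: nexp_def)
next
  case top
  assume f: "(f \<longlongrightarrow> a) F"
  show ?thesis
  proof (rule tendstoI)
    fix e :: real assume e: "0 < e"
    define K where "K = max 0 (- ln (e / 2))"
    have K: "0 \<le> K" "- K \<le> ln (e / 2)"
      by (auto simp: K_def)
    have "eventually (\<lambda>x. ennreal K < f x) F"
      using f top by (intro order_tendstoD(1)) (auto simp: ennreal_less_top)
    then show "eventually (\<lambda>x. dist (nexp (f x)) (nexp a) < e) F"
    proof eventually_elim
      case (elim x)
      have "nexp (f x) \<le> nexp (ennreal K)"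
        using elim by (intro nexp_antimono) auto
      also have "\<dots> = exp (- K)"
        using K by (simp add: nexp_ennreal)
      also have "\<dots> \<le> exp (ln (e / 2))"
        using K by simp
      also have "\<dots> < e"
        using e by simp
      finally show ?case
        using top by simp
    qed
  qed
qed

lemma one_minus_nexp_le: "ennreal (1 - nexp a) \<le> a"
proof (cases a)
  case (real r)
  have "1 - exp (- r) \<le> r"
    using exp_ge_add_one_self[of "-r"] by simp
  then show ?thesis
    using real by (simp add: nexp_ennreal ennreal_leI)
qed simp

text \<open>From \<open>nexp a * nexp d \<le> nexp b\<close> and \<open>nexp a \<le> 1\<close>. The
  hypotheses are additive because subtraction in \<open>ennreal\<close> is truncated and badly
  behaved at infinity.\<close>

lemma abs_nexp_diff_le:
  assumes "a \<le> b + d" "b \<le> a + d"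
  shows "\<bar>nexp a - nexp b\<bar> \<le> 1 - nexp d"
proof -
  have *: "nexp a - nexp b \<le> 1 - nexp d" if "b \<le> a + d" for a b
  proof -
    have "nexp a * nexp d \<le> nexp b"
      using nexp_antimono[OF that] by (simp add: nexp_add)
    moreover have "nexp a * (1 - nexp d) \<le> 1 * (1 - nexp d)"
      by (intro mult_right_mono) auto
    ultimately show ?thesis
      by (simp add: algebra_simps)
  qed
  show ?thesis
    using *[OF assms(1)] *[OF assms(2)] by (auto simp: abs_if)
qed

lemma nlog_measurable [measurable]: "nlog \<in> borel_measurable borel"
  unfolding nlog_def by measurable

lemma nexp_nlog: "0 \<le> s \<Longrightarrow> s \<le> 1 \<Longrightarrow> nexp (nlog s) = s"
  by (auto simp: nlog_def nexp_ennreal)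

lemma nlog_nexp: "nlog (nexp a) = a"
  by (cases a) (auto simp: nlog_def nexp_ennreal)

lemma nlog_1 [simp]: "nlog 1 = 0"
  by (simp add: nlog_def)

lemma nlog_antimono: "s \<le> t \<Longrightarrow> nlog t \<le> nlog s"
  by (auto simp: nlog_def intro!: ennreal_leI)

lemma nexp_suminf: "(\<lambda>m. \<Prod>j<m. nexp (f j)) \<longlonglongrightarrow> nexp (\<Sum>j. f j)"
  using tendsto_nexp[OF summable_LIMSEQ[OF summableI, of f]] by (simp add: nexp_sum)

lemma (in prob_space) integrable_nexp [intro]:
  "f \<in> borel_measurable M \<Longrightarrow> integrable M (\<lambda>\<omega>. nexp (f \<omega>))"
  by (intro integrable_const_bound[of _ 1]) auto

lemma (in prob_space) expectation_nexp_le_1: "expectation (\<lambda>\<omega>. nexp (f \<omega>)) \<le> 1"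
proof (cases "integrable M (\<lambda>\<omega>. nexp (f \<omega>))")
  case True
  then show ?thesis
    by (intro integral_le_const) auto
qed (simp add: not_integrable_integral_eq)

text \<open>For finitely many factors this is independence; all partial products lie in [0, 1], so
  dominated convergence passes to infinitely many, and \<open>nlog\<close> turns the limit of
  products back into a series.\<close>

lemma nlog_nexp_sum_indep:
  fixes F :: "nat \<Rightarrow> 'b \<Rightarrow> ennreal"
  assumes "prob_space N" "prob_space.indep_vars N (\<lambda>_. S) Y UNIV"
    and F [measurable]: "\<And>j. F j \<in> borel_measurable S"
  shows "(\<integral>\<omega>. nexp (\<Sum>j. F j (Y j \<omega>)) \<partial>N) = nexp (\<Sum>j. nlog (\<integral>\<omega>. nexp (F j (Y j \<omega>)) \<partial>N))"
proof -
  interpret prob_space N by fact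
  have Y [measurable]: "Y j \<in> N \<rightarrow>\<^sub>M S" for j
    using assms(2) by (auto simp: indep_vars_def)
  have ind: "indep_vars (\<lambda>_. borel) (\<lambda>j \<omega>. nexp (F j (Y j \<omega>))) UNIV"
    using indep_vars_compose2[OF assms(2), of "\<lambda>j b. nexp (F j b)" "\<lambda>_. borel"] by simp
  have *: "(\<integral>\<omega>. (\<Prod>j<m. nexp (F j (Y j \<omega>))) \<partial>N) = (\<Prod>j<m. \<integral>\<omega>. nexp (F j (Y j \<omega>)) \<partial>N)" for m
    by (intro indep_vars_lebesgue_integral indep_vars_subset[OF ind]) auto
  have "(\<lambda>m. \<integral>\<omega>. (\<Prod>j<m. nexp (F j (Y j \<omega>))) \<partial>N) \<longlonglongrightarrow> (\<integral>\<omega>. nexp (\<Sum>j. F j (Y j \<omega>)) \<partial>N)"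
    by (intro integral_dominated_convergence[of _ _ _ "\<lambda>_. 1"])
       (auto intro!: AE_I2 nexp_suminf prod_le_1 simp: abs_prod)
  moreover have "(\<lambda>m. \<Prod>j<m. \<integral>\<omega>. nexp (F j (Y j \<omega>)) \<partial>N) \<longlonglongrightarrow>
      nexp (\<Sum>j. nlog (\<integral>\<omega>. nexp (F j (Y j \<omega>)) \<partial>N))"
    using nexp_suminf[of "\<lambda>j. nlog (\<integral>\<omega>. nexp (F j (Y j \<omega>)) \<partial>N)"]
    by (simp add: nexp_nlog expectation_nexp_le_1)
  ultimately show ?thesis
    unfolding * by (rule LIMSEQ_unique)
qed

text \<open>Finite products of numbers in [0, 1] differ by at most the sum of the differences of
  their factors; let the number of factors tend to infinity. The bound may be infinite.\<close>

lemma nexp_nlog_diff_le: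
  fixes a b :: "nat \<Rightarrow> real"
  assumes "\<And>j. 0 \<le> b j" "\<And>j. b j \<le> a j" "\<And>j. a j \<le> 1"
  shows "ennreal (nexp (\<Sum>j. nlog (a j)) - nexp (\<Sum>j. nlog (b j))) \<le> (\<Sum>j. ennreal (a j - b j))"
proof -
  have b: "b j \<le> 1" "0 \<le> a j" for j
    using assms[of j] by auto
  have la: "(\<lambda>m. \<Prod>j<m. a j) \<longlonglongrightarrow> nexp (\<Sum>j. nlog (a j))"
    using nexp_suminf[of "\<lambda>j. nlog (a j)"] by (simp add: nexp_nlog b assms)
  have lb: "(\<lambda>m. \<Prod>j<m. b j) \<longlonglongrightarrow> nexp (\<Sum>j. nlog (b j))"
    using nexp_suminf[of "\<lambda>j. nlog (b j)"] by (simp add: nexp_nlog b assms)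
  have le: "ennreal ((\<Prod>j<m. a j) - (\<Prod>j<m. b j)) \<le> (\<Sum>j. ennreal (a j - b j))" for m
  proof -
    have "(\<Prod>j<m. a j) - (\<Prod>j<m. b j) \<le> norm ((\<Prod>j<m. a j) - (\<Prod>j<m. b j))"
      by simp
    also have "\<dots> \<le> (\<Sum>j<m. norm (a j - b j))"
      using b assms by (intro norm_prod_diff) auto
    also have "\<dots> = (\<Sum>j<m. a j - b j)"
      using assms by (intro sum.cong) auto
    finally have "ennreal ((\<Prod>j<m. a j) - (\<Prod>j<m. b j)) \<le> ennreal (\<Sum>j<m. a j - b j)"
      by (rule ennreal_leI)
    also have "\<dots> = (\<Sum>j<m. ennreal (a j - b j))"
      using assms by (subst sum_ennreal) auto
    also have "\<dots> \<le> (\<Sum>j. ennreal (a j - b j))"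
      by (rule sum_le_suminf) auto
    finally show ?thesis .
  qed
  show ?thesis
    by (rule LIMSEQ_le_const2[OF tendsto_ennrealI[OF tendsto_diff[OF la lb]]]) (use le in auto)
qed

section \<open>The space of counting measures\<close>


lemma sets_counting_measures: "\<nu> \<in> counting_measures \<Longrightarrow> sets \<nu> = sets borel"
  by (simp add: counting_measures_def)

lemma space_counting_measures: "\<nu> \<in> counting_measures \<Longrightarrow> space \<nu> = UNIV"
  using sets_eq_imp_space_eq[OF sets_counting_measures] by simp

lemma emeasure_counting_measures_finite:
  "\<nu> \<in> counting_measures \<Longrightarrow> B \<in> sets borel \<Longrightarrow> bounded B \<Longrightarrow> emeasure \<nu> B < \<infinity>"
  by (simp add: counting_measures_def)

lemma emeasure_counting_measures_nat:
  assumes "\<nu> \<in> counting_measures" "B \<in> sets borel" "emeasure \<nu> B < \<infinity>"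
  obtains k :: nat where "emeasure \<nu> B = of_nat k"
  using assms by (auto simp: counting_measures_def)

lemma null_measure_counting_measures [simp]: "null_measure borel \<in> counting_measures"
  by (auto simp: counting_measures_def intro!: rev_image_eqI[of 0])

lemma space_config_space [simp]: "space config_space = counting_measures"
  unfolding config_space_def by (rule space_measure_of) auto

lemma measurable_config_space_space:
  "f \<in> M \<rightarrow>\<^sub>M config_space \<Longrightarrow> \<omega> \<in> space M \<Longrightarrow> f \<omega> \<in> counting_measures"
  using measurable_space[of f M config_space \<omega>] by simp

text \<open>Masses of bounded sets are natural numbers, so a preimage is a countable union of
  generators of the sigma-algebra.\<close>

lemma measurable_emeasure_config_bounded:
  assumes "B \<in> sets borel" "bounded B"
  shows "(\<lambda>\<nu>. emeasure \<nu> B) \<in> borel_measurable config_space"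
proof (rule measurableI)
  fix A :: "ennreal set" assume "A \<in> sets borel"
  have "{\<nu>\<in>counting_measures. emeasure \<nu> B = of_nat k} \<in> sets config_space" for k
    using assms unfolding config_space_def by (intro in_measure_of) auto
  then have "(\<Union>k\<in>{k. of_nat k \<in> A}. {\<nu>\<in>counting_measures. emeasure \<nu> B = of_nat k}) \<in> sets config_space"
    by (intro sets.countable_UN) auto
  also have "(\<Union>k\<in>{k. of_nat k \<in> A}. {\<nu>\<in>counting_measures. emeasure \<nu> B = of_nat k}) =
      (\<lambda>\<nu>. emeasure \<nu> B) -` A \<inter> space config_space"
  proof (intro set_eqI iffI)
    fix \<nu> assume "\<nu> \<in> (\<lambda>\<nu>. emeasure \<nu> B) -` A \<inter> space config_space"
    then have \<nu>: "\<nu> \<in> counting_measures" "emeasure \<nu> B \<in> A"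
      by auto
    obtain k :: nat where "emeasure \<nu> B = of_nat k"
      using emeasure_counting_measures_nat[OF \<nu>(1) assms(1)] emeasure_counting_measures_finite[OF \<nu>(1) assms] by blast
    with \<nu> show "\<nu> \<in> (\<Union>k\<in>{k. of_nat k \<in> A}. {\<nu>\<in>counting_measures. emeasure \<nu> B = of_nat k})"
      by auto
  qed auto
  finally show "(\<lambda>\<nu>. emeasure \<nu> B) -` A \<inter> space config_space \<in> sets config_space" .
qed simp

lemma emeasure_counting_measures_SUP:
  assumes "\<nu> \<in> counting_measures" "B \<in> sets borel"
  shows "emeasure \<nu> B = (SUP n. emeasure \<nu> (B \<inter> ball 0 (real n)))"
proof -
  have "(SUP n. emeasure \<nu> (B \<inter> ball 0 (real n))) = emeasure \<nu> (\<Union>n. B \<inter> ball 0 (real n))"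
    using assms by (intro SUP_emeasure_incseq) (auto simp: incseq_def sets_counting_measures)
  also have "(\<Union>n. B \<inter> ball 0 (real n)) = B"
    by (auto simp: reals_Archimedean2)
  finally show ?thesis ..
qed

lemma measurable_emeasure_config [measurable]:
  assumes [measurable]: "B \<in> sets borel"
  shows "(\<lambda>\<nu>. emeasure \<nu> B) \<in> borel_measurable config_space"
proof -
  have [measurable]: "(\<lambda>\<nu>. emeasure \<nu> (B \<inter> ball 0 (real n))) \<in> borel_measurable config_space" for n
    using assms by (intro measurable_emeasure_config_bounded sets.Int bounded_Int) auto
  have "(\<lambda>\<nu>. SUP n. emeasure \<nu> (B \<inter> ball 0 (real n))) \<in> borel_measurable config_space"
    by measurable
  then show ?thesis
    by (rule measurable_cong[THEN iffD1, rotated]) (simp add: emeasure_counting_measures_SUP[OF _ assms, symmetric])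
qed

lemma measurable_config_spaceI:
  assumes "\<And>\<omega>. \<omega> \<in> space M \<Longrightarrow> f \<omega> \<in> counting_measures"
    and "\<And>B. B \<in> sets borel \<Longrightarrow> bounded B \<Longrightarrow> (\<lambda>\<omega>. emeasure (f \<omega>) B) \<in> borel_measurable M"
  shows "f \<in> M \<rightarrow>\<^sub>M config_space"
  unfolding config_space_def
proof (rule measurable_measure_of)
  fix A assume "A \<in> {{\<nu> \<in> counting_measures. emeasure \<nu> B = of_nat k} |(B::'b set) (k::nat). B \<in> sets borel \<and> bounded B}"
  then obtain B :: "'b set" and k :: nat where A: "A = {\<nu> \<in> counting_measures. emeasure \<nu> B = of_nat k}"
    and B: "B \<in> sets borel" "bounded B" by auto
  have "f -` A \<inter> space M = (\<lambda>\<omega>. emeasure (f \<omega>) B) -` {of_nat k} \<inter> space M"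
    using assms(1) by (auto simp: A)
  also have "\<dots> \<in> sets M"
    using assms(2)[OF B] by measurable
  finally show "f -` A \<inter> space M \<in> sets M" .
qed (use assms(1) in auto)

section \<open>Superpositions of counting measures\<close>

definition sum_measure :: "nat set \<Rightarrow> (nat \<Rightarrow> 'a::euclidean_space measure) \<Rightarrow> 'a measure" where
  "sum_measure J \<eta> = measure_of UNIV (sets borel) (\<lambda>B. \<integral>\<^sup>+j. emeasure (\<eta> j) B \<partial>count_space J)"

text \<open>Masses and integrals are computed for \<open>sum_measure\<close>, which has no default
  clause; \<open>superpose\<close> agrees with it as soon as the sum is a counting measure.\<close>

lemma superpose_eq:
  "superpose J \<eta> = (if sum_measure J \<eta> \<in> counting_measures then sum_measure J \<eta> else null_measure borel)"
  by (simp add: superpose_def sum_measure_def Let_def)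

lemma superpose_in_counting_measures [simp]: "superpose J \<eta> \<in> counting_measures"
  by (simp add: superpose_eq)

lemma sets_superpose [simp]: "sets (superpose J \<eta>) = sets borel"
  by (rule sets_counting_measures) simp

lemma sets_sum_measure [simp, measurable_cong]: "sets (sum_measure J \<eta>) = sets borel"
  using sets.sigma_sets_eq[of "borel :: 'a measure"] by (simp add: sum_measure_def sets_measure_of_conv)

lemma space_sum_measure [simp]: "space (sum_measure J \<eta>) = UNIV"
  using sets_eq_imp_space_eq[OF sets_sum_measure] by simp

lemma emeasure_sum_measure:
  assumes "\<And>j. j \<in> J \<Longrightarrow> sets (\<eta> j) = sets borel" "B \<in> sets borel"
  shows "emeasure (sum_measure J \<eta>) B = (\<integral>\<^sup>+j. emeasure (\<eta> j) B \<partial>count_space J)"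
proof (rule emeasure_measure_of[OF sum_measure_def])
  show "countably_additive (sets (sum_measure J \<eta>)) (\<lambda>B. \<integral>\<^sup>+j. emeasure (\<eta> j) B \<partial>count_space J)"
  proof (rule countably_additiveI)
    fix A :: "nat \<Rightarrow> 'a set" assume A: "range A \<subseteq> sets (sum_measure J \<eta>)" "disjoint_family A"
    have "(\<Sum>i. \<integral>\<^sup>+j. emeasure (\<eta> j) (A i) \<partial>count_space J) = (\<integral>\<^sup>+j. (\<Sum>i. emeasure (\<eta> j) (A i)) \<partial>count_space J)"
      by (subst nn_integral_suminf) auto
    also have "\<dots> = (\<integral>\<^sup>+j. emeasure (\<eta> j) (\<Union>i. A i) \<partial>count_space J)"
      using A assms(1) by (intro nn_integral_cong suminf_emeasure) auto
    finally show "(\<Sum>i. \<integral>\<^sup>+j. emeasure (\<eta> j) (A i) \<partial>count_space J) =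
        (\<integral>\<^sup>+j. emeasure (\<eta> j) (\<Union>i. A i) \<partial>count_space J)" .
  qed
qed (use assms in \<open>auto simp: positive_def\<close>)

lemma nn_integral_sum_measure:
  assumes s: "\<And>j. j \<in> J \<Longrightarrow> sets (\<eta> j) = sets borel" and "f \<in> borel_measurable borel"
  shows "(\<integral>\<^sup>+y. f y \<partial>sum_measure J \<eta>) = (\<integral>\<^sup>+j. (\<integral>\<^sup>+y. f y \<partial>\<eta> j) \<partial>count_space J)"
  using assms(2)
proof (induction rule: borel_measurable_induct)
  case (cong f g)
  then show ?case by (simp cong: nn_integral_cong)
next
  case (set A)
  have "(\<integral>\<^sup>+j. (\<integral>\<^sup>+y. indicator A y \<partial>\<eta> j) \<partial>count_space J) = (\<integral>\<^sup>+j. emeasure (\<eta> j) A \<partial>count_space J)"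
    using s set by (intro nn_integral_cong) simp
  then show ?case
    using set s by (simp add: emeasure_sum_measure)
next
  case (mult u c)
  have "u \<in> borel_measurable (\<eta> j)" if "j \<in> J" for j
    using mult s[OF that] by (simp cong: measurable_cong_sets)
  then have "(\<integral>\<^sup>+j. (\<integral>\<^sup>+y. c * u y \<partial>\<eta> j) \<partial>count_space J) = (\<integral>\<^sup>+j. c * (\<integral>\<^sup>+y. u y \<partial>\<eta> j) \<partial>count_space J)"
    by (intro nn_integral_cong) (simp add: nn_integral_cmult)
  then show ?case
    using mult by (simp add: nn_integral_cmult cong: measurable_cong_sets)
next
  case (add u v)
  have "u \<in> borel_measurable (\<eta> j)" "v \<in> borel_measurable (\<eta> j)" if "j \<in> J" for j
    using add s[OF that] by (simp_all cong: measurable_cong_sets)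
  then have "(\<integral>\<^sup>+j. (\<integral>\<^sup>+y. v y + u y \<partial>\<eta> j) \<partial>count_space J) =
      (\<integral>\<^sup>+j. (\<integral>\<^sup>+y. v y \<partial>\<eta> j) + (\<integral>\<^sup>+y. u y \<partial>\<eta> j) \<partial>count_space J)"
    by (intro nn_integral_cong) (simp add: nn_integral_add)
  then show ?case
    using add by (simp add: nn_integral_add cong: measurable_cong_sets)
next
  case (seq U)
  have U: "U i \<in> borel_measurable (\<eta> j)" if "j \<in> J" for i j
    using seq s[OF that] by (simp cong: measurable_cong_sets)
  have "(\<integral>\<^sup>+j. (\<integral>\<^sup>+y. (SUP i. U i y) \<partial>\<eta> j) \<partial>count_space J) = (\<integral>\<^sup>+j. (SUP i. \<integral>\<^sup>+y. U i y \<partial>\<eta> j) \<partial>count_space J)"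
    using seq U by (intro nn_integral_cong nn_integral_monotone_convergence_SUP) auto
  also have "\<dots> = (SUP i. \<integral>\<^sup>+j. (\<integral>\<^sup>+y. U i y \<partial>\<eta> j) \<partial>count_space J)"
    using seq by (intro nn_integral_monotone_convergence_SUP)
      (auto simp: incseq_def le_fun_def intro!: nn_integral_mono)
  also have "\<dots> = (SUP i. \<integral>\<^sup>+y. U i y \<partial>sum_measure J \<eta>)"
    using seq by simp
  also have "\<dots> = (\<integral>\<^sup>+y. (SUP i. U i y) \<partial>sum_measure J \<eta>)"
    using seq by (intro nn_integral_monotone_convergence_SUP[symmetric]) (auto cong: measurable_cong_sets)
  finally show ?case
    by (simp add: image_comp)
qed

text \<open>A nonzero term is at least 1, so a finite sum has only finitely many nonzero terms, each
  of them a natural number.\<close>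

lemma nn_integral_count_space_nat_valued:
  fixes a :: "'b \<Rightarrow> ennreal"
  assumes a: "\<And>j. j \<in> J \<Longrightarrow> a j \<in> range of_nat \<union> {\<infinity>}"
  shows "(\<integral>\<^sup>+j. a j \<partial>count_space J) \<in> range of_nat \<union> {\<infinity>}"
proof (cases "(\<integral>\<^sup>+j. a j \<partial>count_space J) = \<infinity>")
  case False
  define A where "A = {j\<in>J. 0 < a j}"
  have "a j \<ge> 1" if "j \<in> A" for j
  proof -
    from that a[of j] consider k :: nat where "a j = of_nat k" "0 < a j" | "a j = \<infinity>"
      by (auto simp: A_def)
    then show ?thesis
    proof cases
      case 1
      then have "1 \<le> k" by (cases k) auto
      then have "(of_nat 1 :: ennreal) \<le> of_nat k" by (intro of_nat_mono)
      with 1 show ?thesis by simp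
    qed simp
  qed
  then have "(\<integral>\<^sup>+j. indicator A j \<partial>count_space J) \<le> (\<integral>\<^sup>+j. a j \<partial>count_space J)"
    by (intro nn_integral_mono) (auto split: split_indicator)
  then have "emeasure (count_space J) A < \<infinity>"
    using False by (subst (asm) nn_integral_indicator) (auto simp: A_def less_top top_unique)
  then have fin: "finite A"
    by (subst (asm) emeasure_count_space) (auto simp: A_def split: if_splits)
  have eq: "(\<integral>\<^sup>+j. a j \<partial>count_space J) = (\<Sum>j\<in>A. a j)"
    using fin unfolding A_def by (rule nn_integral_count_space)
  have "\<forall>j\<in>A. \<exists>k::nat. a j = of_nat k"
  proof
    fix j assume j: "j \<in> A"
    then have "a j \<le> (\<Sum>j\<in>A. a j)"
      using fin by (intro member_le_sum) auto
    then have "a j \<noteq> \<infinity>"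
      using False eq by (auto simp: top_unique)
    then show "\<exists>k::nat. a j = of_nat k"
      using a[of j] j by (auto simp: A_def)
  qed
  then obtain k :: "'b \<Rightarrow> nat" where "\<forall>j\<in>A. a j = of_nat (k j)"
    by metis
  then have "(\<Sum>j\<in>A. a j) = of_nat (\<Sum>j\<in>A. k j)"
    by simp
  then show ?thesis
    using eq by (metis UnI1 rangeI)
qed auto

text \<open>Every bounded set lies in one of countably many balls. Testing finiteness on these makes
  the case distinction in \<open>superpose\<close> a measurable event.\<close>

lemma sum_measure_counting_measures_iff:
  assumes \<eta>: "\<And>j. j \<in> J \<Longrightarrow> \<eta> j \<in> counting_measures"
  shows "sum_measure J \<eta> \<in> counting_measures \<longleftrightarrow>
    (\<forall>k::nat. (\<integral>\<^sup>+j. emeasure (\<eta> j) (ball 0 (real k)) \<partial>count_space J) < \<infinity>)"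
proof safe
  have em: "emeasure (sum_measure J \<eta>) B = (\<integral>\<^sup>+j. emeasure (\<eta> j) B \<partial>count_space J)" if "B \<in> sets borel" for B
    using that \<eta> by (intro emeasure_sum_measure) (auto simp: sets_counting_measures)
  {
    fix k :: nat assume "sum_measure J \<eta> \<in> counting_measures"
    from emeasure_counting_measures_finite[OF this, of "ball 0 (real k)"]
    show "(\<integral>\<^sup>+j. emeasure (\<eta> j) (ball 0 (real k)) \<partial>count_space J) < \<infinity>"
      by (simp add: em)
  next
    assume fin: "\<forall>k::nat. (\<integral>\<^sup>+j. emeasure (\<eta> j) (ball 0 (real k)) \<partial>count_space J) < \<infinity>"
    have "emeasure (sum_measure J \<eta>) B \<in> range of_nat \<union> {\<infinity>}" if "B \<in> sets borel" for B
      unfolding em[OF that] using \<eta> that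
      by (intro nn_integral_count_space_nat_valued) (auto simp: counting_measures_def)
    moreover have "emeasure (sum_measure J \<eta>) B < \<infinity>" if B: "B \<in> sets borel" "bounded B" for B
    proof -
      obtain r where "B \<subseteq> ball 0 r"
        using bounded_subset_ballD[OF B(2), of 0] by auto
      moreover obtain k :: nat where "r < real k"
        using reals_Archimedean2 by auto
      ultimately have "B \<subseteq> ball 0 (real k)"
        by (meson less_imp_le subset_ball order_trans)
      then have "emeasure (sum_measure J \<eta>) B \<le> emeasure (sum_measure J \<eta>) (ball 0 (real k))"
        by (intro emeasure_mono) auto
      with fin show ?thesis
        by (simp add: em order.strict_trans1)
    qed
    ultimately show "sum_measure J \<eta> \<in> counting_measures"
      by (simp add: counting_measures_def)
  }
qed

lemma measurable_superpose:
  assumes \<eta>: "\<And>j. \<eta> j \<in> M \<rightarrow>\<^sub>M config_space" and J: "\<And>j. Measurable.pred M (\<lambda>\<omega>. j \<in> J \<omega>)"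
  shows "(\<lambda>\<omega>. superpose (J \<omega>) (\<lambda>j. \<eta> j \<omega>)) \<in> M \<rightarrow>\<^sub>M config_space"
proof (rule measurable_config_spaceI)
  note [measurable] = \<eta> J
  have em: "emeasure (sum_measure (J \<omega>) (\<lambda>j. \<eta> j \<omega>)) B = (\<Sum>j. emeasure (\<eta> j \<omega>) B * (if j \<in> J \<omega> then 1 else 0))"
    if "B \<in> sets borel" "\<omega> \<in> space M" for B \<omega>
  proof -
    have "emeasure (sum_measure (J \<omega>) (\<lambda>j. \<eta> j \<omega>)) B = (\<integral>\<^sup>+j. emeasure (\<eta> j \<omega>) B \<partial>count_space (J \<omega>))"
      using that measurable_config_space_space[OF \<eta>] by (intro emeasure_sum_measure) (auto simp: sets_counting_measures)
    also have "\<dots> = (\<integral>\<^sup>+j. emeasure (\<eta> j \<omega>) B * indicator (J \<omega>) j \<partial>count_space UNIV)"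
      by (rule nn_integral_count_space_indicator) simp
    also have "\<dots> = (\<Sum>j. emeasure (\<eta> j \<omega>) B * indicator (J \<omega>) j)"
      by (rule nn_integral_count_space_nat)
    also have "\<dots> = (\<Sum>j. emeasure (\<eta> j \<omega>) B * (if j \<in> J \<omega> then 1 else 0))"
      by (intro suminf_cong) (simp add: indicator_def)
    finally show ?thesis .
  qed
  have [measurable]: "(\<lambda>\<omega>. emeasure (sum_measure (J \<omega>) (\<lambda>j. \<eta> j \<omega>)) B) \<in> borel_measurable M"
    if [measurable]: "B \<in> sets borel" for B
    by (subst measurable_cong[OF em]) measurable
  have good: "sum_measure (J \<omega>) (\<lambda>j. \<eta> j \<omega>) \<in> counting_measures \<longleftrightarrow>
    (\<forall>k::nat. emeasure (sum_measure (J \<omega>) (\<lambda>j. \<eta> j \<omega>)) (ball 0 (real k)) < \<infinity>)" if "\<omega> \<in> space M" for \<omega>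
    using that measurable_config_space_space[OF \<eta>]
    by (subst sum_measure_counting_measures_iff)
       (auto simp: emeasure_sum_measure sets_counting_measures)
  fix B :: "'b set" assume [measurable]: "B \<in> sets borel"
  have "(\<lambda>\<omega>. if \<forall>k::nat. emeasure (sum_measure (J \<omega>) (\<lambda>j. \<eta> j \<omega>)) (ball 0 (real k)) < \<infinity>
     then emeasure (sum_measure (J \<omega>) (\<lambda>j. \<eta> j \<omega>)) B else 0) \<in> borel_measurable M"
    by measurable
  then show "(\<lambda>\<omega>. emeasure (superpose (J \<omega>) (\<lambda>j. \<eta> j \<omega>)) B) \<in> borel_measurable M"
    by (rule measurable_cong[THEN iffD1, rotated]) (simp add: superpose_eq good)
qed simp

lemma nn_integral_superpose:
  assumes "\<And>j. j \<in> J \<Longrightarrow> \<eta> j \<in> counting_measures"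
    and "\<And>k::nat. (\<integral>\<^sup>+j. emeasure (\<eta> j) (ball 0 (real k)) \<partial>count_space J) < \<infinity>"
    and "f \<in> borel_measurable borel"
  shows "(\<integral>\<^sup>+y. f y \<partial>superpose J \<eta>) = (\<integral>\<^sup>+j. (\<integral>\<^sup>+y. f y \<partial>\<eta> j) \<partial>count_space J)"
  using assms sum_measure_counting_measures_iff[of J \<eta>]
  by (simp add: superpose_eq nn_integral_sum_measure sets_counting_measures)

section \<open>Integrals over configurations with enumerated points\<close>

lemma pred_indices [measurable]: "Measurable.pred config_space (\<lambda>\<nu>. j \<in> indices \<nu>)"
  unfolding indices_def by measurable

lemma nn_integral_counting_measure:
  assumes e: "point_enumeration e" and \<nu>: "\<nu> \<in> counting_measures" and f [measurable]: "f \<in> borel_measurable borel"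
  shows "(\<integral>\<^sup>+y. f y \<partial>\<nu>) = (\<integral>\<^sup>+j. f (e j \<nu>) \<partial>count_space (indices \<nu>))"
proof -
  let ?r = "\<lambda>j. return borel (e j \<nu>)"
  have eq: "\<nu> = superpose (indices \<nu>) ?r"
    using e \<nu> by (auto simp: point_enumeration_def)
  have "\<nu> = sum_measure (indices \<nu>) ?r"
  proof (cases "sum_measure (indices \<nu>) ?r \<in> counting_measures")
    \<comment> \<open>The default clause of \<open>superpose\<close> cannot hide a failure of the
      enumeration: \<nu> would be zero, its index set empty, and the sum the zero measure, which is
      a counting measure after all.\<close>
    case False
    then have "\<nu> = null_measure borel"
      using eq by (simp add: superpose_eq)
    then have "indices \<nu> = {}"
      by (auto simp: indices_def)
    then have "sum_measure (indices \<nu>) ?r \<in> counting_measures"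
      using \<open>indices \<nu> = {}\<close> by (subst sum_measure_counting_measures_iff) (auto simp: nn_integral_empty)
    with False show ?thesis by simp
  qed (use eq in \<open>simp add: superpose_eq\<close>)
  then have "(\<integral>\<^sup>+y. f y \<partial>\<nu>) = (\<integral>\<^sup>+y. f y \<partial>sum_measure (indices \<nu>) ?r)"
    by simp
  also have "\<dots> = (\<integral>\<^sup>+j. (\<integral>\<^sup>+y. f y \<partial>?r j) \<partial>count_space (indices \<nu>))"
    by (intro nn_integral_sum_measure) auto
  also have "\<dots> = (\<integral>\<^sup>+j. f (e j \<nu>) \<partial>count_space (indices \<nu>))"
    by (simp add: nn_integral_return)
  finally show ?thesis .
qed

lemma nn_integral_count_space_suminf:
  fixes f :: "nat \<Rightarrow> ennreal"
  shows "(\<integral>\<^sup>+j. f j \<partial>count_space J) = (\<Sum>j. if j \<in> J then f j else 0)"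
  by (subst nn_integral_count_space_indicator)
     (auto simp: nn_integral_count_space_nat intro!: suminf_cong)

lemma nn_integral_counting_measure_suminf:
  assumes "point_enumeration e" "\<nu> \<in> counting_measures" "f \<in> borel_measurable borel"
  shows "(\<integral>\<^sup>+y. f y \<partial>\<nu>) = (\<Sum>j. if j \<in> indices \<nu> then f (e j \<nu>) else 0)"
  using nn_integral_counting_measure[OF assms] by (simp add: nn_integral_count_space_suminf)

lemma point_enumeration_measurable [measurable_dest]: "point_enumeration e \<Longrightarrow> e j \<in> config_space \<rightarrow>\<^sub>M borel"
  by (simp add: point_enumeration_def)

text \<open>The enumeration makes an integral over a random configuration a countable series of
  measurable functions, even when the integrand is random as well.\<close>

lemma measurable_nn_integral_config:
  fixes \<kappa> :: "'b \<Rightarrow> 'a::euclidean_space measure" and e :: "nat \<Rightarrow> 'a measure \<Rightarrow> 'a"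
  assumes e: "point_enumeration e" and [measurable]: "(\<lambda>(\<omega>, y). f \<omega> y) \<in> borel_measurable (M \<Otimes>\<^sub>M borel)"
    and \<kappa> [measurable]: "\<kappa> \<in> M \<rightarrow>\<^sub>M config_space"
  shows "(\<lambda>\<omega>. \<integral>\<^sup>+y. f \<omega> y \<partial>\<kappa> \<omega>) \<in> borel_measurable M"
proof -
  note [measurable] = point_enumeration_measurable[OF e]
  have "(\<lambda>\<omega>. \<Sum>j. if j \<in> indices (\<kappa> \<omega>) then f \<omega> (e j (\<kappa> \<omega>)) else 0) \<in> borel_measurable M"
    by measurable
  then show ?thesis
    using e measurable_config_space_space[OF \<kappa>]
    by (subst measurable_cong[OF nn_integral_counting_measure_suminf]) auto
qed

lemma sets_shift [simp]: "sets (shift x \<nu>) = sets borel"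
  by (simp add: shift_def)

lemma nn_integral_shift:
  assumes "\<nu> \<in> counting_measures" "f \<in> borel_measurable borel"
  shows "(\<integral>\<^sup>+y. f y \<partial>shift x \<nu>) = (\<integral>\<^sup>+y. f (y + x) \<partial>\<nu>)"
  unfolding shift_def using assms
  by (subst nn_integral_distr) (auto simp: sets_counting_measures cong: measurable_cong_sets)

lemma emeasure_shift:
  assumes "\<nu> \<in> counting_measures" "B \<in> sets borel"
  shows "emeasure (shift x \<nu>) B = emeasure \<nu> ((\<lambda>y. y + x) -` B)"
  unfolding shift_def using assms
  by (subst emeasure_distr) (auto simp: sets_counting_measures space_counting_measures cong: measurable_cong_sets)

lemma shift_in_counting_measures:
  assumes "\<nu> \<in> counting_measures"
  shows "shift x \<nu> \<in> counting_measures"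
proof -
  have "(\<lambda>y. y + x) -` B \<in> sets borel" if "B \<in> sets borel" for B
    using measurable_sets[of "\<lambda>y. y + x" borel borel B] that by simp
  moreover have "bounded ((\<lambda>y. y + x) -` B)" if "bounded B" for B
  proof -
    have "(\<lambda>y. y + x) -` B \<subseteq> (\<lambda>y. y - x) ` B"
      by (auto intro!: rev_image_eqI)
    then show ?thesis
      using bounded_translation_minus[OF that] bounded_subset by blast
  qed
  ultimately show ?thesis
    using assms by (auto simp: counting_measures_def emeasure_shift[OF assms])
qed

lemma measurable_shift:
  fixes \<kappa> :: "'b \<Rightarrow> 'a::euclidean_space measure" and e :: "nat \<Rightarrow> 'a measure \<Rightarrow> 'a"
  assumes e: "point_enumeration e" and [measurable]: "x \<in> M \<rightarrow>\<^sub>M borel" and \<kappa> [measurable]: "\<kappa> \<in> M \<rightarrow>\<^sub>M config_space"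
  shows "(\<lambda>\<omega>. shift (x \<omega>) (\<kappa> \<omega>)) \<in> M \<rightarrow>\<^sub>M config_space"
proof (rule measurable_config_spaceI)
  fix B :: "'a set" assume [measurable]: "B \<in> sets borel"
  have "(\<lambda>\<omega>. \<integral>\<^sup>+y. indicator B (y + x \<omega>) \<partial>\<kappa> \<omega>) \<in> borel_measurable M"
    by (rule measurable_nn_integral_config[OF e]) measurable
  moreover have "(\<integral>\<^sup>+y. indicator B (y + x \<omega>) \<partial>\<kappa> \<omega>) = emeasure (shift (x \<omega>) (\<kappa> \<omega>)) B" if "\<omega> \<in> space M" for \<omega>
    using nn_integral_shift[OF measurable_config_space_space[OF \<kappa> that], of "indicator B" "x \<omega>"] by simp
  ultimately show "(\<lambda>\<omega>. emeasure (shift (x \<omega>) (\<kappa> \<omega>)) B) \<in> borel_measurable M"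
    by (simp cong: measurable_cong)
qed (use measurable_config_space_space[OF \<kappa>] shift_in_counting_measures in blast)

lemma return_in_counting_measures [simp]: "return borel x \<in> counting_measures"
proof -
  have "emeasure (return borel x) B = of_nat (if x \<in> B then 1 else 0)" if "B \<in> sets borel" for B
    using that by auto
  then show ?thesis
    by (auto simp: counting_measures_def simp del: emeasure_return)
qed

lemma measurable_return_config:
  assumes [measurable]: "x \<in> M \<rightarrow>\<^sub>M borel"
  shows "(\<lambda>\<omega>. return borel (x \<omega>)) \<in> M \<rightarrow>\<^sub>M config_space"
  by (rule measurable_config_spaceI) auto

section \<open>Laplace functional of a branching random walk\<close>


text \<open>A cylinder over J pulls back to the product of cylinders over \<open>J - D\<close> and
  over \<open>J \<inter> D\<close>, and their masses multiply. With D one row of clusters, this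
  takes the place of conditioning on all other rows.\<close>

lemma PiM_resample:
  assumes "prob_space L"
  defines "\<Omega> \<equiv> PiM UNIV (\<lambda>_::'i. L)"
  shows "distr (\<Omega> \<Otimes>\<^sub>M \<Omega>) \<Omega> (\<lambda>(z, z') i. if i \<in> D then z' i else z i) = \<Omega>"
proof -
  interpret L: prob_space L by fact
  interpret \<Omega>: prob_space \<Omega>
    unfolding \<Omega>_def by (intro prob_space_PiM) (rule assms)
  interpret P: pair_prob_space \<Omega> \<Omega> ..
  have m [measurable]: "(\<lambda>(z, z') i. if i \<in> D then z' i else z i) \<in> \<Omega> \<Otimes>\<^sub>M \<Omega> \<rightarrow>\<^sub>M \<Omega>"
    unfolding \<Omega>_def
  proof (rule measurable_PiM_single')
    fix i show "(\<lambda>\<omega>. (case \<omega> of (z, z') \<Rightarrow> \<lambda>i. if i \<in> D then z' i else z i) i) \<in>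
        PiM UNIV (\<lambda>_::'i. L) \<Otimes>\<^sub>M PiM UNIV (\<lambda>_::'i. L) \<rightarrow>\<^sub>M L"
      by (cases "i \<in> D") (simp_all add: split_beta')
  qed (auto simp: space_pair_measure space_PiM PiE_iff)
  show ?thesis
    unfolding \<Omega>_def
  proof (rule measure_eqI_PiM_infinite[symmetric, OF refl])
    fix A and J :: "'i set" assume J: "finite J" "J \<subseteq> UNIV" and A: "\<And>i. i \<in> J \<Longrightarrow> A i \<in> sets L"
    let ?X = "prod_emb UNIV (\<lambda>_. L) J (Pi\<^sub>E J A)"
    let ?E = "\<lambda>K. prod_emb UNIV (\<lambda>_. L) K (Pi\<^sub>E K A)"
    have X: "?X \<in> sets \<Omega>"
      using J A unfolding \<Omega>_def by (intro sets_PiM_I) auto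
    have E: "?E K \<in> sets \<Omega>" "emeasure \<Omega> (?E K) = (\<Prod>i\<in>K. emeasure L (A i))" if "K \<subseteq> J" for K
      using J A that finite_subset[OF that] unfolding \<Omega>_def
      by (auto intro!: sets_PiM_I emeasure_PiM_emb assms(1))
    have vim: "(\<lambda>(z, z') i. if i \<in> D then z' i else z i) -` ?X \<inter> space (\<Omega> \<Otimes>\<^sub>M \<Omega>) =
        ?E (J - D) \<times> ?E (J \<inter> D)"
      by (auto simp: \<Omega>_def prod_emb_def space_pair_measure space_PiM PiE_iff split: if_splits)
    have "emeasure (distr (\<Omega> \<Otimes>\<^sub>M \<Omega>) \<Omega> (\<lambda>(z, z') i. if i \<in> D then z' i else z i)) ?X =
        emeasure (\<Omega> \<Otimes>\<^sub>M \<Omega>) (?E (J - D) \<times> ?E (J \<inter> D))"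
      using X by (simp add: emeasure_distr vim)
    also have "\<dots> = emeasure \<Omega> (?E (J - D)) * emeasure \<Omega> (?E (J \<inter> D))"
      using E by (intro \<Omega>.emeasure_pair_measure_Times) auto
    also have "\<dots> = (\<Prod>i\<in>(J - D) \<union> (J \<inter> D). emeasure L (A i))"
      using J by (subst prod.union_disjoint) (auto simp: E)
    also have "(J - D) \<union> (J \<inter> D) = J"
      by auto
    finally show "emeasure (PiM UNIV (\<lambda>_. L)) ?X =
       emeasure (distr (PiM UNIV (\<lambda>_. L) \<Otimes>\<^sub>M PiM UNIV (\<lambda>_. L)) (PiM UNIV (\<lambda>_. L)) (\<lambda>(z, z') i. if i \<in> D then z' i else z i)) ?X"
      using E(2)[of J] by (simp add: \<Omega>_def)
  qed (use \<Omega>.finite_measure_axioms in \<open>auto simp: \<Omega>_def\<close>)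
qed

lemma indep_vars_PiM_coordinates:
  fixes t :: "'j \<Rightarrow> 'i"
  assumes L: "prob_space L" and t: "inj t"
  shows "prob_space.indep_vars (PiM UNIV (\<lambda>_::'i. L)) (\<lambda>_. L) (\<lambda>j z. z (t j)) UNIV"
proof -
  interpret P: prob_space "PiM UNIV (\<lambda>_::'i. L)"
    using L by (intro prob_space_PiM)
  show ?thesis
  proof (subst P.indep_vars_iff_distr_eq_PiM)
    have "distr (PiM UNIV (\<lambda>_::'i. L)) L (\<lambda>z. z (t j)) = L" for j
      using L by (intro distr_PiM_component) auto
    then show "distr (PiM UNIV (\<lambda>_::'i. L)) (PiM UNIV (\<lambda>_. L)) (\<lambda>z. \<lambda>j\<in>UNIV. z (t j)) =
        PiM UNIV (\<lambda>j. distr (PiM UNIV (\<lambda>_::'i. L)) L (\<lambda>z. z (t j)))"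
      using distr_PiM_reindex[of UNIV "\<lambda>_. L" t UNIV] L t by simp
  qed auto
qed

text \<open>Row k of the array enters only at the passage from generation k to k + 1; hence the rows
  from n on can be redrawn or erased without affecting generation n.\<close>

lemma branching_random_walk_cong:
  "(\<And>k. k < n \<Longrightarrow> Z k = Z' k) \<Longrightarrow> branching_random_walk e Z x n = branching_random_walk e Z' x n"
  by (induction n) (auto simp: Let_def)

lemma branching_random_walk_in_counting_measures [simp]:
  "branching_random_walk e Z x n \<in> counting_measures"
  by (cases n) (auto simp: Let_def)

lemma measurable_branching_random_walk:
  fixes e :: "nat \<Rightarrow> 'a::euclidean_space measure \<Rightarrow> 'a"
  assumes e: "point_enumeration e" and Z [measurable]: "\<And>k j. Z k j \<in> M \<rightarrow>\<^sub>M config_space"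
    and x [measurable]: "x \<in> M \<rightarrow>\<^sub>M borel"
  shows "(\<lambda>\<omega>. branching_random_walk e (\<lambda>k j. Z k j \<omega>) (x \<omega>) n) \<in> M \<rightarrow>\<^sub>M config_space"
proof (induction n)
  case 0
  show ?case
    using measurable_return_config[OF x] by simp
next
  case (Suc n)
  note [measurable] = Suc point_enumeration_measurable[OF e]
  have "(\<lambda>\<omega>. superpose (indices (branching_random_walk e (\<lambda>k j. Z k j \<omega>) (x \<omega>) n))
      (\<lambda>j. shift (e j (branching_random_walk e (\<lambda>k j. Z k j \<omega>) (x \<omega>) n)) (Z n j \<omega>))) \<in> M \<rightarrow>\<^sub>M config_space"
    by (intro measurable_superpose measurable_shift[OF e]) measurable
  then show ?case
    by (simp add: Let_def)
qed

lemma measurable_total_progeny: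
  fixes e :: "nat \<Rightarrow> 'a::euclidean_space measure \<Rightarrow> 'a"
  assumes e: "point_enumeration e" and Z: "\<And>k j. Z k j \<in> M \<rightarrow>\<^sub>M config_space"
    and x: "x \<in> M \<rightarrow>\<^sub>M borel"
  shows "(\<lambda>\<omega>. total_progeny e (\<lambda>k j. Z k j \<omega>) (x \<omega>) n) \<in> M \<rightarrow>\<^sub>M config_space"
  unfolding total_progeny_def
  by (intro measurable_superpose measurable_branching_random_walk[OF e Z x]) auto

lemma total_progeny_in_counting_measures [simp]: "total_progeny e Z x n \<in> counting_measures"
  by (simp add: total_progeny_def)

lemma indices_finite:
  assumes "\<nu> \<in> counting_measures" "emeasure \<nu> UNIV < \<infinity>"
  shows "finite (indices \<nu>)"
proof -
  obtain k :: nat where "emeasure \<nu> UNIV = of_nat k"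
    using emeasure_counting_measures_nat[OF assms(1) _ assms(2)] by auto
  then have "indices \<nu> \<subseteq> {..<k}"
    by (auto simp: indices_def)
  then show ?thesis
    by (rule finite_subset) simp
qed

lemma nn_integral_superpose_finite:
  assumes "finite J" "\<And>j. j \<in> J \<Longrightarrow> \<eta> j \<in> counting_measures" "f \<in> borel_measurable borel"
  shows "(\<integral>\<^sup>+y. f y \<partial>superpose J \<eta>) = (\<Sum>j\<in>J. \<integral>\<^sup>+y. f y \<partial>\<eta> j)"
proof -
  have "(\<integral>\<^sup>+j. emeasure (\<eta> j) (ball 0 (real k)) \<partial>count_space J) < \<infinity>" for k :: nat
    using assms(1) emeasure_counting_measures_finite[OF assms(2), of _ "ball 0 (real k)"]
    by (simp add: nn_integral_count_space_finite)
  then show ?thesis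
    using assms by (subst nn_integral_superpose) (auto simp: nn_integral_count_space_finite)
qed

lemma emeasure_superpose_finite:
  assumes "finite J" "\<And>j. j \<in> J \<Longrightarrow> \<eta> j \<in> counting_measures"
  shows "emeasure (superpose J \<eta>) UNIV = (\<Sum>j\<in>J. emeasure (\<eta> j) UNIV)"
proof -
  have *: "emeasure \<nu> UNIV = (\<integral>\<^sup>+y. 1 \<partial>\<nu>)" if "\<nu> \<in> counting_measures" for \<nu> :: "'a measure"
    using that by (simp add: space_counting_measures)
  have "emeasure (superpose J \<eta>) UNIV = (\<integral>\<^sup>+y. 1 \<partial>superpose J \<eta>)"
    by (rule *) simp
  also have "\<dots> = (\<Sum>j\<in>J. \<integral>\<^sup>+y. 1 \<partial>\<eta> j)"
    using assms by (intro nn_integral_superpose_finite) auto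
  also have "\<dots> = (\<Sum>j\<in>J. emeasure (\<eta> j) UNIV)"
    using assms(2) by (intro sum.cong refl *[symmetric])
  finally show ?thesis .
qed

lemma nn_integral_total_progeny:
  assumes "f \<in> borel_measurable borel"
  shows "(\<integral>\<^sup>+y. f y \<partial>total_progeny e Z x n) = (\<Sum>k\<le>n. \<integral>\<^sup>+y. f y \<partial>branching_random_walk e Z x k)"
  unfolding total_progeny_def using assms by (intro nn_integral_superpose_finite) auto

lemma emeasure_branching_random_walk_finite:
  assumes "\<And>k j. Z k j \<in> counting_measures" "\<And>k j. emeasure (Z k j) UNIV < \<infinity>"
  shows "emeasure (branching_random_walk e Z x n) UNIV < \<infinity>"
proof (induction n)
  case (Suc n)
  let ?\<nu> = "branching_random_walk e Z x n"
  have "emeasure (branching_random_walk e Z x (Suc n)) UNIV = (\<Sum>j\<in>indices ?\<nu>. emeasure (Z n j) UNIV)"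
    using assms indices_finite[OF _ Suc] by (simp add: Let_def emeasure_superpose_finite shift_in_counting_measures emeasure_shift)
  also have "\<dots> < \<infinity>"
    using assms indices_finite[OF _ Suc] by simp
  finally show ?case .
qed simp

text \<open>Finite clusters in the rows before n make generation n finite, hence the next one a
  finite superposition that never meets the default clause. Row n may hold infinite clusters, since
  it is the row that will be integrated out over the whole space.\<close>

lemma nn_integral_branching_random_walk_Suc:
  fixes Z :: "nat \<Rightarrow> nat \<Rightarrow> 'a::euclidean_space measure" and e and x and n
  assumes "\<And>k j. Z k j \<in> counting_measures" "\<And>k j. k < n \<Longrightarrow> emeasure (Z k j) UNIV < \<infinity>"
    and [measurable]: "f \<in> borel_measurable borel"
  defines "\<nu> \<equiv> branching_random_walk e Z x n"
  shows "(\<integral>\<^sup>+y. f y \<partial>branching_random_walk e Z x (Suc n)) =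
    (\<Sum>j. if j \<in> indices \<nu> then \<integral>\<^sup>+y. f (y + e j \<nu>) \<partial>Z n j else 0)"
proof -
  \<comment> \<open>Erasing the rows from n on makes all rows finite, as
    \<open>emeasure_branching_random_walk_finite\<close> requires, and leaves generation n
    unchanged.\<close>
  define Z' where "Z' = (\<lambda>k j. if k < n then Z k j else null_measure borel)"
  have "\<nu> = branching_random_walk e Z' x n"
    unfolding \<nu>_def by (rule branching_random_walk_cong) (simp add: Z'_def)
  then have "emeasure \<nu> UNIV < \<infinity>"
    using emeasure_branching_random_walk_finite[of Z' e x n] assms(1,2) by (auto simp: Z'_def)
  then have fin: "finite (indices \<nu>)"
    by (intro indices_finite) (simp_all add: \<nu>_def)
  have "(\<integral>\<^sup>+y. f y \<partial>branching_random_walk e Z x (Suc n)) = (\<Sum>j\<in>indices \<nu>. \<integral>\<^sup>+y. f (y + e j \<nu>) \<partial>Z n j)"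
    using fin assms(1) by (simp add: Let_def nn_integral_superpose_finite shift_in_counting_measures nn_integral_shift flip: \<nu>_def)
  also have "\<dots> = (\<integral>\<^sup>+j. (\<integral>\<^sup>+y. f (y + e j \<nu>) \<partial>Z n j) \<partial>count_space (indices \<nu>))"
    using fin by (simp add: nn_integral_count_space_finite)
  finally show ?thesis
    by (simp add: nn_integral_count_space_suminf)
qed

section \<open>Laplace recursion on the product space of cluster arrays\<close>

locale cluster_law = L: prob_space L
  for L :: "'a::euclidean_space measure measure" +
  fixes e :: "nat \<Rightarrow> 'a measure \<Rightarrow> 'a"
  assumes sets_L [measurable_cong]: "sets L = sets config_space"
    and enum: "point_enumeration e"
    and mean_L: "(\<integral>\<^sup>+\<nu>. emeasure \<nu> UNIV \<partial>L) = 1"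
begin

lemma space_L [simp]: "space L = counting_measures"
  using sets_eq_imp_space_eq[OF sets_L] by simp

lemma AE_finite: "AE \<nu> in L. emeasure \<nu> UNIV < \<infinity>"
  using nn_integral_PInf_AE[of "\<lambda>\<nu>. emeasure \<nu> UNIV" L] mean_L by (auto simp: less_top)

text \<open>Independent clusters indexed by the generation and the label of the parent: all the
  randomness of one branching random walk.\<close>

definition \<Omega> :: "(nat \<times> nat \<Rightarrow> 'a measure) measure" where
  "\<Omega> = PiM UNIV (\<lambda>_. L)"

sublocale \<Omega>: prob_space \<Omega>
  unfolding \<Omega>_def by (intro prob_space_PiM L.prob_space_axioms)

lemma measurable_coord [measurable]: "(\<lambda>z. z t) \<in> \<Omega> \<rightarrow>\<^sub>M config_space"
proof -
  have "(\<lambda>z. z t) \<in> \<Omega> \<rightarrow>\<^sub>M L"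
    unfolding \<Omega>_def by (rule measurable_component_singleton) simp
  then show ?thesis
    by (simp cong: measurable_cong_sets add: measurable_def sets_L)
qed

lemma space_coord: "z \<in> space \<Omega> \<Longrightarrow> z t \<in> counting_measures"
  using measurable_config_space_space[OF measurable_coord] .

lemma distr_coord: "distr \<Omega> L (\<lambda>z. z t) = L"
  unfolding \<Omega>_def by (rule distr_PiM_component) (auto intro: L.prob_space_axioms)

lemma AE_all_finite: "AE z in \<Omega>. \<forall>t. emeasure (z t) UNIV < \<infinity>"
  unfolding AE_all_countable \<Omega>_def
  by (intro allI AE_PiM_component[where P="\<lambda>\<nu>. emeasure \<nu> UNIV < \<infinity>"] AE_finite L.prob_space_axioms) auto

text \<open>One branching step in the Laplace functional: given generation n as the configuration \<open>\<nu>\<close>, the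
  expectation of exp(- sum of h over generation n + 1) is exp(- \<open>\<integral>\<close> offspring h d\<open>\<nu>\<close>).\<close>
definition offspring :: "('a \<Rightarrow> ennreal) \<Rightarrow> 'a \<Rightarrow> ennreal" where
  "offspring h x = nlog (\<integral>\<nu>. nexp (\<integral>\<^sup>+y. h (y + x) \<partial>\<nu>) \<partial>L)"

lemma measurable_nn_integral_L [measurable (raw)]:
  assumes [measurable]: "(\<lambda>(\<omega>, y). f \<omega> y) \<in> borel_measurable (M \<Otimes>\<^sub>M borel)"
    and \<kappa> [measurable]: "\<kappa> \<in> M \<rightarrow>\<^sub>M config_space"
  shows "(\<lambda>\<omega>. \<integral>\<^sup>+y. f \<omega> y \<partial>(\<kappa> \<omega> :: 'a measure)) \<in> borel_measurable M"
  by (rule measurable_nn_integral_config[OF enum assms])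

lemma measurable_offspring [measurable]:
  assumes [measurable]: "h \<in> borel_measurable borel"
  shows "offspring h \<in> borel_measurable borel"
proof -
  have "(\<lambda>(x, \<nu>). nexp (\<integral>\<^sup>+y. h (y + x) \<partial>\<nu>)) \<in> borel_measurable (borel \<Otimes>\<^sub>M L)"
    by measurable
  from L.borel_measurable_lebesgue_integral[OF this] show ?thesis
    unfolding offspring_def[abs_def] by measurable
qed

lemma integral_coord:
  fixes F :: "'a measure \<Rightarrow> real"
  assumes [measurable]: "F \<in> borel_measurable L"
  shows "(\<integral>z. F (z t) \<partial>\<Omega>) = (\<integral>\<nu>. F \<nu> \<partial>L)"
proof -
  have "(\<integral>\<nu>. F \<nu> \<partial>distr \<Omega> L (\<lambda>z. z t)) = (\<integral>z. F (z t) \<partial>\<Omega>)"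
    by (rule integral_distr) measurable
  then show ?thesis
    by (simp add: distr_coord)
qed

lemma indep_coord: "\<Omega>.indep_vars (\<lambda>_. config_space) (\<lambda>j z. z (n, j)) UNIV"
proof -
  have "\<Omega>.indep_vars (\<lambda>_. L) (\<lambda>j z. z (n, j)) UNIV"
    unfolding \<Omega>_def by (rule indep_vars_PiM_coordinates[OF L.prob_space_axioms]) (simp add: inj_def)
  from \<Omega>.indep_vars_compose2[OF this, where Y="\<lambda>_ \<nu>. \<nu>" and N="\<lambda>_. config_space"] show ?thesis
    by (simp add: measurable_ident_sets[OF sets_L])
qed

lemma expectation_offspring:
  assumes \<nu>: "\<nu> \<in> counting_measures" and [measurable]: "h \<in> borel_measurable borel"
  shows "(\<integral>z. nexp (\<Sum>j. if j \<in> indices \<nu> then \<integral>\<^sup>+y. h (y + e j \<nu>) \<partial>z (n, j) else 0) \<partial>\<Omega>) =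
    nexp (\<integral>\<^sup>+y. offspring h y \<partial>\<nu>)"
proof -
  have *: "(\<integral>z. nexp (if j \<in> indices \<nu> then \<integral>\<^sup>+y. h (y + e j \<nu>) \<partial>z (n, j) else 0) \<partial>\<Omega>) =
      (if j \<in> indices \<nu> then \<integral>\<nu>'. nexp (\<integral>\<^sup>+y. h (y + e j \<nu>) \<partial>\<nu>') \<partial>L else 1)" for j
  proof -
    have "(\<lambda>\<nu>'. \<integral>\<^sup>+y. h (y + e j \<nu>) \<partial>\<nu>') \<in> borel_measurable L"
      by (rule measurable_nn_integral_L[OF _ measurable_ident_sets[OF sets_L]]) measurable
    then have "(\<lambda>\<nu>'. nexp (\<integral>\<^sup>+y. h (y + e j \<nu>) \<partial>\<nu>')) \<in> borel_measurable L"
      by measurable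
    from integral_coord[OF this, of "(n, j)"] show ?thesis
      by (simp add: \<Omega>.prob_space)
  qed
  have "(\<integral>z. nexp (\<Sum>j. if j \<in> indices \<nu> then \<integral>\<^sup>+y. h (y + e j \<nu>) \<partial>z (n, j) else 0) \<partial>\<Omega>) =
      nexp (\<Sum>j. nlog (\<integral>z. nexp (if j \<in> indices \<nu> then \<integral>\<^sup>+y. h (y + e j \<nu>) \<partial>z (n, j) else 0) \<partial>\<Omega>))"
    by (rule nlog_nexp_sum_indep[OF \<Omega>.prob_space_axioms indep_coord]) measurable
  also have "(\<Sum>j. nlog (\<integral>z. nexp (if j \<in> indices \<nu> then \<integral>\<^sup>+y. h (y + e j \<nu>) \<partial>z (n, j) else 0) \<partial>\<Omega>)) =
      (\<Sum>j. if j \<in> indices \<nu> then offspring h (e j \<nu>) else 0)"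
    unfolding * by (intro suminf_cong) (simp add: offspring_def)
  also have "\<dots> = (\<integral>\<^sup>+y. offspring h y \<partial>\<nu>)"
    by (rule nn_integral_counting_measure_suminf[OF enum \<nu>, symmetric]) measurable
  finally show ?thesis .
qed

lemma integral_resample:
  fixes F :: "(nat \<times> nat \<Rightarrow> 'a measure) \<Rightarrow> real"
  assumes [measurable]: "F \<in> borel_measurable \<Omega>" and F: "\<And>z. \<bar>F z\<bar> \<le> 1"
  shows "(\<integral>z. F z \<partial>\<Omega>) = (\<integral>z. (\<integral>z'. F (\<lambda>i. if i \<in> D then z' i else z i) \<partial>\<Omega>) \<partial>\<Omega>)"
    and "(\<lambda>(z, z'). F (\<lambda>i. if i \<in> D then z' i else z i)) \<in> borel_measurable (\<Omega> \<Otimes>\<^sub>M \<Omega>)"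
proof -
  interpret P: pair_prob_space \<Omega> \<Omega> ..
  let ?m = "\<lambda>(z, z') i. if i \<in> D then z' i else z i"
  have m [measurable]: "?m \<in> \<Omega> \<Otimes>\<^sub>M \<Omega> \<rightarrow>\<^sub>M \<Omega>"
    unfolding \<Omega>_def
  proof (rule measurable_PiM_single')
    fix i show "(\<lambda>\<omega>. (case \<omega> of (z, z') \<Rightarrow> \<lambda>i. if i \<in> D then z' i else z i) i) \<in>
        PiM UNIV (\<lambda>_::nat\<times>nat. L) \<Otimes>\<^sub>M PiM UNIV (\<lambda>_::nat\<times>nat. L) \<rightarrow>\<^sub>M L"
      by (cases "i \<in> D") (simp_all add: split_beta')
  qed (auto simp: space_pair_measure space_PiM PiE_iff)
  have "(\<lambda>p. F (?m p)) \<in> borel_measurable (\<Omega> \<Otimes>\<^sub>M \<Omega>)"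
    by measurable
  then show M: "(\<lambda>(z, z'). F (\<lambda>i. if i \<in> D then z' i else z i)) \<in> borel_measurable (\<Omega> \<Otimes>\<^sub>M \<Omega>)"
    by (simp add: split_beta')
  have "(\<integral>z. F z \<partial>\<Omega>) = (\<integral>z. F z \<partial>distr (\<Omega> \<Otimes>\<^sub>M \<Omega>) \<Omega> ?m)"
    using PiM_resample[OF L.prob_space_axioms, of D] by (simp add: \<Omega>_def)
  also have "\<dots> = (\<integral>p. F (?m p) \<partial>(\<Omega> \<Otimes>\<^sub>M \<Omega>))"
    by (rule integral_distr) measurable
  also have "\<dots> = (\<integral>z. (\<integral>z'. F (\<lambda>i. if i \<in> D then z' i else z i) \<partial>\<Omega>) \<partial>\<Omega>)"
  proof (subst P.integral_fst'[symmetric])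
    show "integrable (\<Omega> \<Otimes>\<^sub>M \<Omega>) (\<lambda>p. F (?m p))"
      using F by (intro P.P.integrable_const_bound[of _ 1]) auto
  qed simp
  finally show "(\<integral>z. F z \<partial>\<Omega>) = (\<integral>z. (\<integral>z'. F (\<lambda>i. if i \<in> D then z' i else z i) \<partial>\<Omega>) \<partial>\<Omega>)" .
qed

lemma measurable_brw [measurable]: "(\<lambda>z. branching_random_walk e (\<lambda>k j. z (k, j)) x n) \<in> \<Omega> \<rightarrow>\<^sub>M config_space"
  by (rule measurable_branching_random_walk[OF enum]) measurable

text \<open>The induction removes the last generation: averaging over row n replaces h on generation
  n + 1 by \<open>offspring h\<close> on generation n, where it joins f. Hence h is arbitrary in the
  induction. A decomposition at the root would require a relabelling of descendants, because points
  are enumerated generation by generation.\<close>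

lemma laplace_brw:
  assumes [measurable]: "f \<in> borel_measurable borel" "h \<in> borel_measurable borel"
  shows "(\<integral>z. nexp ((\<Sum>m<n. \<integral>\<^sup>+y. f y \<partial>branching_random_walk e (\<lambda>k j. z (k, j)) x m) +
      (\<integral>\<^sup>+y. h y \<partial>branching_random_walk e (\<lambda>k j. z (k, j)) x n)) \<partial>\<Omega>) =
    nexp (((\<lambda>h y. f y + offspring h y) ^^ n) h x)"
  using assms(2)
proof (induction n arbitrary: h)
  case 0
  then show ?case
    by (simp add: \<Omega>.prob_space nn_integral_return)
next
  case (Suc n)
  note [measurable] = Suc.prems
  let ?B = "\<lambda>z. branching_random_walk e (\<lambda>k j. z (k, j)) x"
  let ?S = "\<lambda>z n. \<Sum>m<n. \<integral>\<^sup>+y. f y \<partial>?B z m"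
  define F where "F = (\<lambda>z. nexp (?S z (Suc n) + (\<integral>\<^sup>+y. h y \<partial>?B z (Suc n))))"
  \<comment> \<open>Only row n is redrawn. Generations up to n do not see it, so relative to them it
    is a fresh row of independent clusters.\<close>
  let ?mix = "\<lambda>z z' i. if i \<in> {n} \<times> UNIV then z' i else z i"
  have F [measurable]: "F \<in> borel_measurable \<Omega>"
    unfolding F_def by measurable
  have inner: "(\<integral>z'. F (?mix z z') \<partial>\<Omega>) = nexp (?S z n + (\<integral>\<^sup>+y. f y + offspring h y \<partial>?B z n))"
    if z: "z \<in> space \<Omega>" "\<forall>t. emeasure (z t) UNIV < \<infinity>" for z
  proof -
    have "F (?mix z z') = nexp (?S z (Suc n)) *
        nexp (\<Sum>j. if j \<in> indices (?B z n) then \<integral>\<^sup>+y. h (y + e j (?B z n)) \<partial>z' (n, j) else 0)"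
      if z': "z' \<in> space \<Omega>" for z'
    proof -
      have B: "?B (?mix z z') m = ?B z m" if "m \<le> n" for m
        using that by (intro branching_random_walk_cong) auto
      have "(\<integral>\<^sup>+y. h y \<partial>?B (?mix z z') (Suc n)) =
          (\<Sum>j. if j \<in> indices (?B (?mix z z') n)
            then \<integral>\<^sup>+y. h (y + e j (?B (?mix z z') n)) \<partial>?mix z z' (n, j) else 0)"
        using z z' by (intro nn_integral_branching_random_walk_Suc) (auto simp: space_coord)
      also have "\<dots> = (\<Sum>j. if j \<in> indices (?B z n) then \<integral>\<^sup>+y. h (y + e j (?B z n)) \<partial>z' (n, j) else 0)"
        unfolding B[OF order_refl] by (intro suminf_cong) simp
      finally have "(\<integral>\<^sup>+y. h y \<partial>?B (?mix z z') (Suc n)) = \<dots>" .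
      moreover have "?S (?mix z z') (Suc n) = ?S z (Suc n)"
        by (intro sum.cong refl) (simp only: B less_Suc_eq_le lessThan_iff)
      ultimately show ?thesis
        by (simp only: F_def nexp_add)
    qed
    then have "(\<integral>z'. F (?mix z z') \<partial>\<Omega>) = (\<integral>z'. nexp (?S z (Suc n)) *
        nexp (\<Sum>j. if j \<in> indices (?B z n) then \<integral>\<^sup>+y. h (y + e j (?B z n)) \<partial>z' (n, j) else 0) \<partial>\<Omega>)"
      by (intro Bochner_Integration.integral_cong) auto
    also have "\<dots> = nexp (?S z (Suc n)) * nexp (\<integral>\<^sup>+y. offspring h y \<partial>?B z n)"
      by (simp add: expectation_offspring)
    also have "\<dots> = nexp (?S z n + ((\<integral>\<^sup>+y. f y \<partial>?B z n) + (\<integral>\<^sup>+y. offspring h y \<partial>?B z n)))"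
      by (simp add: nexp_add)
    also have "(\<integral>\<^sup>+y. f y \<partial>?B z n) + (\<integral>\<^sup>+y. offspring h y \<partial>?B z n) = (\<integral>\<^sup>+y. f y + offspring h y \<partial>?B z n)"
      by (rule nn_integral_add[symmetric]) (simp_all add: sets_counting_measures cong: measurable_cong_sets)
    finally show ?thesis .
  qed
  have "(\<integral>z. F z \<partial>\<Omega>) = (\<integral>z. (\<integral>z'. F (?mix z z') \<partial>\<Omega>) \<partial>\<Omega>)"
    by (rule integral_resample(1)[OF F]) (simp add: F_def)
  also have "\<dots> = (\<integral>z. nexp (?S z n + (\<integral>\<^sup>+y. f y + offspring h y \<partial>?B z n)) \<partial>\<Omega>)"
  proof (rule integral_cong_AE)
    show "(\<lambda>z. \<integral>z'. F (?mix z z') \<partial>\<Omega>) \<in> borel_measurable \<Omega>"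
      by (intro \<Omega>.borel_measurable_lebesgue_integral integral_resample(2)[OF F]) (simp add: F_def)
    show "AE z in \<Omega>. (\<integral>z'. F (?mix z z') \<partial>\<Omega>) = nexp (?S z n + (\<integral>\<^sup>+y. f y + offspring h y \<partial>?B z n))"
      using AE_all_finite AE_space by eventually_elim (rule inner)
  qed measurable
  also have "\<dots> = nexp (((\<lambda>h y. f y + offspring h y) ^^ n) (\<lambda>y. f y + offspring h y) x)"
    by (rule Suc.IH) measurable
  finally show ?case
    by (simp only: F_def funpow_Suc_right o_apply)
qed

text \<open>Minus the logarithm of the Laplace functional of the total progeny up to generation n:
  \<open>nexp (cumulant f n x)\<close> is the G n x of the overview.\<close>

definition cumulant :: "('a \<Rightarrow> ennreal) \<Rightarrow> nat \<Rightarrow> 'a \<Rightarrow> ennreal" where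
  "cumulant f n = ((\<lambda>h y. f y + offspring h y) ^^ n) f"

lemma cumulant_0: "cumulant f 0 = f"
  by (simp add: cumulant_def)

lemma cumulant_Suc: "cumulant f (Suc n) y = f y + offspring (cumulant f n) y"
  by (simp add: cumulant_def)

lemma measurable_cumulant [measurable]: "f \<in> borel_measurable borel \<Longrightarrow> cumulant f n \<in> borel_measurable borel"
  by (induction n) (simp_all add: cumulant_0 cumulant_Suc[abs_def])

lemma laplace_total_progeny:
  assumes f [measurable]: "f \<in> borel_measurable borel"
  shows "(\<integral>z. nexp (\<integral>\<^sup>+y. f y \<partial>total_progeny e (\<lambda>k j. z (k, j)) x n) \<partial>\<Omega>) = nexp (cumulant f n x)"
  using laplace_brw[OF f f, of x n]
  by (simp add: nn_integral_total_progeny cumulant_def lessThan_Suc_atMost[symmetric])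

end

section \<open>Convergence of the averaged cumulants\<close>


text \<open>The mean is itself decreasing: a new term is at most each earlier one, hence at most
  their mean.\<close>

lemma convergent_antimono_mean:
  fixes d :: "nat \<Rightarrow> real"
  assumes "antimono d" "\<And>n. 0 \<le> d n"
  shows "convergent (\<lambda>n. (\<Sum>m\<le>n. d m) / (real n + 1))"
proof -
  have "decseq (\<lambda>n. (\<Sum>m\<le>n. d m) / (real n + 1))"
  proof (rule decseq_SucI)
    fix n
    have "(real n + 1) * d (Suc n) = (\<Sum>m\<le>n. d (Suc n))"
      by simp
    also have "\<dots> \<le> (\<Sum>m\<le>n. d m)"
      using antimonoD[OF assms(1)] by (intro sum_mono) simp
    finally show "(\<Sum>m\<le>Suc n. d m) / (real (Suc n) + 1) \<le> (\<Sum>m\<le>n. d m) / (real n + 1)"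
      by (simp add: divide_simps) (simp add: algebra_simps)
  qed
  moreover have "\<forall>n. 0 \<le> (\<Sum>m\<le>n. d m) / (real n + 1)"
    using assms(2) by (auto intro!: divide_nonneg_nonneg sum_nonneg)
  ultimately obtain L where "(\<lambda>n. (\<Sum>m\<le>n. d m) / (real n + 1)) \<longlonglongrightarrow> L"
    by (rule decseq_convergent)
  then show ?thesis
    by (rule convergentI)
qed

text \<open>\<open>nexp\<close> of the integral is the product of \<open>nexp (h y)\<close> over the
  points y of the configuration, so the Lipschitz bound for products in [0, 1] applies.\<close>

lemma nexp_nn_integral_diff_le:
  fixes \<nu> :: "'a::euclidean_space measure" and e :: "nat \<Rightarrow> 'a measure \<Rightarrow> 'a"
  assumes e: "point_enumeration e" and \<nu>: "\<nu> \<in> counting_measures"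
    and [measurable]: "h \<in> borel_measurable borel" "h' \<in> borel_measurable borel" and le: "\<And>y. h y \<le> h' y"
  shows "ennreal (nexp (\<integral>\<^sup>+y. h y \<partial>\<nu>) - nexp (\<integral>\<^sup>+y. h' y \<partial>\<nu>)) \<le>
    (\<integral>\<^sup>+y. ennreal (nexp (h y) - nexp (h' y)) \<partial>\<nu>)"
proof -
  let ?a = "\<lambda>h j. if j \<in> indices \<nu> then nexp (h (e j \<nu>)) else 1"
  have *: "(\<integral>\<^sup>+y. h y \<partial>\<nu>) = (\<Sum>j. nlog (?a h j))" if [measurable]: "h \<in> borel_measurable borel" for h
    by (subst nn_integral_counting_measure_suminf[OF e \<nu>]) (auto simp: nlog_nexp intro!: suminf_cong)
  have "ennreal (nexp (\<Sum>j. nlog (?a h j)) - nexp (\<Sum>j. nlog (?a h' j))) \<le> (\<Sum>j. ennreal (?a h j - ?a h' j))"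
    by (intro nexp_nlog_diff_le) (auto simp: nexp_antimono le)
  also have "\<dots> = (\<integral>\<^sup>+y. ennreal (nexp (h y) - nexp (h' y)) \<partial>\<nu>)"
    by (subst nn_integral_counting_measure_suminf[OF e \<nu>]) (auto intro!: suminf_cong)
  finally show ?thesis
    by (simp add: *)
qed

lemma nn_integral_lborel_translate:
  fixes a :: "'a::euclidean_space"
  assumes [measurable]: "g \<in> borel_measurable borel"
  shows "(\<integral>\<^sup>+x. g (a + x) \<partial>lborel) = (\<integral>\<^sup>+x. g x \<partial>lborel)"
proof -
  have "(\<integral>\<^sup>+x. g x \<partial>lborel) = (\<integral>\<^sup>+x. g x \<partial>distr lborel borel ((+) a))"
    by (simp add: lborel_distr_plus)
  also have "\<dots> = (\<integral>\<^sup>+x. g (a + x) \<partial>lborel)"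
    by (subst nn_integral_distr) auto
  finally show ?thesis ..
qed

section \<open>Criticality and the decreasing increments\<close>

context cluster_law
begin

text \<open>For a fixed configuration every point contributes the same Lebesgue integral of g, by
  translation invariance; the total is this integral times the number of points. This is where the
  value 1 of the mean enters.\<close>

lemma nn_integral_cluster_translate:
  assumes [measurable]: "g \<in> borel_measurable borel"
  shows "(\<integral>\<^sup>+x. (\<integral>\<^sup>+\<nu>. (\<integral>\<^sup>+y. g (y + x) \<partial>\<nu>) \<partial>L) \<partial>lborel) = (\<integral>\<^sup>+x. g x \<partial>lborel)"
proof -
  interpret pair_sigma_finite lborel L ..
  have [measurable]: "snd \<in> lborel \<Otimes>\<^sub>M L \<rightarrow>\<^sub>M config_space"
    using measurable_snd[of lborel L] by (simp add: measurable_def sets_L)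
  have "(\<lambda>p. \<integral>\<^sup>+y. g (y + fst p) \<partial>snd p) \<in> borel_measurable (lborel \<Otimes>\<^sub>M L)"
    by (rule measurable_nn_integral_L) measurable
  then have m: "(\<lambda>(x, \<nu>). \<integral>\<^sup>+y. g (y + x) \<partial>\<nu>) \<in> borel_measurable (lborel \<Otimes>\<^sub>M L)"
    by (simp add: split_beta')
  have "(\<integral>\<^sup>+x. (\<integral>\<^sup>+\<nu>. (\<integral>\<^sup>+y. g (y + x) \<partial>\<nu>) \<partial>L) \<partial>lborel) = (\<integral>\<^sup>+\<nu>. (\<integral>\<^sup>+x. (\<integral>\<^sup>+y. g (y + x) \<partial>\<nu>) \<partial>lborel) \<partial>L)"
    using Fubini'[OF m] by simp
  also have "\<dots> = (\<integral>\<^sup>+\<nu>. (\<integral>\<^sup>+x. g x \<partial>lborel) * emeasure \<nu> UNIV \<partial>L)"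
  proof (rule nn_integral_cong)
    fix \<nu> assume "\<nu> \<in> space L"
    then have \<nu>: "\<nu> \<in> counting_measures" by simp
    have "(\<integral>\<^sup>+x. (\<integral>\<^sup>+y. g (y + x) \<partial>\<nu>) \<partial>lborel) = (\<integral>\<^sup>+x. (\<Sum>j. if j \<in> indices \<nu> then g (e j \<nu> + x) else 0) \<partial>lborel)"
      by (intro nn_integral_cong nn_integral_counting_measure_suminf[OF enum \<nu>]) measurable
    also have "\<dots> = (\<Sum>j. \<integral>\<^sup>+x. (if j \<in> indices \<nu> then g (e j \<nu> + x) else 0) \<partial>lborel)"
      by (intro nn_integral_suminf) measurable
    also have "\<dots> = (\<Sum>j. if j \<in> indices \<nu> then (\<integral>\<^sup>+x. g x \<partial>lborel) else 0)"
      by (intro suminf_cong) (simp add: nn_integral_lborel_translate)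
    also have "\<dots> = (\<integral>\<^sup>+y. (\<integral>\<^sup>+x. g x \<partial>lborel) \<partial>\<nu>)"
      by (subst nn_integral_counting_measure_suminf[OF enum \<nu>]) auto
    also have "\<dots> = (\<integral>\<^sup>+x. g x \<partial>lborel) * emeasure \<nu> UNIV"
      using \<nu> by (simp add: space_counting_measures)
    finally show "(\<integral>\<^sup>+x. (\<integral>\<^sup>+y. g (y + x) \<partial>\<nu>) \<partial>lborel) = (\<integral>\<^sup>+x. g x \<partial>lborel) * emeasure \<nu> UNIV" .
  qed
  also have "\<dots> = (\<integral>\<^sup>+x. g x \<partial>lborel)"
    using measurable_emeasure_config[of UNIV]
    by (subst nn_integral_cmult) (auto simp: mean_L measurable_cong_sets[OF sets_L refl])
  finally show ?thesis .
qed

lemma measurable_nexp_nn_integral_L: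
  assumes [measurable]: "h \<in> borel_measurable borel"
  shows "(\<lambda>\<nu>. nexp (\<integral>\<^sup>+y. h (y + x) \<partial>\<nu>)) \<in> borel_measurable L"
proof -
  have "(\<lambda>\<nu>. \<integral>\<^sup>+y. h (y + x) \<partial>\<nu>) \<in> borel_measurable L"
    by (rule measurable_nn_integral_L[OF _ measurable_ident_sets[OF sets_L]]) measurable
  then show ?thesis
    by measurable
qed

lemma offspring_mono:
  assumes [measurable]: "h \<in> borel_measurable borel" "h' \<in> borel_measurable borel" and le: "\<And>y. h y \<le> h' y"
  shows "offspring h x \<le> offspring h' x"
  unfolding offspring_def
  by (intro nlog_antimono integral_mono L.integrable_const_bound[of _ 1] nexp_antimono nn_integral_mono le
        measurable_nexp_nn_integral_L) auto

text \<open>The cumulants shifted by one, so that the recursion starts from 0.\<close>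
definition pcumulant :: "('a \<Rightarrow> ennreal) \<Rightarrow> nat \<Rightarrow> 'a \<Rightarrow> ennreal" where
  "pcumulant f n = (case n of 0 \<Rightarrow> \<lambda>_. 0 | Suc m \<Rightarrow> cumulant f m)"

lemma pcumulant_0: "pcumulant f 0 = (\<lambda>_. 0)"
  by (simp add: pcumulant_def)

lemma pcumulant_Suc: "pcumulant f (Suc n) x = f x + offspring (pcumulant f n) x"
proof (cases n)
  case 0
  then show ?thesis
    by (simp add: pcumulant_def cumulant_0 offspring_def L.prob_space[unfolded space_L])
qed (simp add: pcumulant_def cumulant_Suc)

lemma measurable_pcumulant [measurable]:
  "f \<in> borel_measurable borel \<Longrightarrow> pcumulant f n \<in> borel_measurable borel"
  by (simp add: pcumulant_def split: nat.split)

lemma pcumulant_mono: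
  assumes [measurable]: "f \<in> borel_measurable borel"
  shows "pcumulant f n x \<le> pcumulant f (Suc n) x"
proof (induction n arbitrary: x)
  case (Suc n)
  then show ?case
    unfolding pcumulant_Suc[of f n] pcumulant_Suc[of f "Suc n"]
    by (intro add_mono offspring_mono) auto
qed (simp add: pcumulant_0)

text \<open>The difference is taken inside the integral because its two terms need not be Lebesgue
  integrable: for n = 0 the first one is the constant 1.\<close>

definition increment :: "('a \<Rightarrow> ennreal) \<Rightarrow> nat \<Rightarrow> ennreal" where
  "increment f n = (\<integral>\<^sup>+x. ennreal (nexp (pcumulant f n x) - nexp (pcumulant f (Suc n) x)) \<partial>lborel)"

text \<open>Criticality makes the increments decrease: products over a cluster are Lipschitz, the cluster
  has mean mass 1, and Lebesgue measure is translation invariant.\<close>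
lemma increment_Suc_le:
  assumes [measurable]: "f \<in> borel_measurable borel"
  shows "increment f (Suc n) \<le> increment f n"
proof -
  let ?c = "pcumulant f"
  let ?E = "\<lambda>n x \<nu>. nexp (\<integral>\<^sup>+y. ?c n (y + x) \<partial>\<nu>)"
  have [measurable]: "?E n x \<in> borel_measurable L" for n x
    by (rule measurable_nexp_nn_integral_L) measurable
  have int: "integrable L (?E n x)" for n x
    by (intro L.integrable_const_bound[of _ 1]) auto
  have mono: "?E (Suc n) x \<nu> \<le> ?E n x \<nu>" for x \<nu>
    by (intro nexp_antimono nn_integral_mono pcumulant_mono) simp
  have E: "nexp (?c (Suc n) x) = nexp (f x) * (\<integral>\<nu>. ?E n x \<nu> \<partial>L)" for n x
    by (simp add: pcumulant_Suc nexp_add offspring_def nexp_nlog L.expectation_nexp_le_1)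
  have "ennreal (nexp (?c (Suc n) x) - nexp (?c (Suc (Suc n)) x)) \<le>
      (\<integral>\<^sup>+\<nu>. (\<integral>\<^sup>+y. ennreal (nexp (?c n (y + x)) - nexp (?c (Suc n) (y + x))) \<partial>\<nu>) \<partial>L)" for x
  proof -
    have "nexp (?c (Suc n) x) - nexp (?c (Suc (Suc n)) x) = nexp (f x) * (\<integral>\<nu>. ?E n x \<nu> - ?E (Suc n) x \<nu> \<partial>L)"
      by (simp add: E Bochner_Integration.integral_diff[OF int int] algebra_simps)
    also have "\<dots> \<le> 1 * (\<integral>\<nu>. ?E n x \<nu> - ?E (Suc n) x \<nu> \<partial>L)"
      using mono by (intro mult_right_mono integral_nonneg_AE) auto
    finally have "ennreal (nexp (?c (Suc n) x) - nexp (?c (Suc (Suc n)) x)) \<le>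
        ennreal (\<integral>\<nu>. ?E n x \<nu> - ?E (Suc n) x \<nu> \<partial>L)"
      by (intro ennreal_leI) simp
    also have "\<dots> = (\<integral>\<^sup>+\<nu>. ennreal (?E n x \<nu> - ?E (Suc n) x \<nu>) \<partial>L)"
      using mono by (intro nn_integral_eq_integral[symmetric] Bochner_Integration.integrable_diff int) auto
    also have "\<dots> \<le> (\<integral>\<^sup>+\<nu>. (\<integral>\<^sup>+y. ennreal (nexp (?c n (y + x)) - nexp (?c (Suc n) (y + x))) \<partial>\<nu>) \<partial>L)"
      by (intro nn_integral_mono nexp_nn_integral_diff_le[OF enum] pcumulant_mono) auto
    finally show ?thesis .
  qed
  then have "increment f (Suc n) \<le>
      (\<integral>\<^sup>+x. (\<integral>\<^sup>+\<nu>. (\<integral>\<^sup>+y. ennreal (nexp (?c n (y + x)) - nexp (?c (Suc n) (y + x))) \<partial>\<nu>) \<partial>L) \<partial>lborel)"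
    unfolding increment_def by (intro nn_integral_mono) simp
  also have "\<dots> = increment f n"
    unfolding increment_def by (rule nn_integral_cluster_translate) measurable
  finally show ?thesis .
qed

lemma increment_le:
  assumes [measurable]: "f \<in> borel_measurable borel"
  shows "increment f n \<le> (\<integral>\<^sup>+x. f x \<partial>lborel)"
proof (induction n)
  case 0
  show ?case
    unfolding increment_def
    by (intro nn_integral_mono) (simp add: pcumulant_0 pcumulant_Suc offspring_def L.prob_space[unfolded space_L] one_minus_nexp_le)
next
  case (Suc n)
  then show ?case
    using increment_Suc_le[OF assms, of n] by simp
qed

text \<open>The sum telescopes, starting from the constant 1. It has n + 1 terms, the number by
  which the thinning at stage n divides.\<close>

lemma nn_integral_cumulant:
  assumes [measurable]: "f \<in> borel_measurable borel"
  shows "(\<integral>\<^sup>+x. ennreal (1 - nexp (cumulant f n x)) \<partial>lborel) = (\<Sum>m\<le>n. increment f m)"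
proof -
  have "ennreal (1 - nexp (cumulant f n x)) =
      (\<Sum>m\<le>n. ennreal (nexp (pcumulant f m x) - nexp (pcumulant f (Suc m) x)))" for x
  proof -
    have "(\<Sum>m\<le>n. ennreal (nexp (pcumulant f m x) - nexp (pcumulant f (Suc m) x))) =
        ennreal (\<Sum>m\<le>n. nexp (pcumulant f m x) - nexp (pcumulant f (Suc m) x))"
      by (intro sum_ennreal) (auto intro!: nexp_antimono pcumulant_mono assms)
    also have "(\<Sum>m\<le>n. nexp (pcumulant f m x) - nexp (pcumulant f (Suc m) x)) = 1 - nexp (cumulant f n x)"
      by (subst sum_telescope) (simp add: pcumulant_def)
    finally show ?thesis ..
  qed
  then show ?thesis
    unfolding increment_def by (simp add: nn_integral_sum)
qed

text \<open>Each of the n + 1 increments is at most the integral of f, and the factor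
  \<open>1 / (real n + 1)\<close> cancels their number: thinning compensates the growing depth of
  the trees, uniformly in n.\<close>

lemma nn_integral_cumulant_le:
  assumes "f \<in> borel_measurable borel"
  shows "ennreal (1 / (real n + 1)) * (\<integral>\<^sup>+x. ennreal (1 - nexp (cumulant f n x)) \<partial>lborel) \<le> (\<integral>\<^sup>+x. f x \<partial>lborel)"
proof -
  have "(\<Sum>m\<le>n. increment f m) \<le> (\<Sum>m\<le>n. (\<integral>\<^sup>+x. f x \<partial>lborel))"
    by (intro sum_mono increment_le assms)
  also have "\<dots> = ennreal (real n + 1) * (\<integral>\<^sup>+x. f x \<partial>lborel)"
    by (simp add: ennreal_of_nat_eq_real_of_nat ennreal_plus[symmetric] add.commute del: ennreal_plus)
  finally have "ennreal (1 / (real n + 1)) * (\<Sum>m\<le>n. increment f m) \<le>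
      ennreal (1 / (real n + 1)) * (ennreal (real n + 1) * (\<integral>\<^sup>+x. f x \<partial>lborel))"
    by (rule mult_left_mono) simp
  also have "\<dots> = (\<integral>\<^sup>+x. f x \<partial>lborel)"
    by (simp add: mult.assoc[symmetric] ennreal_mult[symmetric] del: ennreal_plus)
  finally show ?thesis
    by (simp add: nn_integral_cumulant assms)
qed

lemma convergent_nn_integral_cumulant:
  assumes f: "f \<in> borel_measurable borel" and fin: "(\<integral>\<^sup>+x. f x \<partial>lborel) < \<infinity>"
  obtains a where "(\<lambda>n. ennreal (1 / (real n + 1)) * (\<integral>\<^sup>+x. ennreal (1 - nexp (cumulant f n x)) \<partial>lborel)) \<longlonglongrightarrow> ennreal a"
proof -
  have fi: "increment f n < \<infinity>" for n
    using increment_le[OF f, of n] fin by (rule order.strict_trans1)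
  define d where "d = (\<lambda>n. enn2real (increment f n))"
  have d: "increment f n = ennreal (d n)" for n
    using fi[of n] by (simp add: d_def less_top)
  have "antimono d"
    unfolding decseq_Suc_iff d_def using fi by (auto intro!: enn2real_mono increment_Suc_le f simp: less_top)
  then have "convergent (\<lambda>n. (\<Sum>m\<le>n. d m) / (real n + 1))"
    by (rule convergent_antimono_mean) (simp add: d_def)
  then obtain a where "(\<lambda>n. (\<Sum>m\<le>n. d m) / (real n + 1)) \<longlonglongrightarrow> a"
    by (auto simp: convergent_def)
  then have "(\<lambda>n. ennreal ((\<Sum>m\<le>n. d m) / (real n + 1))) \<longlonglongrightarrow> ennreal a"
    by (rule tendsto_ennrealI)
  moreover have "ennreal ((\<Sum>m\<le>n. d m) / (real n + 1)) =
      ennreal (1 / (real n + 1)) * (\<integral>\<^sup>+x. ennreal (1 - nexp (cumulant f n x)) \<partial>lborel)" for n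
  proof -
    have nn: "0 \<le> d m" for m
      by (simp add: d_def)
    have "(\<integral>\<^sup>+x. ennreal (1 - nexp (cumulant f n x)) \<partial>lborel) = ennreal (\<Sum>m\<le>n. d m)"
      by (simp add: nn_integral_cumulant f d sum_ennreal nn)
    then show ?thesis
      by (simp add: ennreal_mult[symmetric] sum_nonneg nn)
  qed
  ultimately show thesis
    using that by simp
qed

end

section \<open>Laplace functional of a Poisson process\<close>


text \<open>The transform is split by the value of the count and becomes an exponential series. In
  \<open>ennreal\<close>, expectation and sum commute by monotone convergence.\<close>

lemma poisson_laplace_count:
  assumes "poisson_process M c \<mu>" and B: "B \<in> sets borel" "bounded B" and a: "0 \<le> a" and c: "0 \<le> c"
  shows "(\<integral>\<omega>. nexp (ennreal a * emeasure (\<mu> \<omega>) B) \<partial>M) = exp (- (c * measure lborel B * (1 - exp (- a))))"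
proof -
  interpret prob_space M
    using assms(1) by (simp add: poisson_process_def point_process_def)
  have \<mu> [measurable]: "\<mu> \<in> M \<rightarrow>\<^sub>M config_space"
    using assms(1) by (simp add: poisson_process_def point_process_def)
  note [measurable] = B(1)
  let ?l = "c * measure lborel B"
  let ?A = "\<lambda>k::nat. {\<omega>\<in>space M. emeasure (\<mu> \<omega>) B = of_nat k}"
  have P: "measure M (?A k) = exp (- ?l) * ?l ^ k / fact k" for k
    using assms(1) B by (simp add: poisson_process_def)
  have eq: "ennreal (nexp (ennreal a * emeasure (\<mu> \<omega>) B)) = (\<Sum>k. ennreal (exp (- (a * real k))) * indicator (?A k) \<omega>)"
    if \<omega>: "\<omega> \<in> space M" for \<omega>
  proof -
    note \<nu> = measurable_config_space_space[OF \<mu> \<omega>]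
    obtain m :: nat where m: "emeasure (\<mu> \<omega>) B = of_nat m"
      using emeasure_counting_measures_nat[OF \<nu> B(1)] emeasure_counting_measures_finite[OF \<nu> B] by blast
    have "(\<Sum>k. ennreal (exp (- (a * real k))) * indicator (?A k) \<omega>) =
        (\<Sum>k\<in>{m}. ennreal (exp (- (a * real k))) * indicator (?A k) \<omega>)"
      by (rule suminf_finite) (auto simp: m)
    also have "\<dots> = ennreal (exp (- (a * real m)))"
      using \<omega> by (simp add: m)
    also have "exp (- (a * real m)) = nexp (ennreal a * emeasure (\<mu> \<omega>) B)"
      using a by (simp add: m ennreal_of_nat_eq_real_of_nat ennreal_mult[symmetric] nexp_ennreal)
    finally show ?thesis ..
  qed
  have "(\<integral>\<^sup>+\<omega>. ennreal (nexp (ennreal a * emeasure (\<mu> \<omega>) B)) \<partial>M) =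
      (\<Sum>k. \<integral>\<^sup>+\<omega>. ennreal (exp (- (a * real k))) * indicator (?A k) \<omega> \<partial>M)"
    by (subst nn_integral_suminf[symmetric]) (auto intro!: nn_integral_cong eq)
  also have "\<dots> = (\<Sum>k. ennreal (exp (- ?l) * ((exp (- a) * ?l) ^ k /\<^sub>R fact k)))"
  proof (intro suminf_cong)
    fix k
    have "(\<integral>\<^sup>+\<omega>. ennreal (exp (- (a * real k))) * indicator (?A k) \<omega> \<partial>M) = ennreal (exp (- (a * real k))) * emeasure M (?A k)"
      by (rule nn_integral_cmult_indicator) measurable
    also have "\<dots> = ennreal (exp (- (a * real k)) * (exp (- ?l) * ?l ^ k / fact k))"
      by (simp add: emeasure_eq_measure P ennreal_mult[symmetric] c)
    also have "exp (- (a * real k)) * (exp (- ?l) * ?l ^ k / fact k) = exp (- ?l) * ((exp (- a) * ?l) ^ k /\<^sub>R fact k)"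
      by (simp add: exp_of_nat_mult[of k "- a", symmetric] power_mult_distrib divide_inverse mult_ac)
    finally show "(\<integral>\<^sup>+\<omega>. ennreal (exp (- (a * real k))) * indicator (?A k) \<omega> \<partial>M) =
        ennreal (exp (- ?l) * ((exp (- a) * ?l) ^ k /\<^sub>R fact k))" .
  qed
  also have "\<dots> = ennreal (exp (- ?l) * exp (exp (- a) * ?l))"
    using c by (intro suminf_ennreal_eq sums_mult exp_converges) auto
  also have "exp (- ?l) * exp (exp (- a) * ?l) = exp (- (?l * (1 - exp (- a))))"
    by (simp add: exp_add[symmetric] algebra_simps)
  finally have "(\<integral>\<^sup>+\<omega>. ennreal (nexp (ennreal a * emeasure (\<mu> \<omega>) B)) \<partial>M) = ennreal (exp (- (?l * (1 - exp (- a)))))" .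
  then show ?thesis
    by (subst integral_eq_nn_integral) auto
qed

lemma poisson_laplace_disjoint:
  fixes A :: "nat \<Rightarrow> 'a::euclidean_space set"
  assumes p: "poisson_process M c \<mu>" and A: "\<And>i. i < m \<Longrightarrow> A i \<in> sets borel" "\<And>i. i < m \<Longrightarrow> bounded (A i)"
    and dj: "disjoint_family_on A {..<m}" and a: "\<And>i. i < m \<Longrightarrow> 0 \<le> a i" and c: "0 \<le> c"
  shows "(\<integral>\<omega>. nexp (\<Sum>i<m. ennreal (a i) * emeasure (\<mu> \<omega>) (A i)) \<partial>M) =
    exp (- (\<Sum>i<m. c * measure lborel (A i) * (1 - exp (- a i))))"
proof -
  interpret prob_space M
    using p by (simp add: poisson_process_def point_process_def)
  have ind: "indep_vars (\<lambda>_. borel) (\<lambda>i \<omega>. emeasure (\<mu> \<omega>) (A i)) {..<m}"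
    using p A dj by (auto simp: poisson_process_def)
  have ind': "indep_vars (\<lambda>_. borel) (\<lambda>i \<omega>. nexp (ennreal (a i) * emeasure (\<mu> \<omega>) (A i))) {..<m}"
    by (rule indep_vars_compose2[OF ind, where Y="\<lambda>i x. nexp (ennreal (a i) * x)"]) measurable
  have "(\<integral>\<omega>. nexp (\<Sum>i<m. ennreal (a i) * emeasure (\<mu> \<omega>) (A i)) \<partial>M) =
      (\<integral>\<omega>. (\<Prod>i<m. nexp (ennreal (a i) * emeasure (\<mu> \<omega>) (A i))) \<partial>M)"
    by (simp add: nexp_sum)
  also have "\<dots> = (\<Prod>i<m. \<integral>\<omega>. nexp (ennreal (a i) * emeasure (\<mu> \<omega>) (A i)) \<partial>M)"
    using ind' unfolding indep_vars_def
    by (intro indep_vars_lebesgue_integral ind' integrable_const_bound[of _ 1]) auto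
  also have "\<dots> = (\<Prod>i<m. exp (- (c * measure lborel (A i) * (1 - exp (- a i)))))"
    using A a c by (intro prod.cong poisson_laplace_count[OF p]) auto
  finally show ?thesis
    by (simp add: exp_sum sum_negf[symmetric])
qed

text \<open>Cutting off by a ball makes the level sets bounded, as the laws of counts in
  \<open>poisson_process\<close> require; the level sets are disjoint, so their counts are
  independent.\<close>

lemma poisson_laplace_simple:
  fixes s :: "'a::euclidean_space \<Rightarrow> ennreal" and r :: real
  assumes p: "poisson_process M c \<mu>" and c: "0 \<le> c"
    and s: "simple_function borel s" "\<And>x. s x < \<top>"
  defines "h \<equiv> \<lambda>x. s x * indicator (ball 0 r) x"
  shows "(\<integral>\<omega>. nexp (\<integral>\<^sup>+x. h x \<partial>\<mu> \<omega>) \<partial>M) = nexp (ennreal c * (\<integral>\<^sup>+x. ennreal (1 - nexp (h x)) \<partial>lborel))"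
proof -
  have \<mu>: "\<mu> \<in> M \<rightarrow>\<^sub>M config_space"
    using p by (simp add: poisson_process_def point_process_def)
  have "finite (range s)"
    using s(1) by (simp add: simple_function_def)
  then obtain g where g: "bij_betw g {..<card (range s)} (range s)"
    using ex_bij_betw_nat_finite[of "range s"] by (auto simp: atLeast0LessThan)
  define m where "m = card (range s)"
  define A where "A = (\<lambda>i. s -` {g i} \<inter> ball 0 r)"
  define a where "a = (\<lambda>i. enn2real (g i))"
  have g': "inj_on g {..<m}" "g ` {..<m} = range s"
    using g by (auto simp: bij_betw_def m_def)
  have ga: "g i = ennreal (a i)" "0 \<le> a i" if "i < m" for i
  proof -
    have "g i \<in> range s" using that g'(2) by blast
    then show "g i = ennreal (a i)" "0 \<le> a i"
      using s(2) by (auto simp: a_def)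
  qed
  have A [measurable]: "A i \<in> sets borel" for i
    using simple_functionD(2)[OF s(1), of "{g i}"] by (simp add: A_def)
  have bA: "bounded (A i)" for i
    unfolding A_def by (intro bounded_Int) auto
  have dj: "disjoint_family_on A {..<m}"
    using g'(1) by (auto simp: disjoint_family_on_def A_def inj_on_def)
  \<comment> \<open>Any function that vanishes at 0 acts on h level set by level set. This is used
    for the identity on the side of the process and for 1 - \<open>nexp\<close> on the side of
    Lebesgue measure.\<close>
  have F: "F (h x) = (\<Sum>i<m. F (g i) * indicator (A i) x)" if F: "F 0 = 0" for F :: "ennreal \<Rightarrow> ennreal" and x
  proof (cases "x \<in> ball 0 r")
    case True
    have "s x \<in> g ` {..<m}"
      unfolding g'(2) by simp
    then obtain i where i: "i < m" "s x = g i"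
      by auto
    have "(\<Sum>i<m. F (g i) * indicator (A i) x) = (\<Sum>i\<in>{i}. F (g i) * indicator (A i) x)"
      using i g'(1) by (intro sum.mono_neutral_right) (auto simp: A_def inj_on_def indicator_def)
    also have "\<dots> = F (g i)"
      using True i by (simp add: A_def)
    also have "\<dots> = F (h x)"
      using True i by (simp add: h_def)
    finally show ?thesis ..
  qed (simp add: h_def A_def F)
  have "(\<integral>\<^sup>+x. h x \<partial>\<mu> \<omega>) = (\<Sum>i<m. ennreal (a i) * emeasure (\<mu> \<omega>) (A i))" if "\<omega> \<in> space M" for \<omega>
  proof -
    note [simp] = sets_counting_measures[OF measurable_config_space_space[OF \<mu> that]]
    have "(\<integral>\<^sup>+x. h x \<partial>\<mu> \<omega>) = (\<integral>\<^sup>+x. (\<Sum>i<m. g i * indicator (A i) x) \<partial>\<mu> \<omega>)"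
      using F[of "\<lambda>x. x"] by simp
    also have "\<dots> = (\<Sum>i<m. g i * emeasure (\<mu> \<omega>) (A i))"
      by (subst nn_integral_sum) (auto intro!: sum.cong nn_integral_cmult_indicator cong: measurable_cong_sets)
    finally show ?thesis
      using ga by simp
  qed
  then have "(\<integral>\<omega>. nexp (\<integral>\<^sup>+x. h x \<partial>\<mu> \<omega>) \<partial>M) = (\<integral>\<omega>. nexp (\<Sum>i<m. ennreal (a i) * emeasure (\<mu> \<omega>) (A i)) \<partial>M)"
    by (intro Bochner_Integration.integral_cong) auto
  also have "\<dots> = exp (- (\<Sum>i<m. c * measure lborel (A i) * (1 - exp (- a i))))"
    using bA ga by (intro poisson_laplace_disjoint[OF p _ _ dj _ c]) auto
  also have "\<dots> = nexp (ennreal (c * (\<Sum>i<m. (1 - exp (- a i)) * measure lborel (A i))))"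
    using ga c by (subst nexp_ennreal) (auto intro!: mult_nonneg_nonneg sum_nonneg simp: sum_distrib_left mult_ac)
  also have "ennreal (c * (\<Sum>i<m. (1 - exp (- a i)) * measure lborel (A i))) =
      ennreal c * (\<Sum>i<m. ennreal ((1 - exp (- a i)) * measure lborel (A i)))"
    using ga c by (subst sum_ennreal) (auto intro!: ennreal_mult mult_nonneg_nonneg sum_nonneg)
  also have "(\<Sum>i<m. ennreal ((1 - exp (- a i)) * measure lborel (A i))) = (\<Sum>i<m. ennreal (1 - nexp (g i)) * emeasure lborel (A i))"
  proof (intro sum.cong refl)
    fix i assume "i \<in> {..<m}"
    then show "ennreal ((1 - exp (- a i)) * measure lborel (A i)) = ennreal (1 - nexp (g i)) * emeasure lborel (A i)"
      using ga[of i] emeasure_bounded_finite[OF bA[of i]]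
      by (simp add: nexp_ennreal ennreal_mult emeasure_eq_ennreal_measure)
  qed
  also have "\<dots> = (\<integral>\<^sup>+x. (\<Sum>i<m. ennreal (1 - nexp (g i)) * indicator (A i) x) \<partial>lborel)"
    by (subst nn_integral_sum) (auto intro!: sum.cong nn_integral_cmult_indicator[symmetric])
  also have "\<dots> = (\<integral>\<^sup>+x. ennreal (1 - nexp (h x)) \<partial>lborel)"
    using F[of "\<lambda>y. ennreal (1 - nexp y)"] by simp
  finally show ?thesis .
qed

text \<open>Approximation from below by simple functions with bounded support. With 1 -
  \<open>nexp\<close> under the Lebesgue integral the integrands increase, so monotone convergence
  covers infinite integrals too.\<close>

lemma poisson_laplace:
  fixes h :: "'a::euclidean_space \<Rightarrow> ennreal"
  assumes p: "poisson_process M c \<mu>" and c: "0 \<le> c" and e: "point_enumeration (e :: nat \<Rightarrow> 'a measure \<Rightarrow> 'a)"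
    and [measurable]: "h \<in> borel_measurable borel"
  shows "(\<integral>\<omega>. nexp (\<integral>\<^sup>+x. h x \<partial>\<mu> \<omega>) \<partial>M) = nexp (ennreal c * (\<integral>\<^sup>+x. ennreal (1 - nexp (h x)) \<partial>lborel))"
proof -
  interpret prob_space M
    using p by (simp add: poisson_process_def point_process_def)
  have \<mu> [measurable]: "\<mu> \<in> M \<rightarrow>\<^sub>M config_space"
    using p by (simp add: poisson_process_def point_process_def)
  obtain s where s: "\<And>i. simple_function borel (s i)" "incseq s" "\<And>i x. s i x < \<top>" "\<And>x. (SUP i. s i x) = h x"
    using borel_measurable_implies_simple_function_sequence'[of h borel] by auto
  define g where "g = (\<lambda>n x. s n x * indicator (ball 0 (real n)) x)"
  have [measurable]: "g n \<in> borel_measurable borel" for n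
    unfolding g_def by (intro borel_measurable_times_ennreal borel_measurable_indicator borel_measurable_simple_function[OF s(1)]) auto
  have inc: "g n x \<le> g (Suc n) x" for n x
    using s(2) by (auto simp: g_def incseq_Suc_iff le_fun_def split: split_indicator)
  then have incseq: "incseq (\<lambda>n. g n x)" for x
    by (rule incseq_SucI)
  have lim: "(\<lambda>n. g n x) \<longlonglongrightarrow> h x" for x
  proof -
    have "(\<lambda>n. s n x) \<longlonglongrightarrow> h x"
      using s(2) LIMSEQ_SUP[of "\<lambda>n. s n x"] by (simp add: s(4) incseq_def le_fun_def)
    moreover have "eventually (\<lambda>n. s n x = g n x) sequentially"
    proof -
      obtain N :: nat where "norm x < real N"
        using reals_Archimedean2 by auto
      then show ?thesis
        by (intro eventually_sequentiallyI[of N]) (auto simp: g_def split: split_indicator)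
    qed
    ultimately show ?thesis
      by (rule Lim_transform_eventually)
  qed
  have [measurable]: "(\<lambda>\<omega>. \<integral>\<^sup>+x. g n x \<partial>\<mu> \<omega>) \<in> borel_measurable M" "(\<lambda>\<omega>. \<integral>\<^sup>+x. h x \<partial>\<mu> \<omega>) \<in> borel_measurable M" for n
    by (intro measurable_nn_integral_config[OF e _ \<mu>]; measurable)+
  have "(\<lambda>n. \<integral>\<omega>. nexp (\<integral>\<^sup>+x. g n x \<partial>\<mu> \<omega>) \<partial>M) \<longlonglongrightarrow> (\<integral>\<omega>. nexp (\<integral>\<^sup>+x. h x \<partial>\<mu> \<omega>) \<partial>M)"
  proof (rule integral_dominated_convergence[of _ _ _ "\<lambda>_. 1"])
    show "AE \<omega> in M. (\<lambda>n. nexp (\<integral>\<^sup>+x. g n x \<partial>\<mu> \<omega>)) \<longlonglongrightarrow> nexp (\<integral>\<^sup>+x. h x \<partial>\<mu> \<omega>)"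
    proof (intro AE_I2 tendsto_nexp)
      fix \<omega> assume \<omega>: "\<omega> \<in> space M"
      note [simp] = sets_counting_measures[OF measurable_config_space_space[OF \<mu> \<omega>]]
      show "(\<lambda>n. \<integral>\<^sup>+x. g n x \<partial>\<mu> \<omega>) \<longlonglongrightarrow> (\<integral>\<^sup>+x. h x \<partial>\<mu> \<omega>)"
        using lim by (intro nn_integral_LIMSEQ) (auto simp: incseq_Suc_iff le_fun_def inc cong: measurable_cong_sets)
    qed
  qed auto
  moreover have "(\<lambda>n. nexp (ennreal c * (\<integral>\<^sup>+x. ennreal (1 - nexp (g n x)) \<partial>lborel))) \<longlonglongrightarrow>
      nexp (ennreal c * (\<integral>\<^sup>+x. ennreal (1 - nexp (h x)) \<partial>lborel))"
    by (intro tendsto_nexp ennreal_tendsto_cmult nn_integral_LIMSEQ tendsto_ennrealI tendsto_intros lim)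
       (auto simp: incseq_Suc_iff le_fun_def inc intro!: ennreal_leI nexp_antimono)
  moreover have "(\<integral>\<omega>. nexp (\<integral>\<^sup>+x. g n x \<partial>\<mu> \<omega>) \<partial>M) = nexp (ennreal c * (\<integral>\<^sup>+x. ennreal (1 - nexp (g n x)) \<partial>lborel))" for n
    unfolding g_def by (rule poisson_laplace_simple[OF p c s(1,3)])
  ultimately show ?thesis
    by (simp add: LIMSEQ_unique)
qed

section \<open>Laplace functional of the cascade\<close>


text \<open>Rectangles determine the joint law, and their preimages are intersections of events from
  the two generated sigma-algebras.\<close>

lemma (in prob_space) distr_pair_eqI:
  assumes [measurable]: "X \<in> M \<rightarrow>\<^sub>M S" "Y \<in> M \<rightarrow>\<^sub>M T"
    and eq: "\<And>a b. a \<in> sets (vimage_algebra (space M) X S) \<Longrightarrow> b \<in> sets (vimage_algebra (space M) Y T) \<Longrightarrow>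
      prob (a \<inter> b) = prob a * prob b"
  shows "distr M (S \<Otimes>\<^sub>M T) (\<lambda>\<omega>. (X \<omega>, Y \<omega>)) = distr M S X \<Otimes>\<^sub>M distr M T Y"
proof (rule pair_measure_eqI[symmetric])
  interpret X: prob_space "distr M S X" by (rule prob_space_distr) fact
  interpret Y: prob_space "distr M T Y" by (rule prob_space_distr) fact
  show "sigma_finite_measure (distr M S X)" "sigma_finite_measure (distr M T Y)"
    by unfold_locales
  fix A B assume AB: "A \<in> sets (distr M S X)" "B \<in> sets (distr M T Y)"
  have "(\<lambda>\<omega>. (X \<omega>, Y \<omega>)) -` (A \<times> B) \<inter> space M = (X -` A \<inter> space M) \<inter> (Y -` B \<inter> space M)"
    by auto
  moreover have "prob ((X -` A \<inter> space M) \<inter> (Y -` B \<inter> space M)) = prob (X -` A \<inter> space M) * prob (Y -` B \<inter> space M)"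
    using AB by (intro eq in_vimage_algebra) auto
  ultimately show "emeasure (distr M S X) A * emeasure (distr M T Y) B =
      emeasure (distr M (S \<Otimes>\<^sub>M T) (\<lambda>\<omega>. (X \<omega>, Y \<omega>))) (A \<times> B)"
    using AB by (simp add: emeasure_distr emeasure_eq_measure ennreal_mult[symmetric])
qed simp

text \<open>Provides the two splittings needed to integrate out the third variable given the first
  two, and then the second given the first.\<close>

lemma (in prob_space) distr_pair_of_three:
  assumes ind: "indep_sets (\<lambda>l. [sets (vimage_algebra (space M) X S), sets (vimage_algebra (space M) Y T),
        sets (vimage_algebra (space M) Z R)] ! l) {..<3}"
    and [measurable]: "X \<in> M \<rightarrow>\<^sub>M S" "Y \<in> M \<rightarrow>\<^sub>M T" "Z \<in> M \<rightarrow>\<^sub>M R"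
  shows "distr M (S \<Otimes>\<^sub>M T) (\<lambda>\<omega>. (X \<omega>, Y \<omega>)) = distr M S X \<Otimes>\<^sub>M distr M T Y"
    and "distr M ((S \<Otimes>\<^sub>M T) \<Otimes>\<^sub>M R) (\<lambda>\<omega>. ((X \<omega>, Y \<omega>), Z \<omega>)) =
      distr M (S \<Otimes>\<^sub>M T) (\<lambda>\<omega>. (X \<omega>, Y \<omega>)) \<Otimes>\<^sub>M distr M R Z"
proof -
  let ?G = "\<lambda>l. [sets (vimage_algebra (space M) X S), sets (vimage_algebra (space M) Y T),
        sets (vimage_algebra (space M) Z R)] ! l"
  have ev: "?G l \<subseteq> events" if "l < 3" for l
    using ind that by (auto simp: indep_sets_def)
  show "distr M (S \<Otimes>\<^sub>M T) (\<lambda>\<omega>. (X \<omega>, Y \<omega>)) = distr M S X \<Otimes>\<^sub>M distr M T Y"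
  proof (rule distr_pair_eqI)
    fix a b assume a: "a \<in> sets (vimage_algebra (space M) X S)" and b: "b \<in> sets (vimage_algebra (space M) Y T)"
    have "prob (\<Inter>j\<in>{0, 1::nat}. if j = 0 then a else b) = (\<Prod>j\<in>{0, 1::nat}. prob (if j = 0 then a else b))"
      using a b by (intro indep_setsD[OF ind]) auto
    then show "prob (a \<inter> b) = prob a * prob b"
      by (simp add: Int_commute)
  qed fact+
  \<comment> \<open>Mutual independence of the three is regrouped: the sigma-algebra generated by
    the first two is independent of the third, since the generators are stable under
    intersection.\<close>
  let ?I = "\<lambda>j::bool. if j then {0, 1::nat} else {2}"
  have ind2: "indep_sets (\<lambda>j. sigma_sets (space M) (\<Union>i\<in>?I j. ?G i)) UNIV"
  proof (rule indep_sets_collect_sigma)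
    have "(\<Union>j\<in>UNIV. ?I j) = {..<3}"
      by (auto split: if_splits)
    then show "indep_sets ?G (\<Union>j\<in>UNIV. ?I j)"
      using ind by simp
    show "Int_stable (?G i)" if "j \<in> UNIV" "i \<in> ?I j" for i j
      using that by (auto split: if_splits simp: Int_stable_def)
  qed (auto simp: disjoint_family_on_def)
  have indD: "prob (a \<inter> b) = prob a * prob b"
    if "a \<in> sigma_sets (space M) (?G 0 \<union> ?G 1)" "b \<in> sigma_sets (space M) (?G 2)" for a b
  proof -
    have "prob (\<Inter>j\<in>UNIV. if j then a else b) = (\<Prod>j\<in>UNIV. prob (if j then a else b))"
      using that by (intro indep_setsD[OF ind2]) (auto split: if_splits)
    then have "prob (b \<inter> a) = prob b * prob a"
      by (simp add: UNIV_bool)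
    then show ?thesis
      by (simp only: Int_commute[of b a] mult.commute[of "prob b"])
  qed
  show "distr M ((S \<Otimes>\<^sub>M T) \<Otimes>\<^sub>M R) (\<lambda>\<omega>. ((X \<omega>, Y \<omega>), Z \<omega>)) =
      distr M (S \<Otimes>\<^sub>M T) (\<lambda>\<omega>. (X \<omega>, Y \<omega>)) \<Otimes>\<^sub>M distr M R Z"
  proof (rule distr_pair_eqI)
    fix a b assume a: "a \<in> sets (vimage_algebra (space M) (\<lambda>\<omega>. (X \<omega>, Y \<omega>)) (S \<Otimes>\<^sub>M T))"
      and b: "b \<in> sets (vimage_algebra (space M) Z R)"
    let ?N = "sigma (space M) (?G 0 \<union> ?G 1)"
    have sub: "?G 0 \<union> ?G 1 \<subseteq> Pow (space M)"
      using ev[of 0] ev[of 1] sets.sets_into_space by fastforce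
    have N: "space ?N = space M"
      using sub by (rule space_measure_of)
    have "X \<in> ?N \<rightarrow>\<^sub>M S"
    proof (rule measurableI)
      fix A assume "A \<in> sets S"
      then have "X -` A \<inter> space M \<in> ?G 0 \<union> ?G 1"
        by (auto intro: in_vimage_algebra)
      then show "X -` A \<inter> space ?N \<in> sets ?N"
        unfolding N using sub by (rule in_measure_of[rotated])
    qed (use measurable_space[of X M S] N in auto)
    moreover have "Y \<in> ?N \<rightarrow>\<^sub>M T"
    proof (rule measurableI)
      fix A assume "A \<in> sets T"
      then have "Y -` A \<inter> space M \<in> ?G 0 \<union> ?G 1"
        by (auto intro: in_vimage_algebra)
      then show "Y -` A \<inter> space ?N \<in> sets ?N"
        unfolding N using sub by (rule in_measure_of[rotated])
    qed (use measurable_space[of Y M T] N in auto)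
    ultimately have XY: "(\<lambda>\<omega>. (X \<omega>, Y \<omega>)) \<in> ?N \<rightarrow>\<^sub>M S \<Otimes>\<^sub>M T"
      by (rule measurable_Pair)
    have "(\<lambda>\<omega>. (X \<omega>, Y \<omega>)) \<in> space M \<rightarrow> space (S \<Otimes>\<^sub>M T)"
      using measurable_space[of X M S] measurable_space[of Y M T] by (auto simp: space_pair_measure)
    from a[unfolded sets_vimage_algebra2[OF this]] obtain C where
      "C \<in> sets (S \<Otimes>\<^sub>M T)" "a = (\<lambda>\<omega>. (X \<omega>, Y \<omega>)) -` C \<inter> space M"
      by auto
    then have "a \<in> sets ?N"
      using measurable_sets[OF XY, of C] N by simp
    then have "a \<in> sigma_sets (space M) (?G 0 \<union> ?G 1)"
      using sub by (simp add: sets_measure_of)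
    moreover have "b \<in> sigma_sets (space M) (?G 2)"
      using b by (auto intro: sigma_sets.Basic)
    ultimately show "prob (a \<inter> b) = prob a * prob b"
      by (rule indD)
  qed measurable
qed

lemma (in prob_space) integral_distr_pair:
  fixes F :: "'b \<times> 'c \<Rightarrow> real"
  assumes eq: "distr M (S \<Otimes>\<^sub>M T) (\<lambda>\<omega>. (X \<omega>, Y \<omega>)) = distr M S X \<Otimes>\<^sub>M distr M T Y"
    and XY [measurable]: "X \<in> M \<rightarrow>\<^sub>M S" "Y \<in> M \<rightarrow>\<^sub>M T"
    and F [measurable]: "F \<in> borel_measurable (S \<Otimes>\<^sub>M T)" and bd: "\<And>p. \<bar>F p\<bar> \<le> 1"
  shows "(\<integral>\<omega>. F (X \<omega>, Y \<omega>) \<partial>M) = (\<integral>\<omega>. (\<integral>y. F (X \<omega>, y) \<partial>distr M T Y) \<partial>M)"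
proof -
  interpret X: prob_space "distr M S X" by (rule prob_space_distr) fact
  interpret Y: prob_space "distr M T Y" by (rule prob_space_distr) fact
  interpret P: pair_prob_space "distr M S X" "distr M T Y" ..
  have "(\<integral>\<omega>. F (X \<omega>, Y \<omega>) \<partial>M) = (\<integral>p. F p \<partial>(distr M S X \<Otimes>\<^sub>M distr M T Y))"
    unfolding eq[symmetric] by (subst integral_distr) auto
  also have "\<dots> = (\<integral>x. (\<integral>y. F (x, y) \<partial>distr M T Y) \<partial>distr M S X)"
  proof (rule P.integral_fst'[symmetric])
    show "integrable (distr M S X \<Otimes>\<^sub>M distr M T Y) F"
      using bd by (intro P.P.integrable_const_bound[of _ 1]) auto
  qed
  also have "\<dots> = (\<integral>\<omega>. (\<integral>y. F (X \<omega>, y) \<partial>distr M T Y) \<partial>M)"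
  proof (rule integral_distr)
    show "(\<lambda>x. \<integral>y. F (x, y) \<partial>distr M T Y) \<in> borel_measurable S"
      by (intro Y.borel_measurable_lebesgue_integral) (simp add: split_beta')
  qed fact
  finally show ?thesis .
qed

text \<open>Let t decrease to 0. An infinite value contributes 0 to the transform for every t > 0,
  so the transform stays below the probability that X is finite, while its lower bound tends to
  1.\<close>

lemma (in prob_space) AE_finite_of_laplace:
  assumes [measurable]: "X \<in> borel_measurable M" and C: "C < \<infinity>"
    and le: "\<And>t. 0 < t \<Longrightarrow> nexp (ennreal t * C) \<le> (\<integral>\<omega>. nexp (ennreal t * X \<omega>) \<partial>M)"
  shows "AE \<omega> in M. X \<omega> < \<infinity>"
proof -
  let ?A = "{\<omega>\<in>space M. X \<omega> < \<infinity>}"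
  have up: "(\<integral>\<omega>. nexp (ennreal t * X \<omega>) \<partial>M) \<le> prob ?A" if "0 < t" for t
  proof -
    have "(\<integral>\<omega>. nexp (ennreal t * X \<omega>) \<partial>M) \<le> (\<integral>\<omega>. indicator ?A \<omega> \<partial>M)"
    proof (intro integral_mono integrable_const_bound[of _ 1])
      fix \<omega> assume "\<omega> \<in> space M"
      then show "nexp (ennreal t * X \<omega>) \<le> indicator ?A \<omega>"
        using that by (cases "X \<omega> = \<top>") (auto simp: ennreal_mult_top less_top)
    qed auto
    also have "\<dots> = prob ?A"
      by simp
    finally show ?thesis .
  qed
  have "(\<lambda>m. ennreal (1 / real (Suc m)) * C) \<longlonglongrightarrow> 0"
  proof -
    have "(\<lambda>m. C * ennreal (1 / real (Suc m))) \<longlonglongrightarrow> C * ennreal 0"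
      using C by (intro ennreal_tendsto_cmult tendsto_ennrealI LIMSEQ_inverse_real_of_nat[unfolded inverse_eq_divide]) auto
    then show ?thesis
      by (simp add: mult.commute)
  qed
  then have "(\<lambda>m. nexp (ennreal (1 / real (Suc m)) * C)) \<longlonglongrightarrow> 1"
    using tendsto_nexp by fastforce
  then have "1 \<le> prob ?A"
  proof (rule LIMSEQ_le_const2)
    show "\<exists>N. \<forall>n\<ge>N. nexp (ennreal (1 / real (Suc n)) * C) \<le> prob ?A"
      using order_trans[OF le up] by auto
  qed
  then have "prob ?A = 1"
    by (rule antisym[OF prob_le_1])
  then show ?thesis
    by (subst (asm) prob_Collect_eq_1) auto
qed

lemma expectation_uniform_threshold:
  assumes p: "0 \<le> p" "p \<le> 1"
  shows "(\<integral>u. (if u \<le> p then a else 1) \<partial>uniform_measure lborel {0<..<1::real}) = 1 - p * (1 - a :: real)"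
proof -
  let ?V = "uniform_measure lborel {0<..<1::real}"
  interpret V: prob_space ?V
    by (rule prob_space_uniform_measure) auto
  have "measure ?V {..p} = p"
  proof -
    \<comment> \<open>The case p = 1 belongs to stage 0, where almost surely every immigrant is
      kept.\<close>
    have "{0<..<1} \<inter> {..p} = (if p = 1 then {0<..<1} else {0<..p})"
      using p by auto
    then have "emeasure lborel ({0<..<1} \<inter> {..p}) = ennreal p"
      using p by simp
    then have "emeasure ?V {..p} = ennreal p"
      using p by (simp add: divide_ennreal[of p 1, simplified])
    then show ?thesis
      using p by (simp add: measure_def)
  qed
  moreover have "integrable ?V (indicator {..p} :: real \<Rightarrow> real)"
    by (intro V.integrable_const_bound[of _ 1]) auto
  moreover have "(\<integral>u. (if u \<le> p then a else 1) \<partial>?V) = (\<integral>u. 1 + (a - 1) * indicator {..p} u \<partial>?V)"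
    by (intro Bochner_Integration.integral_cong) (auto split: split_indicator)
  moreover have "(\<integral>u. 1 + (a - 1) * indicator {..p} u \<partial>?V) = 1 + (a - 1) * measure ?V {..p}"
    using V.prob_space \<open>integrable ?V (indicator {..p})\<close> by (subst Bochner_Integration.integral_add) auto
  ultimately show ?thesis
    by (simp add: algebra_simps)
qed

section \<open>Separate cluster arrays for separate immigrants\<close>

context cluster_law
begin

abbreviation \<Omega>3 :: "(nat \<times> nat \<times> nat \<Rightarrow> 'a measure) measure" where
  "\<Omega>3 \<equiv> PiM UNIV (\<lambda>_. L)"

text \<open>Fixing the immigrant selects disjoint blocks of coordinates of a product law, so the
  blocks are independent and each is a copy of \<Omega>.\<close>

lemma indep_blocks: "prob_space.indep_vars \<Omega>3 (\<lambda>_. \<Omega>) (\<lambda>i z t. z (i, t)) UNIV"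
  and distr_block: "distr \<Omega>3 \<Omega> (\<lambda>z t. z (i, t)) = \<Omega>"
proof -
  interpret Z: prob_space \<Omega>3
    by (intro prob_space_PiM L.prob_space_axioms)
  let ?K = "\<lambda>i::nat. {i} \<times> (UNIV :: (nat \<times> nat) set)"
  have "Z.indep_vars (\<lambda>_. L) (\<lambda>t z. z t) UNIV"
    by (rule indep_vars_PiM_coordinates[OF L.prob_space_axioms]) simp
  then have "Z.indep_vars (\<lambda>i. PiM (?K i) (\<lambda>_. L)) (\<lambda>i z. restrict (\<lambda>t. z t) (?K i)) UNIV"
    by (rule Z.indep_vars_restrict) (auto simp: disjoint_family_on_def)
  moreover have "(\<lambda>w t. w (i, t)) \<in> PiM (?K i) (\<lambda>_. L) \<rightarrow>\<^sub>M \<Omega>" for i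
    unfolding \<Omega>_def by (rule measurable_PiM_single') (auto simp: space_PiM PiE_iff)
  ultimately have "Z.indep_vars (\<lambda>_. \<Omega>) (\<lambda>i z. (\<lambda>w t. w (i, t)) (restrict (\<lambda>t. z t) (?K i))) UNIV"
    by (rule Z.indep_vars_compose2[where Y="\<lambda>i w t. w (i, t)"])
  then show "Z.indep_vars (\<lambda>_. \<Omega>) (\<lambda>i z t. z (i, t)) UNIV"
    by simp
  show "distr \<Omega>3 \<Omega> (\<lambda>z t. z (i, t)) = \<Omega>"
    using distr_PiM_reindex[of UNIV "\<lambda>_. L" "\<lambda>t. (i, t)" UNIV] L.prob_space_axioms
    by (simp add: inj_def \<Omega>_def restrict_UNIV)
qed

end

locale cluster_cascade = cluster_law L e + prob_space M
  for L :: "'a::euclidean_space measure measure" and e and M :: "'w measure" +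
  fixes \<mu> :: "'w \<Rightarrow> 'a measure" and U :: "nat \<Rightarrow> 'w \<Rightarrow> real" and Z :: "nat \<times> nat \<times> nat \<Rightarrow> 'w \<Rightarrow> 'a measure"
    and c :: real and \<xi> :: "nat \<Rightarrow> 'w \<Rightarrow> 'a measure"
  assumes c: "0 < c" and poisson: "poisson_process M c \<mu>"
    and indep_U: "indep_vars (\<lambda>_. borel) U UNIV"
    and law_U: "\<And>i. distr M borel (U i) = uniform_measure lborel {0<..<1}"
    and indep_Z: "indep_vars (\<lambda>_. config_space) Z UNIV"
    and law_Z: "\<And>t. distr M config_space (Z t) = L"
    and indep: "indep_sets (\<lambda>l. [sets (vimage_algebra (space M) \<mu> config_space),
                 sets (vimage_algebra (space M) (\<lambda>\<omega> i. U i \<omega>) (PiM UNIV (\<lambda>_. borel))),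
                 sets (vimage_algebra (space M) (\<lambda>\<omega> t. Z t \<omega>) (PiM UNIV (\<lambda>_. config_space)))] ! l) {..<3}"
    and \<xi>: "\<And>n \<omega>. \<omega> \<in> space M \<Longrightarrow> \<xi> n \<omega> =
           superpose {i \<in> indices (\<mu> \<omega>). U i \<omega> \<le> 1 / (real n + 1)}
             (\<lambda>i. total_progeny e (\<lambda>k j. Z (i, k, j) \<omega>) (e i (\<mu> \<omega>)) n)"
begin

lemma measurable_mu [measurable]: "\<mu> \<in> M \<rightarrow>\<^sub>M config_space"
  using poisson by (simp add: poisson_process_def point_process_def)

lemma measurable_U [measurable]: "U i \<in> borel_measurable M"
  using indep_U by (auto simp: indep_vars_def)

lemma measurable_Z [measurable]: "Z t \<in> M \<rightarrow>\<^sub>M config_space"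
  using indep_Z unfolding indep_vars_def by blast

lemma distr_U: "distr M (PiM UNIV (\<lambda>_. borel)) (\<lambda>\<omega> i. U i \<omega>) = PiM UNIV (\<lambda>_. uniform_measure lborel {0<..<1})"
  using indep_U by (subst (asm) indep_vars_iff_distr_eq_PiM) (auto simp: law_U restrict_UNIV)

lemma distr_Z: "distr M (PiM UNIV (\<lambda>_. config_space)) (\<lambda>\<omega> t. Z t \<omega>) = \<Omega>3"
  using indep_Z by (subst (asm) indep_vars_iff_distr_eq_PiM) (auto simp: law_Z restrict_UNIV)

lemma measurable_enum [measurable]: "e j \<in> config_space \<rightarrow>\<^sub>M borel"
  using enum by (rule point_enumeration_measurable)

lemma measurable_xi [measurable]: "\<xi> n \<in> M \<rightarrow>\<^sub>M config_space"
proof -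
  have "(\<lambda>\<omega>. superpose {i \<in> indices (\<mu> \<omega>). U i \<omega> \<le> 1 / (real n + 1)}
             (\<lambda>i. total_progeny e (\<lambda>k j. Z (i, k, j) \<omega>) (e i (\<mu> \<omega>)) n)) \<in> M \<rightarrow>\<^sub>M config_space"
    by (intro measurable_superpose measurable_total_progeny[OF enum]) measurable
  then show ?thesis
    by (rule measurable_cong[THEN iffD1, rotated]) (simp add: \<xi>)
qed

text \<open>The integral of f over the cascade as a plain series in the input data, without the
  default clause of \<open>superpose\<close>. As a function of immigrants, marks and clusters it can
  be averaged over one of them at a time; it agrees with the cascade only almost surely, by
  \<open>AE_nn_integral_xi\<close>.\<close>

definition progeny_sum ::
  "nat \<Rightarrow> ('a \<Rightarrow> ennreal) \<Rightarrow> ('a measure \<times> (nat \<Rightarrow> real)) \<times> (nat \<times> nat \<times> nat \<Rightarrow> 'a measure) \<Rightarrow> ennreal" where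
  "progeny_sum n f = (\<lambda>((\<nu>, u), z). \<Sum>i. if i \<in> indices \<nu> \<and> u i \<le> 1 / (real n + 1)
     then \<integral>\<^sup>+y. f y \<partial>total_progeny e (\<lambda>k j. z (i, k, j)) (e i \<nu>) n else 0)"

lemma measurable_progeny_sum [measurable]:
  assumes [measurable]: "f \<in> borel_measurable borel"
  shows "progeny_sum n f \<in> borel_measurable ((config_space \<Otimes>\<^sub>M PiM UNIV (\<lambda>_. borel)) \<Otimes>\<^sub>M PiM UNIV (\<lambda>_. config_space))"
proof -
  let ?N = "(config_space \<Otimes>\<^sub>M PiM UNIV (\<lambda>_::nat. borel :: real measure)) \<Otimes>\<^sub>M PiM UNIV (\<lambda>_::nat\<times>nat\<times>nat. config_space :: 'a measure measure)"
  have "(\<lambda>p. total_progeny e (\<lambda>k j. snd p (i, k, j)) (e i (fst (fst p))) n) \<in> ?N \<rightarrow>\<^sub>M config_space" for i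
    by (intro measurable_total_progeny[OF enum]) measurable
  note tp = this
  have [measurable]: "(\<lambda>p. \<integral>\<^sup>+y. f y \<partial>total_progeny e (\<lambda>k j. snd p (i, k, j)) (e i (fst (fst p))) n) \<in> borel_measurable ?N" for i
    by (rule measurable_nn_integral_L[OF _ tp]) measurable
  show ?thesis
    unfolding progeny_sum_def split_beta' by measurable
qed

text \<open>The clusters, the marks and the immigrants are integrated out in this order.\<close>
lemma laplace_progeny_sum:
  assumes f [measurable]: "f \<in> borel_measurable borel"
  shows "(\<integral>\<omega>. nexp (progeny_sum n f ((\<mu> \<omega>, \<lambda>i. U i \<omega>), \<lambda>t. Z t \<omega>)) \<partial>M) =
    nexp (ennreal c * (ennreal (1 / (real n + 1)) * (\<integral>\<^sup>+x. ennreal (1 - nexp (cumulant f n x)) \<partial>lborel)))"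
proof -
  let ?p = "1 / (real n + 1)"
  let ?V = "uniform_measure lborel {0<..<1::real}"
  interpret V: prob_space ?V
    by (rule prob_space_uniform_measure) auto
  interpret VV: prob_space "PiM UNIV (\<lambda>_::nat. ?V)"
    by (intro prob_space_PiM V.prob_space_axioms)
  interpret Z3: prob_space \<Omega>3
    by (intro prob_space_PiM L.prob_space_axioms)
  have mU: "(\<lambda>\<omega> i. U i \<omega>) \<in> M \<rightarrow>\<^sub>M PiM UNIV (\<lambda>_. borel)"
    by (rule measurable_PiM_single') auto
  have mZ: "(\<lambda>\<omega> t. Z t \<omega>) \<in> M \<rightarrow>\<^sub>M PiM UNIV (\<lambda>_. config_space)"
    by (rule measurable_PiM_single') (use measurable_space[OF measurable_Z] in auto)
  note ind = distr_pair_of_three[OF indep measurable_mu mU mZ]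
  \<comment> \<open>Immigrants and marks are frozen. The trees are independent, and each retained
    one contributes its cumulant.\<close>
  have step1: "(\<integral>z. nexp (progeny_sum n f ((\<nu>, u), z)) \<partial>\<Omega>3) =
      nexp (\<Sum>i. if i \<in> indices \<nu> \<and> u i \<le> ?p then cumulant f n (e i \<nu>) else 0)" for \<nu> u
  proof -
    define F where "F = (\<lambda>i (w :: nat \<times> nat \<Rightarrow> 'a measure). if i \<in> indices \<nu> \<and> u i \<le> ?p
      then \<integral>\<^sup>+y. f y \<partial>total_progeny e (\<lambda>k j. w (k, j)) (e i \<nu>) n else 0)"
    have tp: "(\<lambda>w. total_progeny e (\<lambda>k j. w (k, j)) (e i \<nu>) n) \<in> \<Omega> \<rightarrow>\<^sub>M config_space" for i
      by (intro measurable_total_progeny[OF enum]) measurable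
    have [measurable]: "(\<lambda>w. \<integral>\<^sup>+y. f y \<partial>total_progeny e (\<lambda>k j. w (k, j)) (e i \<nu>) n) \<in> borel_measurable \<Omega>" for i
      by (rule measurable_nn_integral_L[OF _ tp]) measurable
    have F [measurable]: "F i \<in> borel_measurable \<Omega>" for i
      unfolding F_def by measurable
    have m: "(\<lambda>z t. z (i, t)) \<in> \<Omega>3 \<rightarrow>\<^sub>M \<Omega>" for i
      using indep_blocks by (auto simp: Z3.indep_vars_def)
    have "(\<integral>z. nexp (progeny_sum n f ((\<nu>, u), z)) \<partial>\<Omega>3) = (\<integral>z. nexp (\<Sum>i. F i (\<lambda>t. z (i, t))) \<partial>\<Omega>3)"
      by (simp add: progeny_sum_def F_def)
    also have "\<dots> = nexp (\<Sum>i. nlog (\<integral>z. nexp (F i (\<lambda>t. z (i, t))) \<partial>\<Omega>3))"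
      by (rule nlog_nexp_sum_indep[OF Z3.prob_space_axioms indep_blocks F])
    also have "(\<Sum>i. nlog (\<integral>z. nexp (F i (\<lambda>t. z (i, t))) \<partial>\<Omega>3)) =
        (\<Sum>i. if i \<in> indices \<nu> \<and> u i \<le> ?p then cumulant f n (e i \<nu>) else 0)"
    proof (intro suminf_cong)
      fix i
      have "(\<integral>z. nexp (F i (\<lambda>t. z (i, t))) \<partial>\<Omega>3) = (\<integral>w. nexp (F i w) \<partial>distr \<Omega>3 \<Omega> (\<lambda>z t. z (i, t)))"
        by (rule integral_distr[symmetric, OF m]) measurable
      also have "\<dots> = (\<integral>w. nexp (F i w) \<partial>\<Omega>)"
        by (simp add: distr_block)
      also have "\<dots> = nexp (if i \<in> indices \<nu> \<and> u i \<le> ?p then cumulant f n (e i \<nu>) else 0)"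
        by (cases "i \<in> indices \<nu> \<and> u i \<le> ?p") (auto simp: F_def laplace_total_progeny \<Omega>.prob_space)
      finally show "nlog (\<integral>z. nexp (F i (\<lambda>t. z (i, t))) \<partial>\<Omega>3) =
          (if i \<in> indices \<nu> \<and> u i \<le> ?p then cumulant f n (e i \<nu>) else 0)"
        by (simp add: nlog_nexp)
    qed
    finally show ?thesis .
  qed
  \<comment> \<open>Averaging over the mark of a point y yields the factor
    \<open>1 - ?p * (1 - nexp (cumulant f n y))\<close>. Its \<open>nlog\<close> depends on y alone,
    so the result is a Laplace functional of the configuration, ready for the Poisson
    formula.\<close>
  have step2: "(\<integral>u. nexp (\<Sum>i. if i \<in> indices \<nu> \<and> u i \<le> ?p then cumulant f n (e i \<nu>) else 0) \<partial>PiM UNIV (\<lambda>_. ?V)) =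
      nexp (\<integral>\<^sup>+y. nlog (1 - ?p * (1 - nexp (cumulant f n y))) \<partial>\<nu>)" if \<nu>: "\<nu> \<in> counting_measures" for \<nu>
  proof -
    define F where "F = (\<lambda>i u. if i \<in> indices \<nu> \<and> u \<le> ?p then cumulant f n (e i \<nu>) else 0)"
    have F [measurable]: "F i \<in> borel_measurable ?V" for i
      unfolding F_def by measurable
    have "(\<integral>u. nexp (\<Sum>i. F i (u i)) \<partial>PiM UNIV (\<lambda>_. ?V)) = nexp (\<Sum>i. nlog (\<integral>u. nexp (F i (u i)) \<partial>PiM UNIV (\<lambda>_. ?V)))"
      by (rule nlog_nexp_sum_indep[OF VV.prob_space_axioms indep_vars_PiM_coordinates[OF V.prob_space_axioms] F]) simp
    also have "(\<Sum>i. nlog (\<integral>u. nexp (F i (u i)) \<partial>PiM UNIV (\<lambda>_. ?V))) =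
        (\<Sum>i. if i \<in> indices \<nu> then nlog (1 - ?p * (1 - nexp (cumulant f n (e i \<nu>)))) else 0)"
    proof (intro suminf_cong)
      fix i :: nat
      have "(\<integral>u. nexp (F i (u i)) \<partial>PiM UNIV (\<lambda>_. ?V)) = (\<integral>u. nexp (F i u) \<partial>distr (PiM UNIV (\<lambda>_. ?V)) ?V (\<lambda>u. u i))"
        by (rule integral_distr[symmetric]) measurable
      also have "\<dots> = (\<integral>u. nexp (F i u) \<partial>?V)"
        by (subst distr_PiM_component) (auto intro: V.prob_space_axioms)
      also have "\<dots> = (if i \<in> indices \<nu> then \<integral>u. (if u \<le> ?p then nexp (cumulant f n (e i \<nu>)) else 1) \<partial>?V else 1)"
        using V.prob_space by (auto simp: F_def intro!: Bochner_Integration.integral_cong)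
      also have "\<dots> = (if i \<in> indices \<nu> then 1 - ?p * (1 - nexp (cumulant f n (e i \<nu>))) else 1)"
        by (subst expectation_uniform_threshold) auto
      finally show "nlog (\<integral>u. nexp (F i (u i)) \<partial>PiM UNIV (\<lambda>_. ?V)) =
          (if i \<in> indices \<nu> then nlog (1 - ?p * (1 - nexp (cumulant f n (e i \<nu>)))) else 0)"
        by simp
    qed
    also have "\<dots> = (\<integral>\<^sup>+y. nlog (1 - ?p * (1 - nexp (cumulant f n y))) \<partial>\<nu>)"
      by (rule nn_integral_counting_measure_suminf[OF enum \<nu>, symmetric]) measurable
    finally show ?thesis
      by (simp add: F_def)
  qed
  have "(\<integral>\<omega>. nexp (progeny_sum n f ((\<mu> \<omega>, \<lambda>i. U i \<omega>), \<lambda>t. Z t \<omega>)) \<partial>M) =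
      (\<integral>\<omega>. (\<integral>z. nexp (progeny_sum n f ((\<mu> \<omega>, \<lambda>i. U i \<omega>), z)) \<partial>\<Omega>3) \<partial>M)"
    using integral_distr_pair[OF ind(2) _ mZ, of "\<lambda>p. nexp (progeny_sum n f p)"] using mU by (simp add: distr_Z)
  also have "\<dots> = (\<integral>\<omega>. nexp (\<Sum>i. if i \<in> indices (\<mu> \<omega>) \<and> U i \<omega> \<le> ?p then cumulant f n (e i (\<mu> \<omega>)) else 0) \<partial>M)"
    by (simp add: step1)
  also have "\<dots> = (\<integral>\<omega>. (\<integral>u. nexp (\<Sum>i. if i \<in> indices (\<mu> \<omega>) \<and> u i \<le> ?p then cumulant f n (e i (\<mu> \<omega>)) else 0)
      \<partial>PiM UNIV (\<lambda>_. ?V)) \<partial>M)"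
  proof -
    define F where "F = (\<lambda>p. nexp (\<Sum>i. if i \<in> indices (fst p) \<and> snd p i \<le> ?p then cumulant f n (e i (fst p)) else 0))"
    have "F \<in> borel_measurable (config_space \<Otimes>\<^sub>M PiM UNIV (\<lambda>_. borel))"
      unfolding F_def by measurable
    from integral_distr_pair[OF ind(1) measurable_mu mU this] show ?thesis
      by (simp add: F_def distr_U cong: if_cong)
  qed
  also have "\<dots> = (\<integral>\<omega>. nexp (\<integral>\<^sup>+y. nlog (1 - ?p * (1 - nexp (cumulant f n y))) \<partial>\<mu> \<omega>) \<partial>M)"
    by (intro Bochner_Integration.integral_cong refl step2 measurable_config_space_space[OF measurable_mu])
  also have "\<dots> = nexp (ennreal c * (\<integral>\<^sup>+x. ennreal (1 - nexp (nlog (1 - ?p * (1 - nexp (cumulant f n x))))) \<partial>lborel))"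
    using c by (intro poisson_laplace[OF poisson _ enum]) auto
  \<comment> \<open>Thinning acts linearly: the Poisson formula undoes \<open>nlog\<close>, and the
    retention probability comes out as a factor.\<close>
  also have "(\<integral>\<^sup>+x. ennreal (1 - nexp (nlog (1 - ?p * (1 - nexp (cumulant f n x))))) \<partial>lborel) =
      (\<integral>\<^sup>+x. ennreal ?p * ennreal (1 - nexp (cumulant f n x)) \<partial>lborel)"
  proof (intro nn_integral_cong)
    fix x
    have "?p * (1 - nexp (cumulant f n x)) \<le> 1 * 1"
      by (intro mult_mono) auto
    moreover have "0 \<le> ?p * (1 - nexp (cumulant f n x))"
      by (intro mult_nonneg_nonneg) auto
    ultimately show "ennreal (1 - nexp (nlog (1 - ?p * (1 - nexp (cumulant f n x))))) =
        ennreal ?p * ennreal (1 - nexp (cumulant f n x))"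
      by (subst nexp_nlog) (auto simp: ennreal_mult[symmetric])
  qed
  also have "\<dots> = ennreal ?p * (\<integral>\<^sup>+x. ennreal (1 - nexp (cumulant f n x)) \<partial>lborel)"
    by (rule nn_integral_cmult) measurable
  finally show ?thesis .
qed

end


section \<open>The cascade as an almost surely locally finite superposition\<close>

context cluster_cascade
begin

abbreviation input :: "'w \<Rightarrow> ('a measure \<times> (nat \<Rightarrow> real)) \<times> (nat \<times> nat \<times> nat \<Rightarrow> 'a measure)" where
  "input \<omega> \<equiv> ((\<mu> \<omega>, \<lambda>i. U i \<omega>), \<lambda>t. Z t \<omega>)"

lemma measurable_input [measurable]:
  "input \<in> M \<rightarrow>\<^sub>M (config_space \<Otimes>\<^sub>M PiM UNIV (\<lambda>_. borel)) \<Otimes>\<^sub>M PiM UNIV (\<lambda>_. config_space)"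
proof -
  have [measurable]: "(\<lambda>\<omega> i. U i \<omega>) \<in> M \<rightarrow>\<^sub>M PiM UNIV (\<lambda>_. borel)"
    by (rule measurable_PiM_single') auto
  have [measurable]: "(\<lambda>\<omega> t. Z t \<omega>) \<in> M \<rightarrow>\<^sub>M PiM UNIV (\<lambda>_. config_space)"
    by (rule measurable_PiM_single') (use measurable_space[OF measurable_Z] in auto)
  show ?thesis
    by measurable
qed

lemma progeny_sum_cmult:
  assumes f: "f \<in> borel_measurable borel"
  shows "progeny_sum n (\<lambda>x. t * f x) p = t * progeny_sum n f p"
proof -
  have *: "(if P then \<integral>\<^sup>+y. t * f y \<partial>total_progeny e z x n else 0) = t * (if P then \<integral>\<^sup>+y. f y \<partial>total_progeny e z x n else 0)" for P z x
    using f by (auto intro!: nn_integral_cmult simp: sets_counting_measures cong: measurable_cong_sets)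
  show ?thesis
    unfolding progeny_sum_def split_beta' * by (rule ennreal_suminf_cmult)
qed

text \<open>The left side is free of n because thinning cancels the number of generations in
  \<open>nn_integral_cumulant_le\<close>. This is the uniform bound behind local finiteness,
  tightness and approximation.\<close>

lemma laplace_progeny_sum_ge:
  assumes f: "f \<in> borel_measurable borel"
  shows "nexp (ennreal c * (\<integral>\<^sup>+x. f x \<partial>lborel)) \<le> (\<integral>\<omega>. nexp (progeny_sum n f (input \<omega>)) \<partial>M)"
  unfolding laplace_progeny_sum[OF f]
  by (intro nexp_antimono mult_left_mono nn_integral_cumulant_le f) simp

text \<open>For t times the indicator of a ball the uniform bound is \<open>nexp\<close> of t c
  times the volume, so \<open>AE_finite_of_laplace\<close> applies. Hence the default clause in the
  definition of the cascade acts on a null event only.\<close>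

lemma AE_progeny_sum_finite: "AE \<omega> in M. \<forall>k::nat. progeny_sum n (indicator (ball 0 (real k))) (input \<omega>) < \<infinity>"
  unfolding AE_all_countable
proof
  fix k :: nat
  let ?B = "ball 0 (real k) :: 'a set"
  have [measurable]: "?B \<in> sets borel"
    by simp
  show "AE \<omega> in M. progeny_sum n (indicator ?B) (input \<omega>) < \<infinity>"
  proof (rule AE_finite_of_laplace)
    have "emeasure lborel ?B < \<infinity>"
      by (rule emeasure_bounded_finite) simp
    then show "ennreal c * emeasure lborel ?B < \<infinity>"
      by (simp add: ennreal_mult_less_top)
    fix t :: real assume "0 < t"
    have "ennreal t * (ennreal c * emeasure lborel ?B) = ennreal c * (\<integral>\<^sup>+x. ennreal t * indicator ?B x \<partial>lborel)"
      by (simp add: nn_integral_cmult_indicator mult_ac)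
    then show "nexp (ennreal t * (ennreal c * emeasure lborel ?B)) \<le>
        (\<integral>\<omega>. nexp (ennreal t * progeny_sum n (indicator ?B) (input \<omega>)) \<partial>M)"
      using laplace_progeny_sum_ge[of "\<lambda>x. ennreal t * indicator ?B x" n] by (simp add: progeny_sum_cmult)
  qed measurable
qed

lemma AE_nn_integral_xi:
  assumes f [measurable]: "f \<in> borel_measurable borel"
  shows "AE \<omega> in M. (\<integral>\<^sup>+y. f y \<partial>\<xi> n \<omega>) = progeny_sum n f (input \<omega>)"
  using AE_progeny_sum_finite[of n] AE_space
proof eventually_elim
  case (elim \<omega>)
  let ?J = "{i \<in> indices (\<mu> \<omega>). U i \<omega> \<le> 1 / (real n + 1)}"
  let ?T = "\<lambda>i. total_progeny e (\<lambda>k j. Z (i, k, j) \<omega>) (e i (\<mu> \<omega>)) n"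
  have *: "(\<integral>\<^sup>+i. (\<integral>\<^sup>+y. g y \<partial>?T i) \<partial>count_space ?J) = progeny_sum n g (input \<omega>)" for g
    by (simp add: nn_integral_count_space_suminf progeny_sum_def)
  have "(\<integral>\<^sup>+i. emeasure (?T i) (ball 0 (real k)) \<partial>count_space ?J) < \<infinity>" for k :: nat
    using elim(1) *[of "indicator (ball 0 (real k))"] by (simp add: sets_counting_measures)
  then have "(\<integral>\<^sup>+y. f y \<partial>superpose ?J ?T) = (\<integral>\<^sup>+i. (\<integral>\<^sup>+y. f y \<partial>?T i) \<partial>count_space ?J)"
    by (intro nn_integral_superpose) auto
  then show ?case
    using elim(2) by (simp add: \<xi> *)
qed

lemma laplace_xi:
  assumes f [measurable]: "f \<in> borel_measurable borel"
  shows "(\<integral>\<omega>. nexp (\<integral>\<^sup>+y. f y \<partial>\<xi> n \<omega>) \<partial>M) = (\<integral>\<omega>. nexp (progeny_sum n f (input \<omega>)) \<partial>M)"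
proof (rule integral_cong_AE)
  have "(\<lambda>\<omega>. \<integral>\<^sup>+y. f y \<partial>\<xi> n \<omega>) \<in> borel_measurable M"
    by (rule measurable_nn_integral_L[OF _ measurable_xi]) measurable
  then show "(\<lambda>\<omega>. nexp (\<integral>\<^sup>+y. f y \<partial>\<xi> n \<omega>)) \<in> borel_measurable M"
    by measurable
  show "AE \<omega> in M. nexp (\<integral>\<^sup>+y. f y \<partial>\<xi> n \<omega>) = nexp (progeny_sum n f (input \<omega>))"
    using AE_nn_integral_xi[OF f, of n] by eventually_elim simp
qed measurable

lemma laplace_xi_ge:
  "f \<in> borel_measurable borel \<Longrightarrow>
    nexp (ennreal c * (\<integral>\<^sup>+x. f x \<partial>lborel)) \<le> (\<integral>\<omega>. nexp (\<integral>\<^sup>+y. f y \<partial>\<xi> n \<omega>) \<partial>M)"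
  by (simp add: laplace_xi laplace_progeny_sum_ge)

lemma convergent_laplace_xi:
  assumes f: "f \<in> borel_measurable borel" and fin: "(\<integral>\<^sup>+x. f x \<partial>lborel) < \<infinity>"
  shows "convergent (\<lambda>n. \<integral>\<omega>. nexp (\<integral>\<^sup>+y. f y \<partial>\<xi> n \<omega>) \<partial>M)"
proof -
  obtain a where a: "(\<lambda>n. ennreal (1 / (real n + 1)) * (\<integral>\<^sup>+x. ennreal (1 - nexp (cumulant f n x)) \<partial>lborel)) \<longlonglongrightarrow> ennreal a"
    using convergent_nn_integral_cumulant[OF f fin] .
  have "(\<lambda>n. nexp (ennreal c * (ennreal (1 / (real n + 1)) * (\<integral>\<^sup>+x. ennreal (1 - nexp (cumulant f n x)) \<partial>lborel))))
      \<longlonglongrightarrow> nexp (ennreal c * ennreal a)"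
    by (intro tendsto_nexp ennreal_tendsto_cmult a) simp
  then show ?thesis
    unfolding laplace_xi[OF f] laplace_progeny_sum[OF f] by (rule convergentI)
qed

end

section \<open>Limits of vectors of counts\<close>


lemma Weierstrass_polynomial:
  fixes \<phi> :: "real \<Rightarrow> real"
  assumes "continuous_on UNIV \<phi>" "0 < \<epsilon>"
  obtains a and N :: nat where "\<And>y. y \<in> {0..1} \<Longrightarrow> \<bar>\<phi> y - (\<Sum>i\<le>N. a i * y ^ i)\<bar> \<le> \<epsilon>"
proof -
  obtain g where g: "real_polynomial_function g" "\<And>y. y \<in> {0..1} \<Longrightarrow> \<bar>\<phi> y - g y\<bar> < \<epsilon>"
    using Stone_Weierstrass_real_polynomial_function[of "{0..1}" \<phi> \<epsilon>] assms continuous_on_subset[OF assms(1)] by auto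
  obtain a and N :: nat where "g = (\<lambda>y. \<Sum>i\<le>N. a i * y ^ i)"
    using real_polynomial_function_imp_sum[OF g(1)] by blast
  with g(2) show thesis
    by (intro that[of a N]) (auto intro: less_imp_le)
qed

text \<open>The hypothesis on \<^term>\<open>T\<close> says that it is the value at \<^term>\<open>\<phi>\<close> of functionals of norm at
  most 1 on the continuous functions, with moments \<^term>\<open>\<tau>\<close>.\<close>
lemma convergent_of_moments:
  fixes \<phi> :: "real \<Rightarrow> real"
  assumes \<phi>: "continuous_on UNIV \<phi>"
    and T: "\<And>a N \<epsilon> n. (\<And>y. y \<in> {0..1} \<Longrightarrow> \<bar>\<phi> y - (\<Sum>i\<le>N. a i * y ^ i)\<bar> \<le> \<epsilon>) \<Longrightarrow>
      \<bar>T n - (\<Sum>i\<le>(N::nat). a i * \<tau> n i)\<bar> \<le> \<epsilon>"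
    and \<tau>: "\<And>i. convergent (\<lambda>n. \<tau> n i)"
  shows "convergent T"
proof -
  have "Cauchy T"
  proof (rule metric_CauchyI)
    fix \<epsilon> :: real assume "0 < \<epsilon>"
    then have "0 < \<epsilon> / 3" by simp
    then obtain a N where a: "\<And>y. y \<in> {0..1} \<Longrightarrow> \<bar>\<phi> y - (\<Sum>i\<le>N. a i * y ^ i)\<bar> \<le> \<epsilon> / 3"
      using Weierstrass_polynomial[OF \<phi>] by metis
    have "convergent (\<lambda>n. \<Sum>i\<le>N. a i * \<tau> n i)"
      using \<tau> by (intro convergent_sum convergent_mult convergent_const)
    then have "Cauchy (\<lambda>n. \<Sum>i\<le>N. a i * \<tau> n i)"
      by (rule convergent_Cauchy)
    from metric_CauchyD[OF this \<open>0 < \<epsilon> / 3\<close>] obtain M where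
      M: "\<And>m n. M \<le> m \<Longrightarrow> M \<le> n \<Longrightarrow> dist (\<Sum>i\<le>N. a i * \<tau> m i) (\<Sum>i\<le>N. a i * \<tau> n i) < \<epsilon> / 3"
      by blast
    have "dist (T m) (T n) < \<epsilon>" if "M \<le> m" "M \<le> n" for m n
      using M[OF that] T[OF a, of m] T[OF a, of n] unfolding dist_real_def by linarith
    then show "\<exists>M. \<forall>m\<ge>M. \<forall>n\<ge>M. dist (T m) (T n) < \<epsilon>"
      by blast
  qed
  then show ?thesis
    by (rule Cauchy_convergent)
qed

lemma tendsto_of_moments:
  fixes \<phi> :: "real \<Rightarrow> real"
  assumes \<phi>: "continuous_on UNIV \<phi>"
    and T: "\<And>a N \<epsilon> n. (\<And>y. y \<in> {0..1} \<Longrightarrow> \<bar>\<phi> y - (\<Sum>i\<le>N. a i * y ^ i)\<bar> \<le> \<epsilon>) \<Longrightarrow>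
      \<bar>T n - (\<Sum>i\<le>(N::nat). a i * \<tau> n i)\<bar> \<le> \<epsilon>"
    and T': "\<And>a N \<epsilon>. (\<And>y. y \<in> {0..1} \<Longrightarrow> \<bar>\<phi> y - (\<Sum>i\<le>N. a i * y ^ i)\<bar> \<le> \<epsilon>) \<Longrightarrow>
      \<bar>T' - (\<Sum>i\<le>(N::nat). a i * \<tau>' i)\<bar> \<le> \<epsilon>"
    and \<tau>: "\<And>i. (\<lambda>n. \<tau> n i) \<longlonglongrightarrow> \<tau>' i"
  shows "T \<longlonglongrightarrow> T'"
proof (rule metric_LIMSEQ_I)
  fix \<epsilon> :: real assume "0 < \<epsilon>"
  then have "0 < \<epsilon> / 3" by simp
  then obtain a N where a: "\<And>y. y \<in> {0..1} \<Longrightarrow> \<bar>\<phi> y - (\<Sum>i\<le>N. a i * y ^ i)\<bar> \<le> \<epsilon> / 3"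
    using Weierstrass_polynomial[OF \<phi>] by metis
  have "(\<lambda>n. \<Sum>i\<le>N. a i * \<tau> n i) \<longlonglongrightarrow> (\<Sum>i\<le>N. a i * \<tau>' i)"
    using \<tau> by (intro tendsto_intros)
  from metric_LIMSEQ_D[OF this \<open>0 < \<epsilon> / 3\<close>] obtain M where
    M: "\<And>n. M \<le> n \<Longrightarrow> dist (\<Sum>i\<le>N. a i * \<tau> n i) (\<Sum>i\<le>N. a i * \<tau>' i) < \<epsilon> / 3"
    by blast
  have "dist (T n) T' < \<epsilon>" if "M \<le> n" for n
    using M[OF that] T[OF a, of n] T'[OF a] unfolding dist_real_def by linarith
  then show "\<exists>M. \<forall>n\<ge>M. dist (T n) T' < \<epsilon>"
    by blast
qed

text \<open>Verifies the hypothesis on functionals in \<open>convergent_of_moments\<close> and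
  \<open>tendsto_of_moments\<close> for the expectation of
  \<open>\<phi> (Y \<omega>) * R \<omega>\<close>. The weight R carries the remaining coordinates,
  so a joint law can be treated one coordinate at a time.\<close>

lemma (in prob_space) moments_bound:
  fixes \<phi> :: "real \<Rightarrow> real"
  assumes \<phi>: "continuous_on UNIV \<phi>" and [measurable]: "Y \<in> borel_measurable M" "R \<in> borel_measurable M"
    and Y: "\<And>\<omega>. Y \<omega> \<in> {0..1}" and R: "\<And>\<omega>. \<bar>R \<omega>\<bar> \<le> 1"
    and a: "\<And>y. y \<in> {0..1} \<Longrightarrow> \<bar>\<phi> y - (\<Sum>i\<le>N. a i * y ^ i)\<bar> \<le> \<epsilon>"
  shows "\<bar>(\<integral>\<omega>. \<phi> (Y \<omega>) * R \<omega> \<partial>M) - (\<Sum>i\<le>(N::nat). a i * (\<integral>\<omega>. Y \<omega> ^ i * R \<omega> \<partial>M))\<bar> \<le> \<epsilon>"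
proof -
  have [measurable]: "\<phi> \<in> borel_measurable borel"
    using \<phi> by (rule borel_measurable_continuous_onI)
  have "compact (\<phi> ` {0..1})"
    using continuous_on_subset[OF \<phi>] by (intro compact_continuous_image) auto
  then have "bounded (\<phi> ` {0..1})"
    by (rule compact_imp_bounded)
  then obtain C where "\<forall>x\<in>\<phi> ` {0..1}. norm x \<le> C"
    by (auto simp: bounded_iff)
  then have C: "\<bar>\<phi> y\<bar> \<le> C" if "y \<in> {0..1}" for y
    using that by auto
  have C0: "0 \<le> C"
    using C[of 0] by simp
  have i1: "integrable M (\<lambda>\<omega>. \<phi> (Y \<omega>) * R \<omega>)"
    using mult_mono[OF C[OF Y] R] C0 by (intro integrable_const_bound[of _ "C * 1"]) (auto simp: abs_mult)
  have "\<bar>Y \<omega> ^ i * R \<omega>\<bar> \<le> 1" for i \<omega>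
    using Y[of \<omega>] R[of \<omega>] by (auto simp: abs_mult intro!: mult_le_one power_le_one)
  then have i2: "integrable M (\<lambda>\<omega>. Y \<omega> ^ i * R \<omega>)" for i
    by (intro integrable_const_bound[of _ 1]) auto
  have "(\<integral>\<omega>. \<phi> (Y \<omega>) * R \<omega> \<partial>M) - (\<Sum>i\<le>N. a i * (\<integral>\<omega>. Y \<omega> ^ i * R \<omega> \<partial>M)) =
      (\<integral>\<omega>. \<phi> (Y \<omega>) * R \<omega> - (\<Sum>i\<le>N. a i * (Y \<omega> ^ i * R \<omega>)) \<partial>M)"
    using i1 i2 by simp
  also have "\<bar>\<dots>\<bar> \<le> (\<integral>\<omega>. \<bar>\<phi> (Y \<omega>) * R \<omega> - (\<Sum>i\<le>N. a i * (Y \<omega> ^ i * R \<omega>))\<bar> \<partial>M)"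
    by (rule integral_abs_bound)
  also have "\<dots> \<le> \<epsilon>"
  proof (intro integral_le_const AE_I2)
    show "integrable M (\<lambda>\<omega>. \<bar>\<phi> (Y \<omega>) * R \<omega> - (\<Sum>i\<le>N. a i * (Y \<omega> ^ i * R \<omega>))\<bar>)"
      using i1 i2 by (intro integrable_abs Bochner_Integration.integrable_diff Bochner_Integration.integrable_sum) auto
    fix \<omega>
    have "\<bar>\<phi> (Y \<omega>) * R \<omega> - (\<Sum>i\<le>N. a i * (Y \<omega> ^ i * R \<omega>))\<bar> = \<bar>\<phi> (Y \<omega>) - (\<Sum>i\<le>N. a i * Y \<omega> ^ i)\<bar> * \<bar>R \<omega>\<bar>"
      by (simp add: abs_mult[symmetric] left_diff_distrib sum_distrib_right mult.assoc)
    also have "\<dots> \<le> \<epsilon> * 1"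
      using a[OF Y, of \<omega>] R[of \<omega>] by (intro mult_mono) auto
    finally show "\<bar>\<phi> (Y \<omega>) * R \<omega> - (\<Sum>i\<le>N. a i * (Y \<omega> ^ i * R \<omega>))\<bar> \<le> \<epsilon>"
      by simp
  qed
  finally show ?thesis .
qed

text \<open>Turns the event that a count N equals v into a continuous function of exp (- N), a
  variable in [0, 1] whose moments are Laplace transforms of N.\<close>

lemma exp_bump:
  fixes v :: nat
  obtains \<phi> :: "real \<Rightarrow> real" where "continuous_on UNIV \<phi>" "\<And>k::nat. \<phi> (exp (- real k)) = of_bool (k = v)"
proof -
  \<comment> \<open>The gap between exp (- v) and exp (- (v + 1)); every other point exp (- k) is at
    least this far from exp (- v).\<close>
  define \<delta> where "\<delta> = exp (- real v) * (1 - exp (- 1))"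
  have \<delta>: "0 < \<delta>"
    by (simp add: \<delta>_def)
  define \<phi> where "\<phi> = (\<lambda>y. max 0 (1 - \<bar>y - exp (- real v)\<bar> / \<delta>))"
  have "\<phi> (exp (- real k)) = of_bool (k = v)" for k :: nat
  proof (cases "k = v")
    case False
    have gap: "\<delta> \<le> exp (- real m) - exp (- real m')" if "m < m'" "m \<le> v" for m m' :: nat
    proof -
      have "exp (- real m') \<le> exp (- real m) * exp (- 1)"
        using that by (simp add: exp_add[symmetric])
      moreover have "\<delta> \<le> exp (- real m) * (1 - exp (- 1))"
        using that unfolding \<delta>_def by (intro mult_right_mono) auto
      ultimately show ?thesis
        by (simp add: algebra_simps)
    qed
    have "\<delta> \<le> \<bar>exp (- real k) - exp (- real v)\<bar>"
      using gap[of k v] gap[of v k] False by (cases "k < v") auto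
    then show ?thesis
      using False \<delta> by (simp add: \<phi>_def divide_simps)
  qed (simp add: \<phi>_def)
  moreover have "continuous_on UNIV \<phi>"
    unfolding \<phi>_def using \<delta> by (intro continuous_intros) auto
  ultimately show thesis
    using that by blast
qed

text \<open>Splitting by the values in F leaves an error bounded by the mass outside F. It is
  applied to the prelimit laws and to the limit law with the same F.\<close>

lemma (in prob_space) expectation_finite_approx:
  fixes g :: "'b \<Rightarrow> real"
  assumes F: "finite F" "\<And>v. v \<in> F \<Longrightarrow> {\<omega>\<in>space M. W \<omega> = v} \<in> events"
    and [measurable]: "(\<lambda>\<omega>. g (W \<omega>)) \<in> borel_measurable M" and g: "\<And>v. \<bar>g v\<bar> \<le> 1"
  shows "\<bar>(\<integral>\<omega>. g (W \<omega>) \<partial>M) - (\<Sum>v\<in>F. g v * prob {\<omega>\<in>space M. W \<omega> = v})\<bar> \<le> prob {\<omega>\<in>space M. W \<omega> \<notin> F}"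
    and "prob {\<omega>\<in>space M. W \<omega> \<notin> F} = 1 - (\<Sum>v\<in>F. prob {\<omega>\<in>space M. W \<omega> = v})"
proof -
  let ?A = "\<lambda>v. {\<omega>\<in>space M. W \<omega> = v}"
  have UN: "{\<omega>\<in>space M. W \<omega> \<in> F} = (\<Union>v\<in>F. ?A v)"
    by auto
  have ev: "{\<omega>\<in>space M. W \<omega> \<in> F} \<in> events"
    unfolding UN using F by auto
  have compl: "{\<omega>\<in>space M. W \<omega> \<notin> F} = space M - {\<omega>\<in>space M. W \<omega> \<in> F}"
    by auto
  have ev' [measurable]: "{\<omega>\<in>space M. W \<omega> \<notin> F} \<in> events"
    unfolding compl using ev by auto
  have "prob {\<omega>\<in>space M. W \<omega> \<in> F} = (\<Sum>v\<in>F. prob (?A v))"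
    unfolding UN using F by (intro finite_measure_finite_Union) (auto simp: disjoint_family_on_def)
  then show "prob {\<omega>\<in>space M. W \<omega> \<notin> F} = 1 - (\<Sum>v\<in>F. prob (?A v))"
    unfolding compl using ev by (simp add: prob_compl)
  have ig: "integrable M (\<lambda>\<omega>. g (W \<omega>))"
    using g by (intro integrable_const_bound[of _ 1]) auto
  have ii: "integrable M (indicator (?A v) :: 'a \<Rightarrow> real)" if "v \<in> F" for v
    using F(2)[OF that] by (intro integrable_real_indicator) (auto simp: less_top[symmetric])
  have "(\<integral>\<omega>. g (W \<omega>) \<partial>M) - (\<Sum>v\<in>F. g v * prob (?A v)) = (\<integral>\<omega>. g (W \<omega>) - (\<Sum>v\<in>F. g v * indicator (?A v) \<omega>) \<partial>M)"
  proof (subst Bochner_Integration.integral_diff[OF ig])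
    show "integrable M (\<lambda>\<omega>. \<Sum>v\<in>F. g v * indicator (?A v) \<omega>)"
      using ii by (intro Bochner_Integration.integrable_sum integrable_mult_right)
    have "(\<integral>\<omega>. (\<Sum>v\<in>F. g v * indicator (?A v) \<omega>) \<partial>M) = (\<Sum>v\<in>F. \<integral>\<omega>. g v * indicator (?A v) \<omega> \<partial>M)"
      using ii by (intro Bochner_Integration.integral_sum integrable_mult_right)
    also have "\<dots> = (\<Sum>v\<in>F. g v * prob (?A v))"
      using F(2) by (intro sum.cong) auto
    finally show "(\<integral>\<omega>. g (W \<omega>) \<partial>M) - (\<Sum>v\<in>F. g v * prob (?A v)) =
        (\<integral>\<omega>. g (W \<omega>) \<partial>M) - (\<integral>\<omega>. (\<Sum>v\<in>F. g v * indicator (?A v) \<omega>) \<partial>M)"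
      by simp
  qed
  also have "\<dots> = (\<integral>\<omega>. g (W \<omega>) * indicator {\<omega>\<in>space M. W \<omega> \<notin> F} \<omega> \<partial>M)"
  proof (intro Bochner_Integration.integral_cong refl)
    fix \<omega> assume \<omega>: "\<omega> \<in> space M"
    have "(\<Sum>v\<in>F. g v * indicator (?A v) \<omega>) = (\<Sum>v\<in>F. if v = W \<omega> then g v else 0)"
      using \<omega> by (intro sum.cong) (auto simp: indicator_def)
    then show "g (W \<omega>) - (\<Sum>v\<in>F. g v * indicator (?A v) \<omega>) = g (W \<omega>) * indicator {\<omega>\<in>space M. W \<omega> \<notin> F} \<omega>"
      using F(1) \<omega> by (auto simp: sum.delta indicator_def)
  qed
  also have "\<bar>\<dots>\<bar> \<le> (\<integral>\<omega>. \<bar>g (W \<omega>) * indicator {\<omega>\<in>space M. W \<omega> \<notin> F} \<omega>\<bar> \<partial>M)"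
    by (rule integral_abs_bound)
  also have "\<dots> \<le> (\<integral>\<omega>. indicator {\<omega>\<in>space M. W \<omega> \<notin> F} \<omega> \<partial>M)"
    using g by (intro integral_mono integrable_const_bound[of _ 1]) (auto simp: indicator_def)
  also have "\<dots> = prob {\<omega>\<in>space M. W \<omega> \<notin> F}"
    using ev' by simp
  finally show "\<bar>(\<integral>\<omega>. g (W \<omega>) \<partial>M) - (\<Sum>v\<in>F. g v * prob (?A v))\<bar> \<le> prob {\<omega>\<in>space M. W \<omega> \<notin> F}" .
qed

text \<open>Abstract setting for cell counts. The bound \<open>laplace_ge\<close> is what Jensen's
  inequality would give for counts of mean at most \<open>B i\<close>; it is the source of
  tightness.\<close>

locale count_limit = prob_space M for M :: "'w measure" +
  fixes Y :: "nat \<Rightarrow> 'i \<Rightarrow> 'w \<Rightarrow> nat" and B :: "'i \<Rightarrow> real"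
  assumes meas_Y [measurable]: "\<And>n i. Y n i \<in> M \<rightarrow>\<^sub>M count_space UNIV"
    and conv: "\<And>K t. finite K \<Longrightarrow> (\<And>i. 0 \<le> t i) \<Longrightarrow>
      convergent (\<lambda>n. \<integral>\<omega>. exp (- (\<Sum>i\<in>K. t i * real (Y n i \<omega>))) \<partial>M)"
    and B: "\<And>i. 0 \<le> B i"
    and laplace_ge: "\<And>t n i. 0 \<le> t \<Longrightarrow> exp (- (t * B i)) \<le> (\<integral>\<omega>. exp (- (t * real (Y n i \<omega>))) \<partial>M)"
begin

text \<open>Indicators are introduced one coordinate at a time, by polynomial approximation in
  \<open>exp (- real (Y n j \<omega>))\<close>. Powers of this variable are absorbed into the
  exponent, which is why t is arbitrary in the induction and J stays inside K.\<close>

lemma convergent_mixed: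
  assumes "finite J" "finite K" "J \<subseteq> K" "\<And>i. 0 \<le> t i"
  shows "convergent (\<lambda>n. \<integral>\<omega>. (\<Prod>i\<in>J. of_bool (Y n i \<omega> = v i)) * exp (- (\<Sum>i\<in>K. t i * real (Y n i \<omega>))) \<partial>M)"
  using assms(1,3,4)
proof (induction J arbitrary: t rule: finite_induct)
  case empty
  then show ?case
    using conv[OF assms(2)] by simp
next
  case (insert j J)
  obtain \<phi> :: "real \<Rightarrow> real" where \<phi>: "continuous_on UNIV \<phi>" "\<And>k::nat. \<phi> (exp (- real k)) = of_bool (k = v j)"
    using exp_bump[of "v j"] by blast
  let ?R = "\<lambda>n \<omega>. (\<Prod>i\<in>J. of_bool (Y n i \<omega> = v i)) * exp (- (\<Sum>i\<in>K. t i * real (Y n i \<omega>)))"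
  have R: "\<bar>?R n \<omega>\<bar> \<le> 1" for n \<omega>
    using insert.prems by (auto simp: abs_mult abs_prod intro!: mult_le_one prod_le_1 sum_nonneg)
  have "convergent (\<lambda>n. \<integral>\<omega>. \<phi> (exp (- real (Y n j \<omega>))) * ?R n \<omega> \<partial>M)"
  proof (rule convergent_of_moments[OF \<phi>(1)])
    show "\<bar>(\<integral>\<omega>. \<phi> (exp (- real (Y n j \<omega>))) * ?R n \<omega> \<partial>M) -
       (\<Sum>i\<le>N. a i * (\<integral>\<omega>. exp (- real (Y n j \<omega>)) ^ i * ?R n \<omega> \<partial>M))\<bar> \<le> \<epsilon>"
      if "\<And>y. y \<in> {0..1} \<Longrightarrow> \<bar>\<phi> y - (\<Sum>i\<le>N. a i * y ^ i)\<bar> \<le> \<epsilon>" for a and N :: nat and \<epsilon> n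
      using that R by (intro moments_bound[OF \<phi>(1)]) auto
    fix m :: nat
    define t' where "t' = t(j := t j + real m)"
    have "(\<Sum>i\<in>K. t' i * real (Y n i \<omega>)) = real m * real (Y n j \<omega>) + (\<Sum>i\<in>K. t i * real (Y n i \<omega>))" for n \<omega>
      using insert.prems(1) assms(2) by (auto simp: t'_def sum.remove[of K j] algebra_simps)
    then have eq: "exp (- real (Y n j \<omega>)) ^ m * ?R n \<omega> =
        (\<Prod>i\<in>J. of_bool (Y n i \<omega> = v i)) * exp (- (\<Sum>i\<in>K. t' i * real (Y n i \<omega>)))" for n \<omega>
      by (simp add: exp_of_nat_mult[symmetric] exp_diff exp_minus field_simps)
    have "convergent (\<lambda>n. \<integral>\<omega>. (\<Prod>i\<in>J. of_bool (Y n i \<omega> = v i)) * exp (- (\<Sum>i\<in>K. t' i * real (Y n i \<omega>))) \<partial>M)"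
      by (rule insert.IH) (use insert.prems in \<open>auto simp: t'_def\<close>)
    then show "convergent (\<lambda>n. \<integral>\<omega>. exp (- real (Y n j \<omega>)) ^ m * ?R n \<omega> \<partial>M)"
      by (simp only: eq)
  qed
  then show ?case
    using insert.hyps by (simp add: \<phi>(2) mult.assoc)
qed

section \<open>Limit laws of finitely many counts\<close>

definition proj :: "nat \<Rightarrow> 'i set \<Rightarrow> 'w \<Rightarrow> 'i \<Rightarrow> nat" where
  "proj n K \<omega> = (\<lambda>i\<in>K. Y n i \<omega>)"

definition lim_mass :: "'i set \<Rightarrow> ('i \<Rightarrow> nat) \<Rightarrow> real" where
  "lim_mass K v = lim (\<lambda>n. prob {\<omega>\<in>space M. proj n K \<omega> = v})"

lemma proj_eq_iff: "proj n K \<omega> = v \<longleftrightarrow> v \<in> extensional K \<and> (\<forall>i\<in>K. Y n i \<omega> = v i)"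
  by (auto simp: proj_def restrict_def extensional_def fun_eq_iff)

lemma sets_proj_eq [measurable]:
  assumes "finite K"
  shows "{\<omega>\<in>space M. proj n K \<omega> = v} \<in> events"
  unfolding proj_eq_iff using assms by measurable

lemma measurable_proj [measurable]:
  assumes "finite K"
  shows "proj n K \<in> M \<rightarrow>\<^sub>M count_space (PiE K (\<lambda>_. UNIV))"
proof -
  have "countable (PiE K (\<lambda>_. UNIV :: nat set))"
    using assms by (intro countable_PiE) auto
  moreover have "proj n K -` {a} \<inter> space M = {\<omega>\<in>space M. proj n K \<omega> = a}" for a
    by auto
  then have "proj n K \<in> space M \<rightarrow> PiE K (\<lambda>_. UNIV)" "\<forall>a\<in>PiE K (\<lambda>_. UNIV). proj n K -` {a} \<inter> space M \<in> events"
    using sets_proj_eq[OF assms] by (auto simp: proj_def)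
  ultimately show ?thesis
    by (simp add: measurable_count_space_eq_countable)
qed

lemma tendsto_lim_mass:
  assumes "finite K"
  shows "(\<lambda>n. prob {\<omega>\<in>space M. proj n K \<omega> = v}) \<longlonglongrightarrow> lim_mass K v"
proof -
  have "convergent (\<lambda>n. prob {\<omega>\<in>space M. proj n K \<omega> = v})"
  proof (cases "v \<in> extensional K")
    case True
    have "prob {\<omega>\<in>space M. proj n K \<omega> = v} = (\<integral>\<omega>. (\<Prod>i\<in>K. of_bool (Y n i \<omega> = v i)) * exp (- (\<Sum>i\<in>K. 0 * real (Y n i \<omega>))) \<partial>M)" for n
    proof -
      have "prob {\<omega>\<in>space M. proj n K \<omega> = v} = (\<integral>\<omega>. indicator {\<omega>\<in>space M. proj n K \<omega> = v} \<omega> \<partial>M)"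
        using sets_proj_eq[OF assms] by simp
      also have "\<dots> = (\<integral>\<omega>. (\<Prod>i\<in>K. of_bool (Y n i \<omega> = v i)) * exp (- (\<Sum>i\<in>K. 0 * real (Y n i \<omega>))) \<partial>M)"
      proof (intro Bochner_Integration.integral_cong refl)
        fix \<omega> assume "\<omega> \<in> space M"
        then show "indicator {\<omega>\<in>space M. proj n K \<omega> = v} \<omega> = ((\<Prod>i\<in>K. of_bool (Y n i \<omega> = v i)) * exp (- (\<Sum>i\<in>K. 0 * real (Y n i \<omega>))) :: real)"
          using True assms by (cases "\<forall>i\<in>K. Y n i \<omega> = v i") (auto simp: proj_eq_iff prod_zero_iff)
      qed
      finally show ?thesis .
    qed
    then show ?thesis
      using convergent_mixed[OF assms assms, of "\<lambda>_. 0" v] by simp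
  next
    case False
    then show ?thesis
      by (simp add: proj_eq_iff convergent_const)
  qed
  then show ?thesis
    unfolding lim_mass_def by (simp add: convergent_LIMSEQ_iff)
qed

lemma tight_single:
  assumes "0 < \<epsilon>"
  shows "\<exists>m::nat. \<forall>n. prob {\<omega>\<in>space M. m < Y n i \<omega>} \<le> \<epsilon>"
proof -
  define q where "q = 1 - exp (- 1 :: real)"
  have q: "0 < q" by (simp add: q_def)
  obtain m :: nat where m: "B i / (q * \<epsilon>) < real m"
    using reals_Archimedean2 by blast
  have "prob {\<omega>\<in>space M. m < Y n i \<omega>} \<le> \<epsilon>" for n
  proof -
    let ?A = "{\<omega>\<in>space M. m < Y n i \<omega>}"
    \<comment> \<open>With this t the exponent is at least 1 once the count exceeds m, since the
      count is an integer; there the integrand is at most 1 - q. The choice of m makes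
      \<open>t * B i\<close> at most \<open>q * \<epsilon>\<close>.\<close>
    define t where "t = 1 / (real m + 1)"
    have A: "?A \<in> events"
      by measurable
    have "exp (- (t * B i)) \<le> (\<integral>\<omega>. exp (- (t * real (Y n i \<omega>))) \<partial>M)"
      by (intro laplace_ge) (simp add: t_def)
    also have "\<dots> \<le> (\<integral>\<omega>. 1 - q * indicator ?A \<omega> \<partial>M)"
    proof (intro integral_mono integrable_const_bound[of _ 1])
      fix \<omega> assume "\<omega> \<in> space M"
      show "exp (- (t * real (Y n i \<omega>))) \<le> 1 - q * indicator ?A \<omega>"
      proof (cases "\<omega> \<in> ?A")
        case True
        then have "1 \<le> t * real (Y n i \<omega>)"
          by (auto simp: t_def divide_simps)
        with True show ?thesis
          by (simp add: q_def)
      next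
        case False
        then show ?thesis
          by (simp add: t_def)
      qed
    qed (auto simp: t_def q_def A indicator_def)
    also have "\<dots> = 1 - q * prob ?A"
      using A by (subst Bochner_Integration.integral_diff) (auto simp: prob_space less_top[symmetric])
    finally have "q * prob ?A \<le> 1 - exp (- (t * B i))"
      by simp
    also have "\<dots> \<le> t * B i"
      using exp_ge_add_one_self[of "- (t * B i)"] by simp
    also have "\<dots> \<le> q * \<epsilon>"
    proof -
      have "B i < real m * (q * \<epsilon>)"
        using m q assms by (simp add: pos_divide_less_eq)
      also have "\<dots> \<le> (real m + 1) * (q * \<epsilon>)"
        using q assms by (intro mult_right_mono) auto
      finally show ?thesis
        by (simp add: t_def divide_simps) (simp add: algebra_simps)
    qed
    finally show ?thesis
      using q by simp
  qed
  then show ?thesis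
    by blast
qed

lemma tight:
  assumes "finite K" "0 < \<epsilon>"
  shows "\<exists>m::nat. \<forall>n. prob {\<omega>\<in>space M. \<exists>i\<in>K. m < Y n i \<omega>} \<le> \<epsilon>"
  using assms
proof (induction K arbitrary: \<epsilon> rule: finite_induct)
  case empty
  then show ?case by (auto intro: less_imp_le)
next
  case (insert j K)
  obtain m1 where m1: "\<And>n. prob {\<omega>\<in>space M. \<exists>i\<in>K. m1 < Y n i \<omega>} \<le> \<epsilon> / 2"
    using insert.IH[of "\<epsilon> / 2"] insert.prems by auto
  obtain m2 where m2: "\<And>n. prob {\<omega>\<in>space M. m2 < Y n j \<omega>} \<le> \<epsilon> / 2"
    using tight_single[of "\<epsilon> / 2" j] insert.prems by auto
  have "prob {\<omega>\<in>space M. \<exists>i\<in>insert j K. max m1 m2 < Y n i \<omega>} \<le> \<epsilon>" for n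
  proof -
    have [measurable]: "{\<omega>\<in>space M. \<exists>i\<in>K. m1 < Y n i \<omega>} \<in> events" "{\<omega>\<in>space M. m2 < Y n j \<omega>} \<in> events"
      using insert.hyps(1) by measurable
    have "prob {\<omega>\<in>space M. \<exists>i\<in>insert j K. max m1 m2 < Y n i \<omega>} \<le>
        prob ({\<omega>\<in>space M. \<exists>i\<in>K. m1 < Y n i \<omega>} \<union> {\<omega>\<in>space M. m2 < Y n j \<omega>})"
      by (intro finite_measure_mono) auto
    also have "\<dots> \<le> prob {\<omega>\<in>space M. \<exists>i\<in>K. m1 < Y n i \<omega>} + prob {\<omega>\<in>space M. m2 < Y n j \<omega>}"
      by (rule measure_Un_le) measurable
    also have "\<dots> \<le> \<epsilon>"
      using m1[of n] m2[of n] by simp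
    finally show ?thesis .
  qed
  then show ?case by blast
qed

abbreviation box :: "'i set \<Rightarrow> nat \<Rightarrow> ('i \<Rightarrow> nat) set" where
  "box K m \<equiv> PiE K (\<lambda>_. {..m})"

lemma finite_box [simp]: "finite K \<Longrightarrow> finite (box K m)"
  by (intro finite_PiE) auto

lemma proj_notin_box: "proj n K \<omega> \<notin> box K m \<longleftrightarrow> (\<exists>i\<in>K. m < Y n i \<omega>)"
  by (auto simp: proj_def PiE_iff not_le)

lemma sum_prob_proj:
  assumes "finite K" "finite F"
  shows "(\<Sum>v\<in>F. prob {\<omega>\<in>space M. proj n K \<omega> = v}) = 1 - prob {\<omega>\<in>space M. proj n K \<omega> \<notin> F}"
  using expectation_finite_approx(2)[of F "proj n K" "\<lambda>_. 0"] assms by simp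

lemma lim_mass_nonneg:
  "finite K \<Longrightarrow> 0 \<le> lim_mass K v"
  by (rule LIMSEQ_le_const[OF tendsto_lim_mass]) auto

lemma sum_lim_mass_le:
  assumes "finite K" "finite F"
  shows "(\<Sum>v\<in>F. lim_mass K v) \<le> 1"
  by (rule LIMSEQ_le_const2[OF tendsto_sum[OF tendsto_lim_mass[OF assms(1)]]])
     (auto simp: sum_prob_proj[OF assms])

lemma sum_lim_mass_ge:
  assumes "finite K" "0 < \<epsilon>"
  shows "\<exists>m. (\<forall>n. prob {\<omega>\<in>space M. proj n K \<omega> \<notin> box K m} \<le> \<epsilon>) \<and> 1 - \<epsilon> \<le> (\<Sum>v\<in>box K m. lim_mass K v)"
proof -
  obtain m where m: "\<And>n. prob {\<omega>\<in>space M. proj n K \<omega> \<notin> box K m} \<le> \<epsilon>"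
    using tight[OF assms] by (auto simp: proj_notin_box)
  have "1 - \<epsilon> \<le> (\<Sum>v\<in>box K m. prob {\<omega>\<in>space M. proj n K \<omega> = v})" for n
    using m[of n] by (simp add: sum_prob_proj assms(1))
  then have "1 - \<epsilon> \<le> (\<Sum>v\<in>box K m. lim_mass K v)"
    by (intro LIMSEQ_le_const[OF tendsto_sum[OF tendsto_lim_mass[OF assms(1)]]]) auto
  with m show ?thesis by blast
qed

text \<open>Pointwise limits of probabilities can lose mass. Tightness provides boxes that retain at
  least 1 - \<epsilon> of it, which gives the total mass 1 that \<open>embed_pmf\<close>
  needs.\<close>

lemma nn_integral_lim_mass:
  assumes K: "finite K"
  shows "(\<integral>\<^sup>+v. ennreal (lim_mass K v) \<partial>count_space UNIV) = 1"
proof -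
  have 0: "lim_mass K v = 0" if "v \<notin> extensional K" for v
    using that LIMSEQ_unique[OF tendsto_lim_mass[OF K, of v]] by (simp add: proj_eq_iff)
  have inc: "incseq (\<lambda>m. box K m)"
    by (auto simp: incseq_def PiE_iff) (meson order_trans)
  have eq: "ennreal (lim_mass K v) = (SUP m. ennreal (lim_mass K v) * indicator (box K m) v)" for v
  proof (cases "v \<in> extensional K")
    case True
    define m where "m = Max (insert 0 (v ` K))"
    have v: "v \<in> box K m"
      using True K by (auto simp: PiE_iff m_def)
    show ?thesis
    proof (rule antisym)
      show "ennreal (lim_mass K v) \<le> (SUP m. ennreal (lim_mass K v) * indicator (box K m) v)"
        using v by (intro SUP_upper2[of m]) auto
      show "(SUP m. ennreal (lim_mass K v) * indicator (box K m) v) \<le> ennreal (lim_mass K v)"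
        by (intro SUP_least) (simp add: indicator_def)
    qed
  qed (simp add: 0)
  have box: "(\<integral>\<^sup>+v. ennreal (lim_mass K v) * indicator (box K m) v \<partial>count_space UNIV) = ennreal (\<Sum>v\<in>box K m. lim_mass K v)" for m
    using K lim_mass_nonneg[OF K]
    by (subst nn_integral_count_space_indicator[symmetric]) (auto simp: nn_integral_count_space_finite sum_ennreal)
  have "(\<integral>\<^sup>+v. ennreal (lim_mass K v) \<partial>count_space UNIV) = (SUP m. ennreal (\<Sum>v\<in>box K m. lim_mass K v))"
    unfolding box[symmetric]
    by (subst eq, intro nn_integral_monotone_convergence_SUP)
       (use inc in \<open>auto simp: incseq_def le_fun_def split: split_indicator\<close>)
  also have "\<dots> = 1"
  proof (rule antisym)
    show "(SUP m. ennreal (\<Sum>v\<in>box K m. lim_mass K v)) \<le> 1"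
      using sum_lim_mass_le[OF K] K by (intro SUP_least) (simp add: ennreal_le_1)
    show "1 \<le> (SUP m. ennreal (\<Sum>v\<in>box K m. lim_mass K v))"
    proof (rule ennreal_le_epsilon)
      fix \<epsilon> :: real assume "0 < \<epsilon>"
      obtain m where m: "1 - \<epsilon> \<le> (\<Sum>v\<in>box K m. lim_mass K v)"
        using sum_lim_mass_ge[OF K \<open>0 < \<epsilon>\<close>] by blast
      have "ennreal 1 \<le> ennreal ((\<Sum>v\<in>box K m. lim_mass K v) + \<epsilon>)"
        using m by (intro ennreal_leI) simp
      also have "\<dots> = ennreal (\<Sum>v\<in>box K m. lim_mass K v) + ennreal \<epsilon>"
        using \<open>0 < \<epsilon>\<close> lim_mass_nonneg[OF K] by (intro ennreal_plus sum_nonneg) auto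
      also have "\<dots> \<le> (SUP m. ennreal (\<Sum>v\<in>box K m. lim_mass K v)) + ennreal \<epsilon>"
        by (intro add_right_mono SUP_upper) simp
      finally show "1 \<le> (SUP m. ennreal (\<Sum>v\<in>box K m. lim_mass K v)) + ennreal \<epsilon>"
        by simp
    qed
  qed
  finally show ?thesis .
qed

definition lim_pmf :: "'i set \<Rightarrow> ('i \<Rightarrow> nat) pmf" where
  "lim_pmf K = embed_pmf (lim_mass K)"

lemma pmf_lim_pmf: "finite K \<Longrightarrow> pmf (lim_pmf K) v = lim_mass K v"
  unfolding lim_pmf_def by (intro pmf_embed_pmf lim_mass_nonneg nn_integral_lim_mass)

text \<open>On a countable state space, pointwise convergence of the masses and tightness give
  convergence for every bounded g. Discontinuous test functions are thus available later, for the
  failure of additivity.\<close>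

lemma tendsto_lim_pmf:
  fixes g :: "('i \<Rightarrow> nat) \<Rightarrow> real"
  assumes K: "finite K" and g: "\<And>v. \<bar>g v\<bar> \<le> 1"
  shows "(\<lambda>n. \<integral>\<omega>. g (proj n K \<omega>) \<partial>M) \<longlonglongrightarrow> (\<integral>v. g v \<partial>lim_pmf K)"
proof (rule metric_LIMSEQ_I)
  fix \<epsilon> :: real assume "0 < \<epsilon>"
  then have e4: "0 < \<epsilon> / 4" by simp
  obtain m where m: "\<And>n. prob {\<omega>\<in>space M. proj n K \<omega> \<notin> box K m} \<le> \<epsilon> / 4"
    "1 - \<epsilon> / 4 \<le> (\<Sum>v\<in>box K m. lim_mass K v)"
    using sum_lim_mass_ge[OF K e4] by blast
  let ?s = "\<lambda>n. \<Sum>v\<in>box K m. g v * prob {\<omega>\<in>space M. proj n K \<omega> = v}"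
  let ?s' = "\<Sum>v\<in>box K m. g v * lim_mass K v"
  have "(\<lambda>\<omega>. g (proj n K \<omega>)) \<in> borel_measurable M" for n
    using measurable_compose[OF measurable_proj[OF K], of g borel] by simp
  then have 1: "\<bar>(\<integral>\<omega>. g (proj n K \<omega>) \<partial>M) - ?s n\<bar> \<le> \<epsilon> / 4" for n
    using m(1)[of n] expectation_finite_approx(1)[of "box K m" "proj n K" g] K g by (auto intro: order_trans)
  have 2: "\<bar>(\<integral>v. g v \<partial>lim_pmf K) - ?s'\<bar> \<le> \<epsilon> / 4"
  proof -
    have p: "measure_pmf.prob (lim_pmf K) {v} = lim_mass K v" for v
      using K by (simp add: pmf_lim_pmf[symmetric] measure_pmf_single)
    show ?thesis
      using measure_pmf.expectation_finite_approx[of "box K m" "lim_pmf K" "\<lambda>v. v" g] K g m(2) by (simp add: p)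
  qed
  have "?s \<longlonglongrightarrow> ?s'"
    by (intro tendsto_sum tendsto_mult tendsto_const tendsto_lim_mass K)
  from metric_LIMSEQ_D[OF this e4] obtain N where N: "\<And>n. N \<le> n \<Longrightarrow> dist (?s n) ?s' < \<epsilon> / 4"
    by blast
  have "dist (\<integral>\<omega>. g (proj n K \<omega>) \<partial>M) (\<integral>v. g v \<partial>lim_pmf K) < \<epsilon>" if "N \<le> n" for n
    using N[OF that] 1[of n] 2 unfolding dist_real_def by linarith
  then show "\<exists>N. \<forall>n\<ge>N. dist (\<integral>\<omega>. g (proj n K \<omega>) \<partial>M) (\<integral>v. g v \<partial>lim_pmf K) < \<epsilon>"
    by blast
qed

text \<open>The prelimit laws are consistent, and consistency survives because limits are
  unique.\<close>

lemma lim_pmf_projective: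
  assumes H: "finite H" and J: "J \<subseteq> H"
  shows "map_pmf (\<lambda>v. restrict v J) (lim_pmf H) = lim_pmf J"
proof (rule pmf_eqI)
  fix w
  have J': "finite J"
    using H J by (rule finite_subset[rotated])
  have "(\<lambda>n. \<integral>\<omega>. indicator {v. restrict v J = w} (proj n H \<omega>) \<partial>M) \<longlonglongrightarrow>
      (\<integral>v. indicator {v. restrict v J = w} v \<partial>lim_pmf H :: real)"
    by (rule tendsto_lim_pmf[where g="indicator {v. restrict v J = w}", OF H]) (simp add: indicator_def)
  moreover have "(\<integral>\<omega>. indicator {v. restrict v J = w} (proj n H \<omega>) \<partial>M) = prob {\<omega>\<in>space M. proj n J \<omega> = w}" for n
  proof -
    have "restrict (proj n H \<omega>) J = proj n J \<omega>" for \<omega>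
      using J by (auto simp: proj_def fun_eq_iff)
    then have "(\<integral>\<omega>. indicator {v. restrict v J = w} (proj n H \<omega>) \<partial>M) =
        (\<integral>\<omega>. indicator {\<omega>\<in>space M. proj n J \<omega> = w} \<omega> \<partial>M :: real)"
      by (intro Bochner_Integration.integral_cong) (auto simp: indicator_def)
    then show ?thesis
      using sets_proj_eq[OF J'] by simp
  qed
  moreover have "(\<integral>v. indicator {v. restrict v J = w} v \<partial>lim_pmf H) = pmf (map_pmf (\<lambda>v. restrict v J) (lim_pmf H)) w"
    by (simp add: pmf_map vimage_def)
  ultimately show "pmf (map_pmf (\<lambda>v. restrict v J) (lim_pmf H)) w = pmf (lim_pmf J) w"
    using LIMSEQ_unique[OF _ tendsto_lim_mass[OF J', of w]] by (simp add: pmf_lim_pmf J')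
qed

section \<open>Kolmogorov extension of the limit laws\<close>

definition lim_measure :: "'i set \<Rightarrow> ('i \<Rightarrow> real) measure" where
  "lim_measure K = distr (lim_pmf K) (PiM K (\<lambda>_. borel)) (\<lambda>v. \<lambda>i\<in>K. real (v i))"

lemma measurable_real_restrict [measurable]:
  "(\<lambda>v. \<lambda>i\<in>K. real (v i)) \<in> measure_pmf p \<rightarrow>\<^sub>M PiM K (\<lambda>_. borel)"
  by (auto simp: measurable_def space_PiM)

text \<open>The counts have been moved to real coordinates, a Polish space as Kolmogorov's theorem
  requires. That they are natural numbers is recovered afterwards as an almost sure
  property.\<close>

lemma polish_projective_lim_measure: "polish_projective UNIV lim_measure"
  unfolding polish_projective_def
proof (rule projective_family.intro)
  fix J H :: "'i set" assume JH: "J \<subseteq> H" "finite H"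
  have "distr (lim_measure H) (PiM J (\<lambda>_. borel)) (\<lambda>f. restrict f J) =
      distr (lim_pmf H) (PiM J (\<lambda>_. borel)) (\<lambda>v. \<lambda>i\<in>J. real (v i))"
    unfolding lim_measure_def using JH
    by (subst distr_distr) (auto intro!: distr_cong measurable_restrict_subset simp: fun_eq_iff comp_def space_PiM)
  also have "\<dots> = distr (map_pmf (\<lambda>v. restrict v J) (lim_pmf H)) (PiM J (\<lambda>_. borel)) (\<lambda>v. \<lambda>i\<in>J. real (v i))"
    unfolding map_pmf_rep_eq by (subst distr_distr) (auto intro!: distr_cong simp: fun_eq_iff comp_def measurable_def space_PiM)
  also have "\<dots> = lim_measure J"
    unfolding lim_pmf_projective[OF JH(2,1)] lim_measure_def ..
  finally show "lim_measure J = distr (lim_measure H) (PiM J (\<lambda>_. borel)) (\<lambda>f. restrict f J)" ..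
next
  fix J :: "'i set" assume "finite J"
  show "prob_space (lim_measure J)"
    unfolding lim_measure_def by (intro measure_pmf.prob_space_distr) measurable
qed

lemma count_limit_exists:
  obtains Q :: "('i \<Rightarrow> real) measure" where "prob_space Q" "sets Q = sets (PiM UNIV (\<lambda>_. borel))"
    and "\<And>K g. finite K \<Longrightarrow> (\<And>v. \<bar>g v\<bar> \<le> 1) \<Longrightarrow> g \<in> borel_measurable (PiM K (\<lambda>_. borel)) \<Longrightarrow>
      (\<lambda>n. \<integral>\<omega>. g (\<lambda>i\<in>K. real (Y n i \<omega>)) \<partial>M) \<longlonglongrightarrow> (\<integral>x. g (restrict x K) \<partial>Q :: real)"
proof -
  interpret P: polish_projective UNIV lim_measure
    by (rule polish_projective_lim_measure)
  show thesis
  proof (rule that[of P.lim])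
    show "prob_space P.lim"
      by (rule P.P.prob_space_axioms)
    fix K :: "'i set" and g :: "('i \<Rightarrow> real) \<Rightarrow> real"
    assume K: "finite K" and g: "\<And>v. \<bar>g v\<bar> \<le> 1" and [measurable]: "g \<in> borel_measurable (PiM K (\<lambda>_. borel))"
    have eq: "lim_measure K = distr P.lim (PiM K (\<lambda>_. borel)) (\<lambda>x. restrict x K)"
    proof (rule measure_eqI)
      fix A assume "A \<in> sets (lim_measure K)"
      then have A: "A \<in> sets (PiM K (\<lambda>_. borel))"
        by (simp add: lim_measure_def)
      have m: "(\<lambda>x. restrict x K) \<in> P.lim \<rightarrow>\<^sub>M PiM K (\<lambda>_. borel)"
        by (subst measurable_cong_sets[OF P.sets_lim refl]) (intro measurable_restrict_subset, simp)
      have "(\<lambda>x. restrict x K) -` A \<inter> space P.lim = prod_emb UNIV (\<lambda>_. borel) K A"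
        by (auto simp: prod_emb_def space_PiM)
      then show "emeasure (lim_measure K) A = emeasure (distr P.lim (PiM K (\<lambda>_. borel)) (\<lambda>x. restrict x K)) A"
        using P.emeasure_lim_emb[of K A] A K by (simp add: emeasure_distr[OF m])
    qed (simp add: lim_measure_def)
    have "(\<lambda>n. \<integral>\<omega>. g (\<lambda>i\<in>K. real (proj n K \<omega> i)) \<partial>M) \<longlonglongrightarrow> (\<integral>v. g (\<lambda>i\<in>K. real (v i)) \<partial>lim_pmf K)"
      using g by (intro tendsto_lim_pmf[OF K])
    also have "(\<lambda>n. \<integral>\<omega>. g (\<lambda>i\<in>K. real (proj n K \<omega> i)) \<partial>M) = (\<lambda>n. \<integral>\<omega>. g (\<lambda>i\<in>K. real (Y n i \<omega>)) \<partial>M)"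
      by (intro ext Bochner_Integration.integral_cong refl arg_cong[of _ _ g]) (auto simp: proj_def)
    also have "(\<integral>v. g (\<lambda>i\<in>K. real (v i)) \<partial>lim_pmf K) = (\<integral>x. g x \<partial>lim_measure K)"
      unfolding lim_measure_def by (rule integral_distr[symmetric]) measurable
    also have "\<dots> = (\<integral>x. g (restrict x K) \<partial>P.lim)"
      unfolding eq
      by (rule integral_distr) (subst measurable_cong_sets[OF P.sets_lim refl], intro measurable_restrict_subset, simp, measurable)
    finally show "(\<lambda>n. \<integral>\<omega>. g (\<lambda>i\<in>K. real (Y n i \<omega>)) \<partial>M) \<longlonglongrightarrow> (\<integral>x. g (restrict x K) \<partial>P.lim)" .
  qed simp
qed

end

section \<open>Counting measures from cell counts\<close>


text \<open>The fibres are half-open dyadic cubes of side \<open>1 / 2 ^ k\<close>. With rounding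
  maps in place of cubes, nesting becomes the identity \<open>grid_grid\<close>.\<close>

definition grid :: "nat \<Rightarrow> 'a::euclidean_space \<Rightarrow> 'a" where
  "grid k x = (\<Sum>b\<in>Basis. (real_of_int \<lfloor>2 ^ k * (x \<bullet> b)\<rfloor> / 2 ^ k) *\<^sub>R b)"

lemma inner_grid: "b \<in> Basis \<Longrightarrow> grid k x \<bullet> b = real_of_int \<lfloor>2 ^ k * (x \<bullet> b)\<rfloor> / 2 ^ k"
  by (simp add: grid_def)

lemma dist_grid: "dist x (grid k x) \<le> real DIM('a) / 2 ^ k" for x :: "'a::euclidean_space"
proof -
  have "norm (x - grid k x) \<le> (\<Sum>b\<in>Basis. \<bar>(x - grid k x) \<bullet> b\<bar>)"
    by (rule norm_le_l1)
  also have "\<dots> \<le> (\<Sum>b\<in>(Basis :: 'a set). 1 / 2 ^ k)"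
  proof (rule sum_mono)
    fix b :: 'a assume b: "b \<in> Basis"
    have "x \<bullet> b - grid k x \<bullet> b = (2 ^ k * (x \<bullet> b) - real_of_int \<lfloor>2 ^ k * (x \<bullet> b)\<rfloor>) / 2 ^ k"
      using b by (simp add: inner_grid diff_divide_distrib)
    moreover have "0 \<le> 2 ^ k * (x \<bullet> b) - real_of_int \<lfloor>2 ^ k * (x \<bullet> b)\<rfloor>"
      "2 ^ k * (x \<bullet> b) - real_of_int \<lfloor>2 ^ k * (x \<bullet> b)\<rfloor> \<le> 1"
      by linarith+
    ultimately show "\<bar>(x - grid k x) \<bullet> b\<bar> \<le> 1 / 2 ^ k"
      by (simp add: inner_diff_left divide_right_mono)
  qed
  finally show ?thesis
    by (simp add: dist_norm)
qed

lemma dist_grid_le: "dist x (grid k x) \<le> real DIM('a)" for x :: "'a::euclidean_space"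
proof -
  have "real DIM('a) / 2 ^ k \<le> real DIM('a) / 1"
    by (intro divide_left_mono) auto
  then show ?thesis
    using dist_grid[of x k] by simp
qed

text \<open>In each coordinate, dividing a floor by \<open>2 ^ j\<close> and taking the floor again
  gives the floor of the quotient.\<close>

lemma grid_grid:
  assumes "k \<le> m"
  shows "grid k (grid m x) = grid k x"
proof (rule euclidean_eqI)
  fix b :: 'a assume b: "b \<in> Basis"
  obtain j where m: "m = k + j"
    using assms le_Suc_ex by blast
  let ?z = "2 ^ m * (x \<bullet> b)"
  have "2 ^ k * (real_of_int \<lfloor>?z\<rfloor> / 2 ^ m) = real_of_int \<lfloor>?z\<rfloor> / real_of_int (2 ^ j)"
    by (simp add: m power_add)
  then have "\<lfloor>2 ^ k * (real_of_int \<lfloor>?z\<rfloor> / 2 ^ m)\<rfloor> = \<lfloor>?z\<rfloor> div 2 ^ j"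
    by (simp only: floor_divide_of_int_eq)
  also have "\<dots> = \<lfloor>?z / real_of_int (2 ^ j)\<rfloor>"
    by (rule floor_divide_real_eq_div[symmetric]) simp
  also have "?z / real_of_int (2 ^ j) = 2 ^ k * (x \<bullet> b)"
    by (simp add: m power_add)
  finally show "grid k (grid m x) \<bullet> b = grid k x \<bullet> b"
    using b by (simp add: inner_grid)
qed

lemma grid_range: "p \<in> range (grid k) \<Longrightarrow> grid k p = p"
  by (auto simp: grid_grid)

lemma countable_range_grid: "countable (range (grid k :: 'a::euclidean_space \<Rightarrow> 'a))"
proof -
  have "range (grid k) \<subseteq> (\<lambda>v. \<Sum>b\<in>Basis. (real_of_int (v b) / 2 ^ k) *\<^sub>R b) ` (PiE (Basis :: 'a set) (\<lambda>_. UNIV))"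
  proof
    fix p :: 'a assume "p \<in> range (grid k)"
    then obtain x where "p = grid k x" by auto
    then show "p \<in> (\<lambda>v. \<Sum>b\<in>Basis. (real_of_int (v b) / 2 ^ k) *\<^sub>R b) ` (PiE (Basis :: 'a set) (\<lambda>_. UNIV))"
      by (intro rev_image_eqI[of "\<lambda>b\<in>Basis. \<lfloor>2 ^ k * (x \<bullet> b)\<rfloor>"]) (auto simp: grid_def)
  qed
  moreover have "countable (PiE (Basis :: 'a set) (\<lambda>_. UNIV :: int set))"
    by (intro countable_PiE) auto
  ultimately show ?thesis
    by (meson countable_image countable_subset)
qed

lemma finite_grid_image:
  fixes S :: "'a::euclidean_space set"
  assumes "bounded S"
  shows "finite (grid k ` S)"
proof -
  obtain R where R: "\<And>x. x \<in> S \<Longrightarrow> norm x \<le> R"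
    using assms by (auto simp: bounded_iff)
  let ?P = "PiE (Basis :: 'a set) (\<lambda>_. {\<lfloor>- (2 ^ k * R)\<rfloor>..\<lfloor>2 ^ k * R\<rfloor>})"
  have "grid k ` S \<subseteq> (\<lambda>v. \<Sum>b\<in>Basis. (real_of_int (v b) / 2 ^ k) *\<^sub>R b) ` ?P"
  proof
    fix p assume "p \<in> grid k ` S"
    then obtain x where x: "x \<in> S" "p = grid k x" by auto
    have "\<lfloor>- (2 ^ k * R)\<rfloor> \<le> \<lfloor>2 ^ k * (x \<bullet> b)\<rfloor> \<and> \<lfloor>2 ^ k * (x \<bullet> b)\<rfloor> \<le> \<lfloor>2 ^ k * R\<rfloor>" if "b \<in> Basis" for b
    proof -
      have "\<bar>2 ^ k * (x \<bullet> b)\<bar> \<le> 2 ^ k * R"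
        using Basis_le_norm[OF that, of x] R[OF x(1)] by (simp add: abs_mult)
      then have "- (2 ^ k * R) \<le> 2 ^ k * (x \<bullet> b)" "2 ^ k * (x \<bullet> b) \<le> 2 ^ k * R"
        by linarith+
      then show ?thesis
        by (intro conjI floor_mono)
    qed
    then have "(\<lambda>b\<in>Basis. \<lfloor>2 ^ k * (x \<bullet> b)\<rfloor>) \<in> ?P"
      by (simp add: PiE_iff)
    then show "p \<in> (\<lambda>v. \<Sum>b\<in>Basis. (real_of_int (v b) / 2 ^ k) *\<^sub>R b) ` ?P"
      by (rule rev_image_eqI) (simp add: x grid_def)
  qed
  moreover have "finite ?P"
    by (intro finite_PiE) auto
  ultimately show ?thesis
    by (meson finite_imageI finite_subset)
qed

lemma finite_range_grid_bounded:
  assumes "bounded S"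
  shows "finite (range (grid k) \<inter> S)"
proof (rule finite_subset[OF _ finite_grid_image[OF assms, of k]])
  show "range (grid k) \<inter> S \<subseteq> grid k ` S"
    by (metis IntE grid_range imageI subsetI)
qed

lemma measurable_grid [measurable]: "grid k \<in> borel \<rightarrow>\<^sub>M borel"
  unfolding grid_def by measurable

lemma grid_tendsto: "(\<lambda>k. grid k x) \<longlonglongrightarrow> (x :: 'a::euclidean_space)"
proof -
  have 1: "(\<lambda>k. real DIM('a) * (1 / 2) ^ k) \<longlonglongrightarrow> 0"
    by (intro tendsto_mult_right_zero LIMSEQ_power_zero) simp
  have 2: "dist (grid k x) x \<le> real DIM('a) * (1 / 2) ^ k" for k
  proof -
    have "real DIM('a) * (1 / 2) ^ k = real DIM('a) / 2 ^ k"
      by (simp add: power_one_over)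
    then show ?thesis
      using dist_grid[of x k] by (subst dist_commute) simp
  qed
  have "(\<lambda>k. dist (grid k x) x) \<longlonglongrightarrow> 0"
    by (rule real_tendsto_sandwich[OF _ _ tendsto_const 1]) (simp_all add: 2)
  then show ?thesis
    by (rule tendsto_dist_iff[THEN iffD2])
qed

text \<open>The cells of level k are the fibres of \<open>grid k\<close>, labelled by their corners.\<close>
definition children :: "nat \<Rightarrow> 'a::euclidean_space \<Rightarrow> 'a set" where
  "children k p = {q \<in> range (grid (Suc k)). grid k q = p}"

lemma finite_children: "finite (children k p)"
proof (rule finite_subset)
  show "children k p \<subseteq> range (grid (Suc k)) \<inter> cball p (real DIM('a))"
    using dist_grid_le by (auto simp: children_def dist_commute)
  show "finite (range (grid (Suc k)) \<inter> cball p (real DIM('a)))"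
    by (intro finite_range_grid_bounded) simp
qed

text \<open>The points are labelled at level 0 and each label is passed on to a child cell bijectively; the
  nested cells shrink to the positions of the points.\<close>
lemma counting_measure_of_additive:
  fixes N :: "nat \<Rightarrow> 'a::euclidean_space \<Rightarrow> nat"
  assumes add: "\<And>k p. p \<in> range (grid k) \<Longrightarrow> N k p = (\<Sum>q\<in>children k p. N (Suc k) q)"
  shows "\<exists>\<nu>\<in>counting_measures. \<forall>f :: 'a \<Rightarrow> real. continuous_on UNIV f \<longrightarrow> bounded {x. f x \<noteq> 0} \<longrightarrow>
      (\<lambda>k. \<Sum>p\<in>range (grid k) \<inter> {x. f x \<noteq> 0}. f p * real (N k p)) \<longlonglongrightarrow> (\<integral>y. f y \<partial>\<nu>)"
proof -
  let ?C = "real DIM('a)"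
  \<comment> \<open>The particles of level k: the cell at p holds \<open>N k p\<close> numbered
    ones.\<close>
  define D where "D = (\<lambda>k. SIGMA p:range (grid k). {..<N k p})"
  \<comment> \<open>By additivity a cell and its children hold equally many particles; the
    bijections of the single cells are glued into one that moves each particle to a child of its
    cell.\<close>
  have "\<exists>s. bij_betw s (D k) (D (Suc k)) \<and> (\<forall>d\<in>D k. grid k (fst (s d)) = fst d)" for k
  proof -
    have "\<exists>h. bij_betw h {..<N k p} (SIGMA q:children k p. {..<N (Suc k) q})" if "p \<in> range (grid k)" for p
      using add[OF that] finite_children[of k p] by (intro finite_same_card_bij) auto
    then obtain h where h: "\<And>p. p \<in> range (grid k) \<Longrightarrow> bij_betw (h p) {..<N k p} (SIGMA q:children k p. {..<N (Suc k) q})"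
      by metis
    define s where "s = (\<lambda>(p, i). h p i)"
    have s: "fst (s (p, i)) \<in> children k p" "snd (s (p, i)) < N (Suc k) (fst (s (p, i)))" if "(p, i) \<in> D k" for p i
      using bij_betwE[OF h[of p]] that by (force simp: D_def s_def)+
    have fst_s: "grid k (fst (s d)) = fst d" if "d \<in> D k" for d
      using s(1)[of "fst d" "snd d"] that by (simp add: children_def)
    have "bij_betw s (D k) (D (Suc k))"
    proof (rule bij_betwI')
      fix d d' assume d: "d \<in> D k" "d' \<in> D k"
      show "s d = s d' \<longleftrightarrow> d = d'"
      proof
        assume eq: "s d = s d'"
        then have "fst d = fst d'"
          using fst_s[OF d(1)] fst_s[OF d(2)] by simp
        with eq d h[of "fst d"] show "d = d'"
          by (auto simp: s_def D_def bij_betw_def inj_on_def split: prod.splits)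
      qed simp
    next
      fix d assume d: "d \<in> D k"
      then show "s d \<in> D (Suc k)"
        using s[of "fst d" "snd d"] by (cases "s d") (auto simp: D_def children_def)
    next
      fix d assume d: "d \<in> D (Suc k)"
      obtain q j where qj: "d = (q, j)" by (cases d)
      let ?p = "grid k q"
      have "(q, j) \<in> (SIGMA q:children k ?p. {..<N (Suc k) q})"
        using d by (auto simp: D_def children_def qj)
      also have "(SIGMA q:children k ?p. {..<N (Suc k) q}) = h ?p ` {..<N k ?p}"
        using h[of ?p] by (simp add: bij_betw_imp_surj_on)
      finally obtain i where "i < N k ?p" "h ?p i = (q, j)"
        by (metis imageE lessThan_iff)
      then show "\<exists>x\<in>D k. d = s x"
        by (intro bexI[of _ "(?p, i)"]) (auto simp: D_def s_def qj)
    qed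
    with fst_s show ?thesis by blast
  qed
  then obtain s where s: "\<And>k. bij_betw (s k) (D k) (D (Suc k))"
    and fst_s: "\<And>k d. d \<in> D k \<Longrightarrow> grid k (fst (s k d)) = fst d"
    by metis
  define tr where "tr = rec_nat id (\<lambda>k t. s k \<circ> t)"
  have tr_0 [simp]: "tr 0 = id" and tr_Suc: "tr (Suc k) = s k \<circ> tr k" for k
    by (simp_all add: tr_def)
  have tr: "bij_betw (tr k) (D 0) (D k)" for k
  proof (induction k)
    case (Suc k)
    then show ?case
      unfolding tr_Suc by (rule bij_betw_trans[OF _ s])
  qed (simp add: bij_betw_def)
  have tr_D: "tr k d \<in> D k" if "d \<in> D 0" for k d
    using tr[of k] that by (rule bij_betw_apply)
  have fst_D: "grid k (fst d) = fst d" if "d \<in> D k" for k d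
    using that by (auto simp: D_def grid_grid)
  have nested: "grid k (fst (tr m d)) = fst (tr k d)" if "k \<le> m" "d \<in> D 0" for k m d
    using that(1)
  proof (induction m rule: dec_induct)
    case base
    show ?case
      using fst_D[OF tr_D[OF that(2)]] .
  next
    case (step m)
    have "grid k (fst (tr (Suc m) d)) = grid k (grid m (fst (s m (tr m d))))"
      using step.hyps by (simp add: tr_Suc grid_grid)
    then show ?case
      using step.IH fst_s[OF tr_D[OF that(2)]] by simp
  qed
  have close: "dist (fst (tr m d)) (fst (tr k d)) \<le> ?C / 2 ^ k" if "k \<le> m" "d \<in> D 0" for k m d
    using dist_grid[of "fst (tr m d)" k] nested[OF that] by simp
  have "convergent (\<lambda>k. fst (tr k d))" if d: "d \<in> D 0" for d
  proof (rule Cauchy_convergent, rule metric_CauchyI)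
    fix \<epsilon> :: real assume "0 < \<epsilon>"
    have "(\<lambda>k. ?C * (1 / 2) ^ k) \<longlonglongrightarrow> 0"
      by (intro tendsto_mult_right_zero LIMSEQ_power_zero) simp
    then have "eventually (\<lambda>k. ?C * (1 / 2) ^ k < \<epsilon> / 2) sequentially"
      by (rule order_tendstoD(2)) (use \<open>0 < \<epsilon>\<close> in simp)
    then obtain k where "?C * (1 / 2) ^ k < \<epsilon> / 2"
      using eventually_happens'[OF sequentially_bot] by blast
    then have k: "?C / 2 ^ k < \<epsilon> / 2"
      by (simp add: power_one_over)
    have "dist (fst (tr m d)) (fst (tr n d)) < \<epsilon>" if "k \<le> m" "k \<le> n" for m n
      using close[OF that(1) d] close[OF that(2) d] k
        dist_triangle2[of "fst (tr m d)" "fst (tr n d)" "fst (tr k d)"] by linarith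
    then show "\<exists>M. \<forall>m\<ge>M. \<forall>n\<ge>M. dist (fst (tr m d)) (fst (tr n d)) < \<epsilon>"
      by blast
  qed
  \<comment> \<open>The final position of each particle. It may be a boundary point outside the
    half-open cells, so cells may get masses under \<nu> that differ from the given counts.\<close>
  then obtain X where X: "\<And>d. d \<in> D 0 \<Longrightarrow> (\<lambda>k. fst (tr k d)) \<longlonglongrightarrow> X d"
    unfolding convergent_def by metis
  have X_close: "dist (X d) (fst d) \<le> ?C" if "d \<in> D 0" for d
  proof (rule LIMSEQ_le_const2)
    show "(\<lambda>k. dist (fst (tr k d)) (fst d)) \<longlonglongrightarrow> dist (X d) (fst d)"
      using X[OF that] by (intro tendsto_intros)
    show "\<exists>N. \<forall>n\<ge>N. dist (fst (tr n d)) (fst d) \<le> ?C"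
      using close[of 0 _ d] that by auto
  qed
  have fin: "finite {d \<in> D 0. norm (fst d) \<le> r}" for r
  proof (rule finite_subset)
    show "{d \<in> D 0. norm (fst d) \<le> r} \<subseteq> (SIGMA p:range (grid 0) \<inter> cball 0 r. {..<N 0 p})"
      by (auto simp: D_def)
    show "finite (SIGMA p:range (grid 0) \<inter> cball 0 r. {..<N 0 p})"
      by (intro finite_SigmaI finite_range_grid_bounded) auto
  qed
  define \<nu> where "\<nu> = distr (count_space (D 0)) borel X"
  have em: "emeasure \<nu> A = emeasure (count_space (D 0)) {d\<in>D 0. X d \<in> A}" if "A \<in> sets borel" for A
    using that unfolding \<nu>_def by (subst emeasure_distr) (auto intro!: arg_cong2[where f=emeasure])
  have "\<nu> \<in> counting_measures"
    unfolding counting_measures_def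
  proof (intro CollectI conjI ballI impI)
    show "sets \<nu> = sets borel"
      by (simp add: \<nu>_def)
    fix A :: "'a set" assume A: "A \<in> sets borel"
    show "emeasure \<nu> A \<in> range of_nat \<union> {\<infinity>}"
      unfolding em[OF A] by (subst emeasure_count_space) auto
    assume "bounded A"
    then obtain r where r: "\<And>x. x \<in> A \<Longrightarrow> norm x \<le> r"
      by (auto simp: bounded_iff)
    have "{d\<in>D 0. X d \<in> A} \<subseteq> {d \<in> D 0. norm (fst d) \<le> r + ?C}"
    proof safe
      fix p i assume d: "(p, i) \<in> D 0" "X (p, i) \<in> A"
      then show "norm (fst (p, i)) \<le> r + ?C"
        using r[OF d(2)] X_close[OF d(1)] dist_triangle[of p 0 "X (p, i)"] by (simp add: dist_commute)
    qed
    then have "finite {d\<in>D 0. X d \<in> A}"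
      using fin finite_subset by blast
    then show "emeasure \<nu> A < \<infinity>"
      unfolding em[OF A] by (subst emeasure_count_space) (auto simp: less_top[symmetric])
  qed
  moreover have "(\<lambda>k. \<Sum>p\<in>range (grid k) \<inter> {x. f x \<noteq> 0}. f p * real (N k p)) \<longlonglongrightarrow> (\<integral>y. f y \<partial>\<nu>)"
    if f: "continuous_on UNIV f" "bounded {x. f x \<noteq> 0}" for f :: "'a \<Rightarrow> real"
  proof -
    obtain R where R: "\<And>x. f x \<noteq> 0 \<Longrightarrow> norm x \<le> R"
      using f(2) by (auto simp: bounded_iff)
    \<comment> \<open>Particles never get farther than \<open>?C\<close> from their corner at level
      0. So this finite set contains every particle that meets the support of f at some level or in
      the limit, and the sums of all levels run over the same set.\<close>
    define F where "F = {d \<in> D 0. norm (fst d) \<le> R + ?C}"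
    have F: "finite F" "F \<subseteq> D 0"
      unfolding F_def by (rule fin) auto
    have in_F: "d \<in> F" if "d \<in> D 0" "f x \<noteq> 0" "dist x (fst d) \<le> ?C" for d x
      using that R[OF that(2)] dist_triangle[of "fst d" 0 x] by (simp add: F_def dist_commute)
    have "(\<Sum>p\<in>range (grid k) \<inter> {x. f x \<noteq> 0}. f p * real (N k p)) = (\<Sum>d\<in>F. f (fst (tr k d)))" for k
    proof -
      let ?S = "range (grid k) \<inter> {x. f x \<noteq> 0}"
      have S: "finite ?S"
        using f(2) by (rule finite_range_grid_bounded)
      have "(\<Sum>p\<in>?S. f p * real (N k p)) = (\<Sum>p\<in>?S. \<Sum>i<N k p. f p)"
        by (simp add: mult.commute)
      also have "\<dots> = (\<Sum>d\<in>(SIGMA p:?S. {..<N k p}). f (fst d))"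
        using S by (subst sum.Sigma) (auto simp: split_beta')
      also have "(SIGMA p:?S. {..<N k p}) = {d\<in>D k. f (fst d) \<noteq> 0}"
        by (auto simp: D_def)
      also have "{d\<in>D k. f (fst d) \<noteq> 0} = tr k ` {d\<in>D 0. f (fst (tr k d)) \<noteq> 0}"
      proof -
        have eq: "D k = tr k ` D 0"
          using tr[of k] by (simp add: bij_betw_def)
        show ?thesis
          unfolding eq by (rule Compr_image_eq)
      qed
      also have "(\<Sum>d\<in>tr k ` {d\<in>D 0. f (fst (tr k d)) \<noteq> 0}. f (fst d)) = (\<Sum>d\<in>{d\<in>D 0. f (fst (tr k d)) \<noteq> 0}. f (fst (tr k d)))"
        using tr[of k] by (subst sum.reindex) (auto simp: bij_betw_def inj_on_def)
      also have "\<dots> = (\<Sum>d\<in>F. f (fst (tr k d)))"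
        using F in_F close[of 0 k] by (intro sum.mono_neutral_left) auto
      finally show ?thesis .
    qed
    moreover have "(\<lambda>k. \<Sum>d\<in>F. f (fst (tr k d))) \<longlonglongrightarrow> (\<Sum>d\<in>F. f (X d))"
    proof (intro tendsto_sum)
      fix d assume "d \<in> F"
      then have "(\<lambda>k. fst (tr k d)) \<longlonglongrightarrow> X d"
        using F(2) by (intro X) blast
      moreover have "isCont f (X d)"
        using f(1) by (simp add: continuous_on_eq_continuous_at)
      ultimately show "(\<lambda>k. f (fst (tr k d))) \<longlonglongrightarrow> f (X d)"
        by (rule isCont_tendsto_compose[rotated])
    qed
    moreover have "(\<integral>y. f y \<partial>\<nu>) = (\<Sum>d\<in>F. f (X d))"
    proof -
      have sub: "{d \<in> D 0. f (X d) \<noteq> 0} \<subseteq> F"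
        using in_F X_close by auto
      have [measurable]: "f \<in> borel_measurable borel"
        using f(1) by (rule borel_measurable_continuous_onI)
      have "(\<integral>y. f y \<partial>\<nu>) = (\<integral>d. f (X d) \<partial>count_space (D 0))"
        unfolding \<nu>_def by (rule integral_distr) auto
      also have "\<dots> = (\<Sum>d | d \<in> D 0 \<and> f (X d) \<noteq> 0. f (X d))"
        using finite_subset[OF sub F(1)] by (rule lebesgue_integral_count_space_finite_support)
      also have "\<dots> = (\<Sum>d\<in>F. f (X d))"
        using F sub by (intro sum.mono_neutral_left) auto
      finally show ?thesis .
    qed
    ultimately show ?thesis by simp
  qed
  ultimately show ?thesis
    by blast
qed

section \<open>Measurability of random counting measures\<close>

lemma integrable_counting_measure:
  fixes f :: "'a::euclidean_space \<Rightarrow> real"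
  assumes \<nu>: "\<nu> \<in> counting_measures" and f: "continuous_on UNIV f" "bounded {x. f x \<noteq> 0}"
  shows "integrable \<nu> f"
proof -
  have s: "sets \<nu> = sets borel"
    using \<nu> by (rule sets_counting_measures)
  obtain R where "\<And>x. f x \<noteq> 0 \<Longrightarrow> norm x \<le> R"
    using f(2) by (auto simp: bounded_iff)
  then have R: "{x. f x \<noteq> 0} \<subseteq> cball 0 R"
    by auto
  have "bounded (f ` cball 0 R)"
    using continuous_on_subset[OF f(1)] by (intro compact_imp_bounded compact_continuous_image) auto
  then obtain C where "\<forall>y\<in>f ` cball 0 R. norm y \<le> C"
    unfolding bounded_iff by blast
  then have C: "\<bar>f x\<bar> \<le> C" if "x \<in> cball 0 R" for x
    using that by auto
  show ?thesis
  proof (rule integrableI_bounded)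
    show "f \<in> borel_measurable \<nu>"
      using borel_measurable_continuous_onI[OF f(1)] by (simp add: s cong: measurable_cong_sets)
    have "(\<integral>\<^sup>+x. ennreal (norm (f x)) \<partial>\<nu>) \<le> (\<integral>\<^sup>+x. ennreal C * indicator (cball 0 R) x \<partial>\<nu>)"
      using R C by (intro nn_integral_mono) (auto simp: indicator_def intro!: ennreal_leI)
    also have "\<dots> = ennreal C * emeasure \<nu> (cball 0 R)"
      by (rule nn_integral_cmult_indicator) (simp add: s)
    also have "\<dots> < \<infinity>"
      using emeasure_counting_measures_finite[OF \<nu>, of "cball 0 R"] by (simp add: ennreal_mult_less_top)
    finally show "(\<integral>\<^sup>+x. ennreal (norm (f x)) \<partial>\<nu>) < \<infinity>" .
  qed
qed

text \<open>Masses of bounded open sets are suprema of integrals of continuous functions with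
  bounded support; a Dynkin argument extends this to Borel sets.\<close>

lemma measurable_config_spaceI_continuous:
  fixes \<eta> :: "'w \<Rightarrow> 'a::euclidean_space measure"
  assumes \<eta>: "\<And>\<omega>. \<omega> \<in> space M \<Longrightarrow> \<eta> \<omega> \<in> counting_measures"
    and f: "\<And>f :: 'a \<Rightarrow> real. continuous_on UNIV f \<Longrightarrow> (\<And>x. 0 \<le> f x) \<Longrightarrow> bounded {x. f x \<noteq> 0} \<Longrightarrow>
      (\<lambda>\<omega>. \<integral>y. f y \<partial>\<eta> \<omega>) \<in> borel_measurable M"
  shows "\<eta> \<in> M \<rightarrow>\<^sub>M config_space"
proof -
  have opn: "(\<lambda>\<omega>. emeasure (\<eta> \<omega>) V) \<in> borel_measurable M" if V: "open V" "bounded V" for V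
  proof -
    \<comment> \<open>Capped multiples of the distance to the complement increase to the indicator
      of V. Since V is bounded, its complement is nonempty and the distance is positive on
      V.\<close>
    define g where "g = (\<lambda>m x. min 1 (real m * infdist x (- V)))"
    have cg: "continuous_on UNIV (g m)" for m
      unfolding g_def by (intro continuous_intros)
    have g0: "0 \<le> g m x" for m x
      by (simp add: g_def infdist_nonneg)
    have "g m x = 0" if "x \<notin> V" for m x
      using that by (simp add: g_def infdist_zero[of x "- V"])
    then have sg: "{x. g m x \<noteq> 0} \<subseteq> V" for m
      by blast
    have bg: "bounded {x. g m x \<noteq> 0}" for m
      using sg V(2) by (rule bounded_subset[rotated])
    have "- V \<noteq> {}"
      using V(2) not_bounded_UNIV by (metis double_complement compl_bot_eq)
    then have pos: "0 < infdist x (- V)" if "x \<in> V" for x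
      using that V(1) by (simp add: infdist_pos_not_in_closed closed_Compl)
    have lim: "(SUP m. ennreal (g m x)) = indicator V x" for x
    proof (cases "x \<in> V")
      case True
      obtain m :: nat where "1 / infdist x (- V) < real m"
        using reals_Archimedean2 by blast
      then have "g m x = 1"
        using pos[OF True] by (simp add: g_def divide_simps)
      then have "1 \<le> (SUP m. ennreal (g m x))"
        by (intro SUP_upper2[of m]) auto
      moreover have "(SUP m. ennreal (g m x)) \<le> 1"
        by (intro SUP_least) (simp add: g_def ennreal_le_1)
      ultimately show ?thesis
        using True by simp
    next
      case False
      then have "g m x = 0" for m
        using sg by auto
      with False show ?thesis by simp
    qed
    have "emeasure (\<eta> \<omega>) V = (SUP m. ennreal (\<integral>y. g m y \<partial>\<eta> \<omega>))" if \<omega>: "\<omega> \<in> space M" for \<omega>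
    proof -
      note s = sets_counting_measures[OF \<eta>[OF \<omega>]]
      have [measurable]: "g m \<in> borel_measurable (\<eta> \<omega>)" for m
        using borel_measurable_continuous_onI[OF cg] by (simp add: s cong: measurable_cong_sets)
      have "emeasure (\<eta> \<omega>) V = (\<integral>\<^sup>+y. (SUP m. ennreal (g m y)) \<partial>\<eta> \<omega>)"
        using V(1) by (simp add: lim s)
      also have "\<dots> = (SUP m. \<integral>\<^sup>+y. ennreal (g m y) \<partial>\<eta> \<omega>)"
      proof (rule nn_integral_monotone_convergence_SUP)
        show "incseq (\<lambda>m x. ennreal (g m x))"
          by (auto simp: incseq_def le_fun_def g_def intro!: ennreal_leI min.mono mult_right_mono infdist_nonneg)
      qed measurable
      also have "\<dots> = (SUP m. ennreal (\<integral>y. g m y \<partial>\<eta> \<omega>))"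
        using g0 by (simp add: nn_integral_eq_integral[OF integrable_counting_measure[OF \<eta>[OF \<omega>] cg bg]])
      finally show ?thesis .
    qed
    moreover have "(\<lambda>\<omega>. SUP m. ennreal (\<integral>y. g m y \<partial>\<eta> \<omega>)) \<in> borel_measurable M"
      using f[OF cg g0 bg] by measurable
    ultimately show ?thesis
      by (simp cong: measurable_cong)
  qed
  \<comment> \<open>The induction runs inside a ball, where masses are finite and complements can be
    treated by subtraction.\<close>
  have "(\<lambda>\<omega>. emeasure (\<eta> \<omega>) (A \<inter> ball 0 r)) \<in> borel_measurable M" if "A \<in> sets borel" for A r
  proof -
    have ball: "(\<lambda>\<omega>. emeasure (\<eta> \<omega>) (ball 0 r)) \<in> borel_measurable M"
      by (intro opn) auto
    have "Int_stable {S :: 'a set. open S}" "{S :: 'a set. open S} \<subseteq> Pow UNIV" "A \<in> sigma_sets UNIV {S. open S}"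
      using that by (auto simp: sets_borel Int_stable_def)
    then show ?thesis
    proof (induction rule: sigma_sets_induct_disjoint)
      case (basic A)
      then show ?case
        by (intro opn) (auto intro: bounded_Int)
    next
      case (compl A)
      have "emeasure (\<eta> \<omega>) ((UNIV - A) \<inter> ball 0 r) = emeasure (\<eta> \<omega>) (ball 0 r) - emeasure (\<eta> \<omega>) (A \<inter> ball 0 r)"
        if \<omega>: "\<omega> \<in> space M" for \<omega>
      proof -
        note s = sets_counting_measures[OF \<eta>[OF \<omega>]]
        have A: "A \<in> sets borel"
          using compl.hyps by (simp add: sets_borel)
        then have "emeasure (\<eta> \<omega>) (ball 0 r - A \<inter> ball 0 r) = emeasure (\<eta> \<omega>) (ball 0 r) - emeasure (\<eta> \<omega>) (A \<inter> ball 0 r)"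
          using emeasure_counting_measures_finite[OF \<eta>[OF \<omega>], of "A \<inter> ball 0 r"]
          by (intro emeasure_Diff) (auto simp: s bounded_Int less_top)
        moreover have "ball 0 r - A \<inter> ball 0 r = (UNIV - A) \<inter> ball 0 r"
          by auto
        ultimately show ?thesis by simp
      qed
      moreover have "(\<lambda>\<omega>. emeasure (\<eta> \<omega>) (ball 0 r) - emeasure (\<eta> \<omega>) (A \<inter> ball 0 r)) \<in> borel_measurable M"
        using ball compl.IH by measurable
      ultimately show ?case
        by (simp cong: measurable_cong)
    next
      case (union A)
      have "emeasure (\<eta> \<omega>) ((\<Union>i. A i) \<inter> ball 0 r) = (\<Sum>i. emeasure (\<eta> \<omega>) (A i \<inter> ball 0 r))"
        if \<omega>: "\<omega> \<in> space M" for \<omega>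
      proof -
        note s = sets_counting_measures[OF \<eta>[OF \<omega>]]
        have "A i \<in> sets borel" for i
          using union.hyps by (auto simp: sets_borel)
        then have "(\<Sum>i. emeasure (\<eta> \<omega>) (A i \<inter> ball 0 r)) = emeasure (\<eta> \<omega>) (\<Union>i. A i \<inter> ball 0 r)"
          using union.hyps(1) by (intro suminf_emeasure) (auto simp: s disjoint_family_on_def)
        then show ?thesis by simp
      qed
      moreover have "(\<lambda>\<omega>. \<Sum>i. emeasure (\<eta> \<omega>) (A i \<inter> ball 0 r)) \<in> borel_measurable M"
        using union.IH by measurable
      ultimately show ?case
        by (simp cong: measurable_cong)
    qed simp
  qed
  note * = this
  show ?thesis
  proof (rule measurable_config_spaceI)
    fix A :: "'a set" assume A: "A \<in> sets borel" "bounded A"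
    obtain r where "A \<subseteq> ball 0 r"
      using bounded_subset_ballD[OF A(2), of 0] by auto
    then have "A \<inter> ball 0 r = A" by auto
    with *[OF A(1), of r] show "(\<lambda>\<omega>. emeasure (\<eta> \<omega>) A) \<in> borel_measurable M"
      by simp
  qed (rule \<eta>)
qed

section \<open>The limit point process\<close>


text \<open>Truncation at \<open>exp (- b)\<close> keeps the logarithm continuous down to 0 and
  changes nothing, because \<open>cts_step a b\<close> vanishes from b on.\<close>

lemma cts_step_exp:
  assumes "a < b"
  obtains \<phi> :: "real \<Rightarrow> real" where "continuous_on UNIV \<phi>" "\<And>x. \<phi> (exp (- x)) = cts_step a b x"
proof -
  define \<phi> where "\<phi> = (\<lambda>y. cts_step a b (- ln (max y (exp (- b)))))"
  have "continuous_on UNIV (cts_step a b)"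
    using assms by (intro uniformly_continuous_imp_continuous cts_step_uniformly_continuous)
  moreover have "continuous_on UNIV (\<lambda>y. - ln (max y (exp (- b))))"
    by (intro continuous_intros) (auto simp: max_def not_le intro: less_le_trans[OF exp_gt_zero])
  ultimately have "continuous_on UNIV \<phi>"
    unfolding \<phi>_def by (rule continuous_on_compose2) auto
  moreover have "\<phi> (exp (- x)) = cts_step a b x" for x
  proof (cases "x \<le> b")
    case True
    then show ?thesis by (simp add: \<phi>_def max_def)
  next
    case False
    then show ?thesis using assms by (simp add: \<phi>_def max_def cts_step_def)
  qed
  ultimately show thesis
    using that by blast
qed

text \<open>Integer arguments suffice: exp (- X) lies in [0, 1] and its m-th moment is the Laplace
  transform at m, so continuous step functions of X are reached by polynomials.\<close>

lemma weak_conv_of_laplace: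
  fixes X :: "nat \<Rightarrow> 'w \<Rightarrow> real" and Y :: "'v \<Rightarrow> real"
  assumes M: "prob_space M" and Q: "prob_space Q"
    and X [measurable]: "\<And>n. X n \<in> borel_measurable M" and Y [measurable]: "Y \<in> borel_measurable Q"
    and nn: "\<And>n \<omega>. 0 \<le> X n \<omega>" "\<And>x. 0 \<le> Y x"
    and conv: "\<And>m::nat. (\<lambda>n. \<integral>\<omega>. exp (- (real m * X n \<omega>)) \<partial>M) \<longlonglongrightarrow> (\<integral>x. exp (- (real m * Y x)) \<partial>Q)"
  shows "weak_conv_m (\<lambda>n. distr M borel (X n)) (distr Q borel Y)"
proof (rule integral_cts_step_conv_imp_weak_conv)
  interpret M: prob_space M by fact
  interpret Q: prob_space Q by fact
  show "real_distribution (distr M borel (X n))" for n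
    by (rule M.real_distribution_distr) fact
  show "real_distribution (distr Q borel Y)"
    by (rule Q.real_distribution_distr) fact
  fix a b :: real assume "a < b"
  then obtain \<phi> where \<phi>: "continuous_on UNIV \<phi>" "\<And>x. \<phi> (exp (- x)) = cts_step a b x"
    by (rule cts_step_exp) blast
  have pow: "exp (- x) ^ m = exp (- (real m * x))" for m :: nat and x :: real
    by (simp add: exp_of_nat_mult[symmetric])
  have meas: "cts_step a b \<in> borel_measurable borel"
    using \<open>a < b\<close>
    by (intro borel_measurable_continuous_onI uniformly_continuous_imp_continuous cts_step_uniformly_continuous)
  have "(\<lambda>n. \<integral>\<omega>. \<phi> (exp (- X n \<omega>)) * 1 \<partial>M) \<longlonglongrightarrow> (\<integral>x. \<phi> (exp (- Y x)) * 1 \<partial>Q)"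
  proof (rule tendsto_of_moments[OF \<phi>(1)])
    show "\<bar>(\<integral>\<omega>. \<phi> (exp (- X n \<omega>)) * 1 \<partial>M) - (\<Sum>i\<le>N. a i * (\<integral>\<omega>. exp (- X n \<omega>) ^ i * 1 \<partial>M))\<bar> \<le> \<epsilon>"
      if "\<And>y. y \<in> {0..1} \<Longrightarrow> \<bar>\<phi> y - (\<Sum>i\<le>N. a i * y ^ i)\<bar> \<le> \<epsilon>" for a and N :: nat and \<epsilon> n
      using that nn by (intro M.moments_bound[OF \<phi>(1)]) auto
    show "\<bar>(\<integral>x. \<phi> (exp (- Y x)) * 1 \<partial>Q) - (\<Sum>i\<le>N. a i * (\<integral>x. exp (- Y x) ^ i * 1 \<partial>Q))\<bar> \<le> \<epsilon>"
      if "\<And>y. y \<in> {0..1} \<Longrightarrow> \<bar>\<phi> y - (\<Sum>i\<le>N. a i * y ^ i)\<bar> \<le> \<epsilon>" for a and N :: nat and \<epsilon>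
      using that nn by (intro Q.moments_bound[OF \<phi>(1)]) auto
    show "(\<lambda>n. \<integral>\<omega>. exp (- X n \<omega>) ^ m * 1 \<partial>M) \<longlonglongrightarrow> (\<integral>x. exp (- Y x) ^ m * 1 \<partial>Q)" for m
      using conv[of m] by (simp add: pow)
  qed
  then show "(\<lambda>n. integral\<^sup>L (distr M borel (X n)) (cts_step a b)) \<longlonglongrightarrow> integral\<^sup>L (distr Q borel Y) (cts_step a b)"
    using meas by (simp add: \<phi>(2) integral_distr)
qed

text \<open>\<^term>\<open>y = nat_part y\<close> expresses, in a measurable form, that \<^term>\<open>y\<close> is a natural number.\<close>
definition nat_part :: "real \<Rightarrow> real" where
  "nat_part y = real (nat \<lfloor>y\<rfloor>)"

lemma measurable_nat_part [measurable]: "nat_part \<in> borel_measurable borel"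
proof -
  have "(\<lambda>y::real. nat \<lfloor>y\<rfloor>) \<in> borel \<rightarrow>\<^sub>M count_space UNIV"
    by measurable
  then show ?thesis
    unfolding nat_part_def[abs_def] by (rule measurable_compose) simp
qed

lemma nat_part_of_nat [simp]: "nat_part (real n) = real n"
  by (simp add: nat_part_def)

text \<open>Level and corner form one index, so that a single random family carries the counts of
  all levels. A label that is not a corner of its level has an empty cell.\<close>

definition cell :: "nat \<times> 'a::euclidean_space \<Rightarrow> 'a set" where
  "cell i = grid (fst i) -` {snd i}"

lemma sets_cell [measurable, simp]: "cell i \<in> sets borel"
  using measurable_sets[OF measurable_grid, of "{snd i}" "fst i"] by (simp add: cell_def)

lemma bounded_cell [simp]: "bounded (cell i)"
proof (rule bounded_subset)
  show "cell i \<subseteq> cball (snd i) (real DIM('a))" for i :: "nat \<times> 'a"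
  proof
    fix x assume "x \<in> cell i"
    then show "x \<in> cball (snd i) (real DIM('a))"
      using dist_grid_le[of x "fst i"] by (simp add: cell_def dist_commute)
  qed
qed simp

lemma cell_eq_children: "cell (k, p) = (\<Union>q\<in>children k p. cell (Suc k, q))"
proof -
  have "grid k x = grid k (grid (Suc k) x)" for x :: 'a
    by (simp add: grid_grid)
  then show ?thesis
    unfolding cell_def children_def by auto
qed

lemma disjoint_cells: "disjoint_family_on (\<lambda>q. cell (k, q)) A"
  by (auto simp: disjoint_family_on_def cell_def)

lemma pred_consistent_at:
  fixes p :: "'a::euclidean_space"
  assumes "(\<lambda>x. x (k, p)) \<in> borel_measurable N"
    and "\<And>q. q \<in> children k p \<Longrightarrow> (\<lambda>x. x (Suc k, q)) \<in> borel_measurable N"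
  shows "Measurable.pred N (\<lambda>x. x (k, p) = nat_part (x (k, p)) \<and> x (k, p) = (\<Sum>q\<in>children k p. x (Suc k, q)))"
proof -
  have "{x\<in>space N. x (k, p) = nat_part (x (k, p))} \<in> sets N"
    using assms(1) by measurable
  moreover have "{x\<in>space N. x (k, p) = (\<Sum>q\<in>children k p. x (Suc k, q))} \<in> sets N"
    using assms by (intro borel_measurable_eq borel_measurable_sum)
  ultimately show ?thesis
    unfolding pred_def by (rule sets.sets_Collect_conj[rotated])
qed

text \<open>The error \<open>r k\<close> does not depend on n, so k can be fixed before n is
  chosen.\<close>

lemma tendsto_double_limit:
  fixes a :: "nat \<Rightarrow> real"
  assumes a': "\<And>k. (\<lambda>n. a' n k) \<longlonglongrightarrow> b' k" and b': "b' \<longlonglongrightarrow> b"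
    and r: "r \<longlonglongrightarrow> 0" and close: "\<And>n k. \<bar>a n - a' n k\<bar> \<le> r k"
  shows "a \<longlonglongrightarrow> b"
proof (rule metric_LIMSEQ_I)
  fix \<epsilon> :: real assume "0 < \<epsilon>"
  then have e3: "0 < \<epsilon> / 3" by simp
  obtain k1 where k1: "\<And>k. k1 \<le> k \<Longrightarrow> dist (b' k) b < \<epsilon> / 3"
    using metric_LIMSEQ_D[OF b' e3] by blast
  obtain k2 where k2: "\<And>k. k2 \<le> k \<Longrightarrow> dist (r k) 0 < \<epsilon> / 3"
    using metric_LIMSEQ_D[OF r e3] by blast
  define k where "k = max k1 k2"
  obtain N where N: "\<And>n. N \<le> n \<Longrightarrow> dist (a' n k) (b' k) < \<epsilon> / 3"
    using metric_LIMSEQ_D[OF a'[of k] e3] by blast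
  have "dist (a n) b < \<epsilon>" if "N \<le> n" for n
  proof -
    have "dist (b' k) b < \<epsilon> / 3" "dist (r k) 0 < \<epsilon> / 3"
      using k1[of k] k2[of k] by (simp_all add: k_def)
    then show ?thesis
      using N[OF that] close[of n k] unfolding dist_real_def by linarith
  qed
  then show "\<exists>N. \<forall>n\<ge>N. dist (a n) b < \<epsilon>"
    by blast
qed

text \<open>Apart from measurability, all that is kept of the cascade: convergence of Laplace
  functionals for integrable f and the lower bound that is uniform in n.\<close>

locale laplace_limit = prob_space M for M :: "'w measure" +
  fixes \<xi> :: "nat \<Rightarrow> 'w \<Rightarrow> 'a::euclidean_space measure" and c :: real and e :: "nat \<Rightarrow> 'a measure \<Rightarrow> 'a"
  assumes enum: "point_enumeration e" and xi [measurable]: "\<And>n. \<xi> n \<in> M \<rightarrow>\<^sub>M config_space" and c: "0 \<le> c"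
    and laplace_conv: "\<And>f. f \<in> borel_measurable borel \<Longrightarrow> (\<integral>\<^sup>+x. f x \<partial>lborel) < \<infinity> \<Longrightarrow>
      convergent (\<lambda>n. \<integral>\<omega>. nexp (\<integral>\<^sup>+y. f y \<partial>\<xi> n \<omega>) \<partial>M)"
    and laplace_lower: "\<And>f n. f \<in> borel_measurable borel \<Longrightarrow>
      nexp (ennreal c * (\<integral>\<^sup>+x. f x \<partial>lborel)) \<le> (\<integral>\<omega>. nexp (\<integral>\<^sup>+y. f y \<partial>\<xi> n \<omega>) \<partial>M)"
begin

definition count :: "nat \<Rightarrow> nat \<times> 'a \<Rightarrow> 'w \<Rightarrow> nat" where
  "count n i \<omega> = nat \<lfloor>measure (\<xi> n \<omega>) (cell i)\<rfloor>"

lemma xi_counting: "\<omega> \<in> space M \<Longrightarrow> \<xi> n \<omega> \<in> counting_measures"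
  by (rule measurable_config_space_space[OF xi])

lemma emeasure_cell: "\<omega> \<in> space M \<Longrightarrow> emeasure (\<xi> n \<omega>) (cell i) = of_nat (count n i \<omega>)"
  using emeasure_counting_measures_finite[OF xi_counting, of \<omega> "cell i" n]
  by (auto elim!: emeasure_counting_measures_nat[OF xi_counting, of \<omega> "cell i" n]
      simp: count_def measure_def ennreal_of_nat_eq_real_of_nat)

lemma measurable_count [measurable]: "count n i \<in> M \<rightarrow>\<^sub>M count_space UNIV"
proof -
  have "(\<lambda>\<omega>. measure (\<xi> n \<omega>) (cell i)) \<in> borel_measurable M"
    unfolding measure_def by measurable
  then show ?thesis
    unfolding count_def[abs_def] by measurable
qed

lemma nn_integral_cells:
  assumes "finite K" "\<And>i. 0 \<le> t i" "\<omega> \<in> space M"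
  shows "(\<integral>\<^sup>+y. (\<Sum>i\<in>K. ennreal (t i) * indicator (cell i) y) \<partial>\<xi> n \<omega>) = ennreal (\<Sum>i\<in>K. t i * real (count n i \<omega>))"
proof -
  note s = sets_counting_measures[OF xi_counting[OF assms(3)]]
  have "(\<integral>\<^sup>+y. (\<Sum>i\<in>K. ennreal (t i) * indicator (cell i) y) \<partial>\<xi> n \<omega>) =
      (\<Sum>i\<in>K. \<integral>\<^sup>+y. ennreal (t i) * indicator (cell i) y \<partial>\<xi> n \<omega>)"
    by (rule nn_integral_sum) (simp add: s cong: measurable_cong_sets)
  also have "\<dots> = (\<Sum>i\<in>K. ennreal (t i * real (count n i \<omega>)))"
    using assms by (intro sum.cong refl, subst nn_integral_cmult_indicator)
      (auto simp: s emeasure_cell ennreal_mult ennreal_of_nat_eq_real_of_nat)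
  also have "\<dots> = ennreal (\<Sum>i\<in>K. t i * real (count n i \<omega>))"
    using assms by (intro sum_ennreal) auto
  finally show ?thesis .
qed

lemma laplace_cells:
  assumes "finite K" "\<And>i. 0 \<le> t i"
  shows "(\<integral>\<omega>. nexp (\<integral>\<^sup>+y. (\<Sum>i\<in>K. ennreal (t i) * indicator (cell i) y) \<partial>\<xi> n \<omega>) \<partial>M) =
    (\<integral>\<omega>. exp (- (\<Sum>i\<in>K. t i * real (count n i \<omega>))) \<partial>M)"
proof (intro Bochner_Integration.integral_cong refl)
  fix \<omega> assume "\<omega> \<in> space M"
  then show "nexp (\<integral>\<^sup>+y. (\<Sum>i\<in>K. ennreal (t i) * indicator (cell i) y) \<partial>\<xi> n \<omega>) = exp (- (\<Sum>i\<in>K. t i * real (count n i \<omega>)))"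
    unfolding nn_integral_cells[OF assms \<open>\<omega> \<in> space M\<close>] using assms
    by (intro nexp_ennreal sum_nonneg mult_nonneg_nonneg) auto
qed

text \<open>Weighted sums of cell counts are integrals of step functions, so the conditions on
  Laplace transforms are instances of those on Laplace functionals.\<close>

sublocale count_limit M count "\<lambda>i. c * measure lborel (cell i)"
proof
  show "count n i \<in> M \<rightarrow>\<^sub>M count_space UNIV" for n i
    by measurable
  have lb: "(\<integral>\<^sup>+y. ennreal t * indicator (cell i) y \<partial>lborel) = ennreal (t * measure lborel (cell i))" if "0 \<le> t" for t i
    using that emeasure_bounded_finite[OF bounded_cell, of i]
    by (subst nn_integral_cmult_indicator) (auto simp: ennreal_mult emeasure_eq_ennreal_measure)
  show "convergent (\<lambda>n. \<integral>\<omega>. exp (- (\<Sum>i\<in>K. t i * real (count n i \<omega>))) \<partial>M)"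
    if "finite K" "\<And>i. 0 \<le> t i" for K t
  proof -
    have "(\<integral>\<^sup>+y. (\<Sum>i\<in>K. ennreal (t i) * indicator (cell i) y) \<partial>lborel) < \<infinity>"
      using that by (subst nn_integral_sum) (auto simp: lb)
    then show ?thesis
      unfolding laplace_cells[OF that, symmetric] by (intro laplace_conv) measurable
  qed
  show "0 \<le> c * measure lborel (cell i)" for i
    using c by simp
  show "exp (- (t * (c * measure lborel (cell i)))) \<le> (\<integral>\<omega>. exp (- (t * real (count n i \<omega>))) \<partial>M)" if "0 \<le> t" for t n i
  proof -
    have "exp (- (t * (c * measure lborel (cell i)))) = nexp (ennreal c * (\<integral>\<^sup>+y. ennreal t * indicator (cell i) y \<partial>lborel))"
      using that c by (simp add: lb ennreal_mult[symmetric] nexp_ennreal mult_ac)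
    also have "\<dots> \<le> (\<integral>\<omega>. nexp (\<integral>\<^sup>+y. ennreal t * indicator (cell i) y \<partial>\<xi> n \<omega>) \<partial>M)"
      by (rule laplace_lower) measurable
    also have "\<dots> = (\<integral>\<omega>. exp (- (t * real (count n i \<omega>))) \<partial>M)"
    proof -
      have "(\<Sum>j\<in>{i}. ennreal t * indicator (cell j) y) = ennreal t * indicator (cell i) y" for y
        by (rule trans[OF sum.insert]) auto
      moreover have "(\<Sum>j\<in>{i}. t * real (count n j \<omega>)) = t * real (count n i \<omega>)" for \<omega>
        by simp
      ultimately show ?thesis
        using laplace_cells[where K="{i}" and t="\<lambda>_. t" and n=n, OF _ that] by (simp only: finite.intros)
    qed
    finally show ?thesis .
  qed
qed

lemma count_additive:
  assumes "\<omega> \<in> space M"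
  shows "count n (k, p) \<omega> = (\<Sum>q\<in>children k p. count n (Suc k, q) \<omega>)"
proof -
  note s = sets_counting_measures[OF xi_counting[OF assms]]
  have "emeasure (\<xi> n \<omega>) (cell (k, p)) = (\<Sum>q\<in>children k p. emeasure (\<xi> n \<omega>) (cell (Suc k, q)))"
    unfolding cell_eq_children[of k p]
    by (rule sum_emeasure[symmetric]) (auto simp: s finite_children disjoint_cells)
  then have "(of_nat (count n (k, p) \<omega>) :: ennreal) = of_nat (\<Sum>q\<in>children k p. count n (Suc k, q) \<omega>)"
    by (simp add: emeasure_cell[OF assms])
  then show ?thesis
    by (simp only: of_nat_eq_iff)
qed

text \<open>Sampling f at the corner of each cell turns the integral into a finite combination of
  counts, the same sums as in \<open>counting_measure_of_additive\<close>.\<close>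

lemma nn_integral_grid:
  fixes f :: "'a \<Rightarrow> real"
  assumes f: "\<And>x. 0 \<le> f x" "bounded {x. f x \<noteq> 0}" and "\<omega> \<in> space M"
  shows "(\<integral>\<^sup>+y. ennreal (f (grid k y)) \<partial>\<xi> n \<omega>) =
    ennreal (\<Sum>p\<in>range (grid k) \<inter> {x. f x \<noteq> 0}. f p * real (count n (k, p) \<omega>))"
proof -
  let ?S = "range (grid k) \<inter> {x. f x \<noteq> 0}"
  have S: "finite ?S"
    using f(2) by (rule finite_range_grid_bounded)
  have "ennreal (f (grid k y)) = (\<Sum>i\<in>{k} \<times> ?S. ennreal (f (snd i)) * indicator (cell i) y)" for y
  proof -
    have "(\<Sum>i\<in>{k} \<times> ?S. ennreal (f (snd i)) * indicator (cell i) y) = (\<Sum>p\<in>?S. ennreal (f p) * indicator (cell (k, p)) y)"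
      by (subst sum.cartesian_product[symmetric, of "\<lambda>k p. ennreal (f p) * indicator (cell (k, p)) y", simplified split_beta' prod.collapse]) simp
    also have "\<dots> = (\<Sum>p\<in>?S. if p = grid k y then ennreal (f p) else 0)"
      by (intro sum.cong) (auto simp: cell_def indicator_def)
    also have "\<dots> = ennreal (f (grid k y))"
      using S by (auto simp: sum.delta)
    finally show ?thesis ..
  qed
  then have "(\<integral>\<^sup>+y. ennreal (f (grid k y)) \<partial>\<xi> n \<omega>) = ennreal (\<Sum>i\<in>{k} \<times> ?S. f (snd i) * real (count n i \<omega>))"
    using nn_integral_cells[of "{k} \<times> ?S" "\<lambda>i. f (snd i)" \<omega> n] S f(1) assms(3) by simp
  also have "(\<Sum>i\<in>{k} \<times> ?S. f (snd i) * real (count n i \<omega>)) = (\<Sum>p\<in>?S. f p * real (count n (k, p) \<omega>))"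
    by (subst sum.cartesian_product[symmetric, of "\<lambda>k p. f p * real (count n (k, p) \<omega>)", simplified split_beta' prod.collapse]) simp
  finally show ?thesis .
qed

lemma measurable_nn_integral_xi [measurable]:
  assumes [measurable]: "f \<in> borel_measurable borel"
  shows "(\<lambda>\<omega>. \<integral>\<^sup>+y. f y \<partial>\<xi> n \<omega>) \<in> borel_measurable M"
  by (rule measurable_nn_integral_config[OF enum _ xi]) measurable

text \<open>For each outcome the exponents differ by at most the integral of the absolute difference
  of the two functions, so \<open>abs_nexp_diff_le\<close> applies; \<open>laplace_lower\<close> for
  that difference makes the error independent of n.\<close>

lemma laplace_grid_close:
  fixes f :: "'a \<Rightarrow> real"
  assumes f: "continuous_on UNIV f" "\<And>x. 0 \<le> f x"
  shows "\<bar>(\<integral>\<omega>. nexp (\<integral>\<^sup>+y. ennreal (f y) \<partial>\<xi> n \<omega>) \<partial>M) - (\<integral>\<omega>. nexp (\<integral>\<^sup>+y. ennreal (f (grid k y)) \<partial>\<xi> n \<omega>) \<partial>M)\<bar> \<le>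
    1 - nexp (ennreal c * (\<integral>\<^sup>+x. ennreal \<bar>f (grid k x) - f x\<bar> \<partial>lborel))"
proof -
  have [measurable]: "f \<in> borel_measurable borel"
    using f(1) by (rule borel_measurable_continuous_onI)
  let ?F = "\<lambda>\<omega>. nexp (\<integral>\<^sup>+y. ennreal (f y) \<partial>\<xi> n \<omega>)"
  let ?G = "\<lambda>\<omega>. nexp (\<integral>\<^sup>+y. ennreal (f (grid k y)) \<partial>\<xi> n \<omega>)"
  let ?H = "\<lambda>\<omega>. nexp (\<integral>\<^sup>+y. ennreal \<bar>f (grid k y) - f y\<bar> \<partial>\<xi> n \<omega>)"
  have i: "integrable M ?F" "integrable M ?G" "integrable M ?H"
    by (intro integrable_nexp; measurable)+
  have "\<bar>(\<integral>\<omega>. ?F \<omega> \<partial>M) - (\<integral>\<omega>. ?G \<omega> \<partial>M)\<bar> = \<bar>\<integral>\<omega>. ?F \<omega> - ?G \<omega> \<partial>M\<bar>"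
    using i by simp
  also have "\<dots> \<le> (\<integral>\<omega>. \<bar>?F \<omega> - ?G \<omega>\<bar> \<partial>M)"
    by (rule integral_abs_bound)
  also have "\<dots> \<le> (\<integral>\<omega>. 1 - ?H \<omega> \<partial>M)"
  proof (intro integral_mono)
    fix \<omega> assume \<omega>: "\<omega> \<in> space M"
    note s = sets_counting_measures[OF xi_counting[OF \<omega>]]
    have *: "(\<integral>\<^sup>+y. ennreal (u y) \<partial>\<xi> n \<omega>) \<le> (\<integral>\<^sup>+y. ennreal (v y) \<partial>\<xi> n \<omega>) + (\<integral>\<^sup>+y. ennreal \<bar>f (grid k y) - f y\<bar> \<partial>\<xi> n \<omega>)"
      if [measurable]: "u \<in> borel_measurable borel" "v \<in> borel_measurable borel"
        and "\<And>y. 0 \<le> v y" "\<And>y. u y \<le> v y + \<bar>f (grid k y) - f y\<bar>" for u v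
    proof -
      have "(\<integral>\<^sup>+y. ennreal (u y) \<partial>\<xi> n \<omega>) \<le> (\<integral>\<^sup>+y. ennreal (v y) + ennreal \<bar>f (grid k y) - f y\<bar> \<partial>\<xi> n \<omega>)"
        using that by (intro nn_integral_mono) (auto simp: ennreal_plus[symmetric] intro!: ennreal_leI simp del: ennreal_plus)
      also have "\<dots> = (\<integral>\<^sup>+y. ennreal (v y) \<partial>\<xi> n \<omega>) + (\<integral>\<^sup>+y. ennreal \<bar>f (grid k y) - f y\<bar> \<partial>\<xi> n \<omega>)"
        by (rule nn_integral_add) (simp_all add: s cong: measurable_cong_sets)
      finally show ?thesis .
    qed
    show "\<bar>?F \<omega> - ?G \<omega>\<bar> \<le> 1 - ?H \<omega>"
      using f(2) by (intro abs_nexp_diff_le *) auto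
  qed (use i in auto)
  also have "\<dots> = 1 - (\<integral>\<omega>. ?H \<omega> \<partial>M)"
    using i by (simp add: prob_space)
  also have "\<dots> \<le> 1 - nexp (ennreal c * (\<integral>\<^sup>+x. ennreal \<bar>f (grid k x) - f x\<bar> \<partial>lborel))"
    using laplace_lower[of "\<lambda>x. ennreal \<bar>f (grid k x) - f x\<bar>" n] by simp
  finally show ?thesis .
qed

lemma grid_approx_tendsto:
  fixes f :: "'a \<Rightarrow> real"
  assumes f: "continuous_on UNIV f" "bounded {x. f x \<noteq> 0}"
  shows "(\<lambda>k. 1 - nexp (ennreal c * (\<integral>\<^sup>+x. ennreal \<bar>f (grid k x) - f x\<bar> \<partial>lborel))) \<longlonglongrightarrow> 0"
proof -
  have [measurable]: "f \<in> borel_measurable borel"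
    using f(1) by (rule borel_measurable_continuous_onI)
  obtain R where R: "\<And>x. f x \<noteq> 0 \<Longrightarrow> norm x \<le> R"
    using f(2) by (auto simp: bounded_iff)
  \<comment> \<open>The margin \<open>real DIM('a)\<close> covers points outside the support of f
    whose corner lies in it.\<close>
  let ?B = "cball (0 :: 'a) (R + real DIM('a))"
  have "bounded (f ` cball 0 R)"
    using continuous_on_subset[OF f(1)] by (intro compact_imp_bounded compact_continuous_image) auto
  then obtain C where "\<forall>y\<in>f ` cball 0 R. norm y \<le> C"
    unfolding bounded_iff by blast
  then have "\<bar>f x\<bar> \<le> max 0 C" for x
    using R[of x] by (cases "f x = 0") force+
  then have C: "\<bar>f (grid k x) - f x\<bar> \<le> 2 * max 0 C" for k x
    using abs_triangle_ineq4[of "f (grid k x)" "f x"] by (smt (verit))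
  have out: "f (grid k x) = 0 \<and> f x = 0" if "x \<notin> ?B" for k x
  proof -
    have "norm x \<le> norm (grid k x) + dist x (grid k x)"
      using norm_triangle_sub[of x "grid k x"] by (simp add: dist_norm)
    then have "\<not> norm (grid k x) \<le> R" "\<not> norm x \<le> R"
      using dist_grid_le[of x k] that by auto
    then show ?thesis
      using R by blast
  qed
  define w where "w = (\<lambda>x. ennreal (2 * max 0 C) * indicator ?B x)"
  have [measurable]: "w \<in> borel_measurable borel"
    unfolding w_def by (intro borel_measurable_times_ennreal borel_measurable_indicator) auto
  have "(\<lambda>k. \<integral>\<^sup>+x. ennreal \<bar>f (grid k x) - f x\<bar> \<partial>lborel) \<longlonglongrightarrow> (\<integral>\<^sup>+x. 0 \<partial>(lborel :: 'a measure))"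
  proof (rule nn_integral_dominated_convergence[where w=w])
    show "AE x in lborel. ennreal \<bar>f (grid k x) - f x\<bar> \<le> w x" for k
      using C out unfolding w_def by (intro AE_I2) (auto simp: indicator_def intro!: ennreal_leI)
    have "(\<integral>\<^sup>+x. w x \<partial>lborel) = ennreal (2 * max 0 C) * emeasure lborel ?B"
      unfolding w_def by (rule nn_integral_cmult_indicator) simp
    also have "\<dots> < \<infinity>"
      using emeasure_bounded_finite[of ?B] by (simp add: ennreal_mult_less_top)
    finally show "(\<integral>\<^sup>+x. w x \<partial>lborel) < \<infinity>" .
    show "AE x in lborel. (\<lambda>k. ennreal \<bar>f (grid k x) - f x\<bar>) \<longlonglongrightarrow> 0"
    proof (rule AE_I2)
      fix x :: 'a
      have "isCont f x"
        using f(1) by (simp add: continuous_on_eq_continuous_at)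
      then have "(\<lambda>k. f (grid k x)) \<longlonglongrightarrow> f x"
        by (rule isCont_tendsto_compose[OF _ grid_tendsto])
      then have "(\<lambda>k. \<bar>f (grid k x) - f x\<bar>) \<longlonglongrightarrow> \<bar>f x - f x\<bar>"
        by (intro tendsto_intros)
      then show "(\<lambda>k. ennreal \<bar>f (grid k x) - f x\<bar>) \<longlonglongrightarrow> 0"
        using tendsto_ennrealI by fastforce
    qed
  qed measurable
  then have "(\<lambda>k. nexp (ennreal c * (\<integral>\<^sup>+x. ennreal \<bar>f (grid k x) - f x\<bar> \<partial>lborel))) \<longlonglongrightarrow> nexp (ennreal c * 0)"
    by (intro tendsto_nexp ennreal_tendsto_cmult) auto
  then have "(\<lambda>k. 1 - nexp (ennreal c * (\<integral>\<^sup>+x. ennreal \<bar>f (grid k x) - f x\<bar> \<partial>lborel))) \<longlonglongrightarrow> 1 - nexp (ennreal c * 0)"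
    by (intro tendsto_intros)
  then show ?thesis by simp
qed

section \<open>The limit configuration\<close>

definition consistent :: "(nat \<times> 'a \<Rightarrow> real) \<Rightarrow> bool" where
  "consistent x \<longleftrightarrow> (\<forall>k. \<forall>p\<in>range (grid k). x (k, p) = nat_part (x (k, p)) \<and>
     x (k, p) = (\<Sum>q\<in>children k p. x (Suc k, q)))"

text \<open>The map need not be measurable by construction; measurability follows because the integrals of
  continuous functions against the chosen measure are limits of measurable functions.\<close>
definition realisation :: "(nat \<times> 'a \<Rightarrow> real) \<Rightarrow> 'a measure" where
  "realisation x = (if consistent x then
     SOME \<nu>. \<nu> \<in> counting_measures \<and> (\<forall>f. continuous_on UNIV f \<longrightarrow> bounded {y. f y \<noteq> 0} \<longrightarrow>
       (\<lambda>k. \<Sum>p\<in>range (grid k) \<inter> {y. f y \<noteq> 0}. f p * x (k, p)) \<longlonglongrightarrow> (\<integral>y. f y \<partial>\<nu>))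
   else null_measure borel)"

lemma realisation_consistent:
  assumes "consistent x"
  shows "realisation x \<in> counting_measures"
    and "continuous_on UNIV f \<Longrightarrow> bounded {y. f y \<noteq> 0} \<Longrightarrow>
       (\<lambda>k. \<Sum>p\<in>range (grid k) \<inter> {y. f y \<noteq> 0}. f p * x (k, p)) \<longlonglongrightarrow> (\<integral>y. f y \<partial>realisation x)"
proof -
  define N where "N = (\<lambda>k p. nat \<lfloor>x (k, p)\<rfloor>)"
  have x: "x (k, p) = real (N k p)" if "p \<in> range (grid k)" for k p
    using assms that unfolding consistent_def N_def nat_part_def by blast
  have "N k p = (\<Sum>q\<in>children k p. N (Suc k) q)" if p: "p \<in> range (grid k)" for k p
  proof -
    have "real (N k p) = (\<Sum>q\<in>children k p. x (Suc k, q))"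
      using assms p unfolding x[OF p, symmetric] consistent_def by blast
    also have "\<dots> = (\<Sum>q\<in>children k p. real (N (Suc k) q))"
      by (intro sum.cong refl x) (auto simp: children_def)
    finally show ?thesis
      by (simp only: of_nat_sum[symmetric] of_nat_eq_iff)
  qed
  note ex = counting_measure_of_additive[of N, OF this]
  have "(\<Sum>p\<in>range (grid k) \<inter> {y. f y \<noteq> 0}. f p * x (k, p)) = (\<Sum>p\<in>range (grid k) \<inter> {x. f x \<noteq> 0}. f p * real (N k p))"
    for k and f :: "'a \<Rightarrow> real"
    by (intro sum.cong) (auto simp: x)
  with ex have "\<exists>\<nu>. \<nu> \<in> counting_measures \<and> (\<forall>f. continuous_on UNIV f \<longrightarrow> bounded {y. f y \<noteq> 0} \<longrightarrow>
       (\<lambda>k. \<Sum>p\<in>range (grid k) \<inter> {y. f y \<noteq> 0}. f p * x (k, p)) \<longlonglongrightarrow> (\<integral>y. f y \<partial>\<nu>))"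
    by auto
  from someI_ex[OF this] assms
  show "realisation x \<in> counting_measures"
    and "continuous_on UNIV f \<Longrightarrow> bounded {y. f y \<noteq> 0} \<Longrightarrow>
       (\<lambda>k. \<Sum>p\<in>range (grid k) \<inter> {y. f y \<noteq> 0}. f p * x (k, p)) \<longlonglongrightarrow> (\<integral>y. f y \<partial>realisation x)"
    by (auto simp: realisation_def)
qed

lemma realisation_counting: "realisation x \<in> counting_measures"
  using realisation_consistent(1) by (cases "consistent x") (auto simp: realisation_def)

lemma limit_point_process:
  obtains Q :: "(nat \<times> 'a \<Rightarrow> real) measure" where "prob_space Q" "realisation \<in> Q \<rightarrow>\<^sub>M config_space"
    and "\<And>f :: 'a \<Rightarrow> real. continuous_on UNIV f \<Longrightarrow> (\<And>x. 0 \<le> f x) \<Longrightarrow> bounded {x. f x \<noteq> 0} \<Longrightarrow>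
      (\<lambda>n. \<integral>\<omega>. exp (- (\<integral>y. f y \<partial>\<xi> n \<omega>)) \<partial>M) \<longlonglongrightarrow> (\<integral>x. exp (- (\<integral>y. f y \<partial>realisation x)) \<partial>Q)"
proof -
  obtain Q :: "(nat \<times> 'a \<Rightarrow> real) measure" where Q: "prob_space Q" and sQ: "sets Q = sets (PiM UNIV (\<lambda>_. borel))"
    and lim: "\<And>K g. finite K \<Longrightarrow> (\<And>v. \<bar>g v\<bar> \<le> 1) \<Longrightarrow> g \<in> borel_measurable (PiM K (\<lambda>_. borel)) \<Longrightarrow>
      (\<lambda>n. \<integral>\<omega>. g (\<lambda>i\<in>K. real (count n i \<omega>)) \<partial>M) \<longlonglongrightarrow> (\<integral>x. g (restrict x K) \<partial>Q :: real)"
    using count_limit_exists by metis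
  interpret Q: prob_space Q by fact
  have coord [measurable]: "(\<lambda>x. x i) \<in> borel_measurable Q" for i
    by (simp add: measurable_cong_sets[OF sQ refl])
  \<comment> \<open>Each level has countably many corners, so consistency is a countable conjunction
    of conditions on finitely many coordinates.\<close>
  have consistent_meas [measurable]: "Measurable.pred Q consistent"
  proof -
    have "Measurable.pred Q (\<lambda>x. x (k, p) = nat_part (x (k, p)) \<and> x (k, p) = (\<Sum>q\<in>children k p. x (Suc k, q)))" for k p
      by (intro pred_consistent_at coord)
    note at = this[unfolded pred_def]
    show ?thesis
      unfolding consistent_def[abs_def] pred_def
      by (intro sets.sets_Collect_countable_All sets.sets_Collect_countable_All' countable_range_grid at)
  qed
  have AE_consistent: "AE x in Q. consistent x"
    unfolding consistent_def
  proof (subst AE_all_countable, intro allI, subst AE_ball_countable[OF countable_range_grid], intro ballI)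
    fix k and p :: 'a assume "p \<in> range (grid k)"
    define K where "K = insert (k, p) ({Suc k} \<times> children k p)"
    \<comment> \<open>Indicator of a violation at one cell. It depends on finitely many counts and
      vanishes at every stage n, so its expectation in the limit is 0; the test functions in
      \<open>lim\<close> may be discontinuous.\<close>
    define g where "g = (\<lambda>v. of_bool (\<not> (v (k, p) = nat_part (v (k, p)) \<and> v (k, p) = (\<Sum>q\<in>children k p. v (Suc k, q)))) :: real)"
    have K: "finite K"
      by (simp add: K_def finite_children)
    have "Measurable.pred (PiM K (\<lambda>_. borel)) (\<lambda>v. v (k, p) = nat_part (v (k, p)) \<and> v (k, p) = (\<Sum>q\<in>children k p. v (Suc k, q)))"
      by (intro pred_consistent_at measurable_component_singleton) (auto simp: K_def)
    then have gK: "g \<in> borel_measurable (PiM K (\<lambda>_. borel))"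
      unfolding g_def by measurable
    have "g (\<lambda>i\<in>K. real (count n i \<omega>)) = 0" if "\<omega> \<in> space M" for n \<omega>
      using count_additive[OF that, of n k p] by (simp add: g_def K_def flip: of_nat_sum)
    then have "(\<integral>\<omega>. g (\<lambda>i\<in>K. real (count n i \<omega>)) \<partial>M) = 0" for n
      by (subst Bochner_Integration.integral_cong[of M M _ "\<lambda>_. 0"]) auto
    moreover have "(\<lambda>n. \<integral>\<omega>. g (\<lambda>i\<in>K. real (count n i \<omega>)) \<partial>M) \<longlonglongrightarrow> (\<integral>x. g (restrict x K) \<partial>Q)"
      by (rule lim[OF K _ gK]) (simp add: g_def)
    ultimately have "(\<integral>x. g (restrict x K) \<partial>Q) = 0"
      by (simp add: LIMSEQ_const_iff)
    moreover have "g (restrict x K) = g x" for x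
      by (simp add: g_def K_def)
    ultimately have "(\<integral>x. g x \<partial>Q) = 0"
      by simp
    moreover have gm: "g \<in> borel_measurable Q"
      using pred_consistent_at[of k p Q, OF coord coord] unfolding g_def by measurable
    moreover have "integrable Q g"
      using gm by (intro Q.integrable_const_bound[of _ 1]) (auto simp: g_def)
    ultimately have "AE x in Q. g x = 0"
      by (subst (asm) integral_nonneg_eq_0_iff_AE) (auto simp: g_def)
    then show "AE x in Q. x (k, p) = nat_part (x (k, p)) \<and> x (k, p) = (\<Sum>q\<in>children k p. x (Suc k, q))"
    proof eventually_elim
      case (elim x)
      then show ?case
        unfolding g_def of_bool_eq_0_iff not_not .
    qed
  qed
  have meas_int: "(\<lambda>x. \<integral>y. f y \<partial>realisation x) \<in> borel_measurable Q"
    if f: "continuous_on UNIV f" "bounded {x. f x \<noteq> 0}" for f :: "'a \<Rightarrow> real"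
  proof (rule borel_measurable_LIMSEQ_real)
    fix x
    show "(\<lambda>k. if consistent x then \<Sum>p\<in>range (grid k) \<inter> {y. f y \<noteq> 0}. f p * x (k, p) else 0) \<longlonglongrightarrow> (\<integral>y. f y \<partial>realisation x)"
      using realisation_consistent(2)[OF _ f, of x]
      by (cases "consistent x") (auto simp: realisation_def)
  qed measurable
  have "realisation \<in> Q \<rightarrow>\<^sub>M config_space"
    by (rule measurable_config_spaceI_continuous) (auto intro: realisation_counting meas_int)
  moreover have "(\<lambda>n. \<integral>\<omega>. exp (- (\<integral>y. f y \<partial>\<xi> n \<omega>)) \<partial>M) \<longlonglongrightarrow> (\<integral>x. exp (- (\<integral>y. f y \<partial>realisation x)) \<partial>Q)"
    if f: "continuous_on UNIV f" "\<And>x. 0 \<le> f x" "bounded {x. f x \<noteq> 0}" for f :: "'a \<Rightarrow> real"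
  proof -
    let ?S = "\<lambda>k. range (grid k) \<inter> {y. f y \<noteq> 0}"
    have S: "finite (?S k)" for k
      using f(3) by (rule finite_range_grid_bounded)
    have lap: "(\<integral>\<omega>. exp (- (\<integral>y. f y \<partial>\<xi> n \<omega>)) \<partial>M) = (\<integral>\<omega>. nexp (\<integral>\<^sup>+y. ennreal (f y) \<partial>\<xi> n \<omega>) \<partial>M)" for n
      using f by (intro Bochner_Integration.integral_cong refl)
        (simp add: nn_integral_eq_integral[OF integrable_counting_measure[OF xi_counting]] nexp_ennreal)
    have r: "(\<lambda>k. 1 - nexp (ennreal c * (\<integral>\<^sup>+x. ennreal \<bar>f (grid k x) - f x\<bar> \<partial>lborel))) \<longlonglongrightarrow> 0"
      using f by (intro grid_approx_tendsto)
    have close: "\<bar>(\<integral>\<omega>. exp (- (\<integral>y. f y \<partial>\<xi> n \<omega>)) \<partial>M) - (\<integral>\<omega>. nexp (\<integral>\<^sup>+y. ennreal (f (grid k y)) \<partial>\<xi> n \<omega>) \<partial>M)\<bar> \<le>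
        1 - nexp (ennreal c * (\<integral>\<^sup>+x. ennreal \<bar>f (grid k x) - f x\<bar> \<partial>lborel))" for n k
      unfolding lap using f by (intro laplace_grid_close)
    \<comment> \<open>\<open>lim\<close> wants the bound 1 at every real vector, negative
      coordinates included, hence \<open>max 0\<close>; on actual counts the sum is
      nonnegative.\<close>
    let ?g = "\<lambda>k v. exp (- max 0 (\<Sum>p\<in>?S k. f p * v (k, p)))"
    have a': "(\<lambda>n. \<integral>\<omega>. nexp (\<integral>\<^sup>+y. ennreal (f (grid k y)) \<partial>\<xi> n \<omega>) \<partial>M) \<longlonglongrightarrow> (\<integral>x. ?g k x \<partial>Q)" for k
    proof -
      let ?K = "{k} \<times> ?S k"
      have [measurable]: "p \<in> ?S k \<Longrightarrow> (\<lambda>v. v (k, p)) \<in> borel_measurable (PiM ?K (\<lambda>_. borel))" for p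
        by (intro measurable_component_singleton) auto
      have "?g k \<in> borel_measurable (PiM ?K (\<lambda>_. borel))"
        by measurable
      then have "(\<lambda>n. \<integral>\<omega>. ?g k (\<lambda>i\<in>?K. real (count n i \<omega>)) \<partial>M) \<longlonglongrightarrow> (\<integral>x. ?g k (restrict x ?K) \<partial>Q)"
        using S by (intro lim) auto
      moreover have "?g k (restrict x ?K) = ?g k x" for x :: "nat \<times> 'a \<Rightarrow> real"
        by (intro arg_cong[where f="\<lambda>s. exp (- max 0 s)"] sum.cong) auto
      moreover have "?g k (\<lambda>i\<in>?K. real (count n i \<omega>)) = nexp (\<integral>\<^sup>+y. ennreal (f (grid k y)) \<partial>\<xi> n \<omega>)"
        if "\<omega> \<in> space M" for n \<omega>
      proof -
        have nn: "0 \<le> (\<Sum>p\<in>?S k. f p * real (count n (k, p) \<omega>))"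
          using f(2) by (intro sum_nonneg) auto
        have "(\<Sum>p\<in>?S k. f p * (\<lambda>i\<in>?K. real (count n i \<omega>)) (k, p)) = (\<Sum>p\<in>?S k. f p * real (count n (k, p) \<omega>))"
          by (intro sum.cong) auto
        then show ?thesis
          using nn by (simp add: nn_integral_grid[OF f(2,3) that] nexp_ennreal)
      qed
      ultimately show ?thesis
        by (simp cong: Bochner_Integration.integral_cong)
    qed
    have b': "(\<lambda>k. \<integral>x. ?g k x \<partial>Q) \<longlonglongrightarrow> (\<integral>x. exp (- (\<integral>y. f y \<partial>realisation x)) \<partial>Q)"
    proof (rule integral_dominated_convergence[of _ _ _ "\<lambda>_. 1"])
      show "(\<lambda>x. exp (- (\<integral>y. f y \<partial>realisation x))) \<in> borel_measurable Q"
        using meas_int[OF f(1,3)] by measurable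
      show "AE x in Q. (\<lambda>k. ?g k x) \<longlonglongrightarrow> exp (- (\<integral>y. f y \<partial>realisation x))"
        using AE_consistent
      proof eventually_elim
        case (elim x)
        have "(\<lambda>k. ?g k x) \<longlonglongrightarrow> exp (- max 0 (\<integral>y. f y \<partial>realisation x))"
          by (intro tendsto_intros realisation_consistent(2)[OF elim f(1,3)])
        moreover have "0 \<le> (\<integral>y. f y \<partial>realisation x)"
          using f(2) by (intro integral_nonneg_AE) auto
        ultimately show ?case by simp
      qed
    qed auto
    show ?thesis
      by (rule tendsto_double_limit[OF a' b' r close])
  qed
  ultimately show thesis
    using that[OF Q] by blast
qed

lemma measurable_integral_config:
  fixes f :: "'a \<Rightarrow> real"
  assumes f: "continuous_on UNIV f" "\<And>x. 0 \<le> f x"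
  shows "(\<lambda>\<nu>. \<integral>y. f y \<partial>\<nu>) \<in> borel_measurable config_space"
proof -
  have [measurable]: "f \<in> borel_measurable borel"
    using f(1) by (rule borel_measurable_continuous_onI)
  have "(\<lambda>\<nu>. \<integral>\<^sup>+y. ennreal (f y) \<partial>\<nu>) \<in> borel_measurable (config_space :: 'a measure measure)"
    by (rule measurable_nn_integral_config[OF enum _ measurable_ident_sets[OF refl]]) measurable
  then have "(\<lambda>\<nu>. enn2real (\<integral>\<^sup>+y. ennreal (f y) \<partial>\<nu>)) \<in> borel_measurable (config_space :: 'a measure measure)"
    by measurable
  moreover have "enn2real (\<integral>\<^sup>+y. ennreal (f y) \<partial>\<nu>) = (\<integral>y. f y \<partial>\<nu>)" if "\<nu> \<in> counting_measures" for \<nu>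
    using f(2) \<open>f \<in> borel_measurable borel\<close> that
    by (subst integral_eq_nn_integral) (auto simp: sets_counting_measures cong: measurable_cong_sets)
  ultimately show ?thesis
    by (rule measurable_cong[THEN iffD1, rotated]) simp
qed

lemma converges_weakly_exists:
  "\<exists>(Q :: 'a measure measure) (\<eta> :: 'a measure \<Rightarrow> 'a measure). converges_weakly M \<xi> Q \<eta>"
proof -
  obtain Q :: "(nat \<times> 'a \<Rightarrow> real) measure" where Q: "prob_space Q" and re [measurable]: "realisation \<in> Q \<rightarrow>\<^sub>M config_space"
    and lim: "\<And>f :: 'a \<Rightarrow> real. continuous_on UNIV f \<Longrightarrow> (\<And>x. 0 \<le> f x) \<Longrightarrow> bounded {x. f x \<noteq> 0} \<Longrightarrow>
      (\<lambda>n. \<integral>\<omega>. exp (- (\<integral>y. f y \<partial>\<xi> n \<omega>)) \<partial>M) \<longlonglongrightarrow> (\<integral>x. exp (- (\<integral>y. f y \<partial>realisation x)) \<partial>Q)"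
    by (rule limit_point_process) blast
  \<comment> \<open>The limit process is the identity under the law of \<open>realisation\<close>,
    so that the witness lives on configurations and not on families of cell counts.\<close>
  let ?Q = "distr Q config_space realisation"
  have "converges_weakly M \<xi> ?Q (\<lambda>\<nu>. \<nu>)"
    unfolding converges_weakly_def
  proof (intro conjI allI impI)
    show "point_process M (\<xi> n)" for n
      using prob_space_axioms by (simp add: point_process_def)
    show "point_process ?Q (\<lambda>\<nu>. \<nu>)"
      using prob_space.prob_space_distr[OF Q re] by (simp add: point_process_def)
    fix f :: "'a \<Rightarrow> real"
    assume "continuous_on UNIV f \<and> (\<forall>x. 0 \<le> f x) \<and> compact (closure {x. f x \<noteq> 0})"
    then have f: "continuous_on UNIV f" "\<And>x. 0 \<le> f x" "bounded {x. f x \<noteq> 0}"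
      using compact_imp_bounded bounded_subset closure_subset by blast+
    have "weak_conv_m (\<lambda>n. distr M borel (\<lambda>\<omega>. \<integral>y. f y \<partial>\<xi> n \<omega>)) (distr Q borel (\<lambda>x. \<integral>y. f y \<partial>realisation x))"
    proof (rule weak_conv_of_laplace[OF prob_space_axioms Q])
      show "(\<lambda>\<omega>. \<integral>y. f y \<partial>\<xi> n \<omega>) \<in> borel_measurable M" for n
        using measurable_compose[OF xi measurable_integral_config[OF f(1,2)]] .
      show "(\<lambda>x. \<integral>y. f y \<partial>realisation x) \<in> borel_measurable Q"
        using measurable_compose[OF re measurable_integral_config[OF f(1,2)]] .
      show "0 \<le> (\<integral>y. f y \<partial>\<xi> n \<omega>)" "0 \<le> (\<integral>y. f y \<partial>realisation x)" for n \<omega> x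
        using f(2) by (auto intro!: integral_nonneg_AE)
      fix m :: nat
      \<comment> \<open>The Laplace transform at m of the integral of f is the Laplace functional at
        \<open>real m * f\<close>, which is again continuous with bounded support.\<close>
      have "bounded {x. real m * f x \<noteq> 0}"
        by (rule bounded_subset[OF f(3)]) auto
      then show "(\<lambda>n. \<integral>\<omega>. exp (- (real m * (\<integral>y. f y \<partial>\<xi> n \<omega>))) \<partial>M) \<longlonglongrightarrow>
          (\<integral>x. exp (- (real m * (\<integral>y. f y \<partial>realisation x))) \<partial>Q)"
        using lim[of "\<lambda>x. real m * f x"] f by (simp add: continuous_on_mult_left)
    qed
    moreover have "distr ?Q borel (\<lambda>\<nu>. \<integral>y. f y \<partial>\<nu>) = distr Q borel (\<lambda>x. \<integral>y. f y \<partial>realisation x)"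
      by (subst distr_distr[OF measurable_integral_config[OF f(1,2)] re]) (simp add: comp_def)
    ultimately show "weak_conv_m (\<lambda>n. distr M borel (\<lambda>\<omega>. \<integral>y. f y \<partial>\<xi> n \<omega>)) (distr ?Q borel (\<lambda>\<omega>. \<integral>y. f y \<partial>\<omega>))"
      by simp
  qed
  then show ?thesis
    by blast
qed

end

lemma critical_cluster_law:
  assumes X: "critical_cluster P X" and e: "point_enumeration e"
  shows "cluster_law (distr P config_space X) e"
proof -
  have P: "prob_space P" and m [measurable]: "X \<in> P \<rightarrow>\<^sub>M config_space"
    using X by (auto simp: critical_cluster_def point_process_def)
  interpret L: prob_space "distr P config_space X"
    by (rule prob_space.prob_space_distr[OF P m])
  show ?thesis
  proof
    show "(\<integral>\<^sup>+\<nu>. emeasure \<nu> UNIV \<partial>distr P config_space X) = 1"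
      using X by (subst nn_integral_distr) (auto simp: critical_cluster_def)
  qed (use e in auto)
qed

theorem theorem1:
  fixes P :: "'v measure" and X :: "'v \<Rightarrow> 'a::euclidean_space measure"
    and M :: "'w measure" and \<xi> :: "nat \<Rightarrow> 'w \<Rightarrow> 'a measure"
    and c :: real
  assumes "critical_cluster P X"
    and "c > 0"
    and "critical_cluster_cascade M (distr P config_space X) c \<xi>"
  shows "\<exists>(Q :: 'a measure measure) (\<eta> :: 'a measure \<Rightarrow> 'a measure).
           converges_weakly M \<xi> Q \<eta>"
proof -
  let ?L = "distr P config_space X"
  from assms(3) obtain e \<mu> and U :: "nat \<Rightarrow> 'w \<Rightarrow> real" and Z :: "nat \<times> nat \<times> nat \<Rightarrow> 'w \<Rightarrow> 'a measure"
    where cascade: "prob_space M" "point_enumeration e" "poisson_process M c \<mu>"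
      "prob_space.indep_vars M (\<lambda>_. borel) U UNIV"
      "\<forall>i. distr M borel (U i) = uniform_measure lborel {0<..<1}"
      "prob_space.indep_vars M (\<lambda>_. config_space) Z UNIV"
      "\<forall>t. distr M config_space (Z t) = ?L"
      "prob_space.indep_sets M
          (\<lambda>l. [sets (vimage_algebra (space M) \<mu> config_space),
                 sets (vimage_algebra (space M) (\<lambda>\<omega> i. U i \<omega>) (PiM UNIV (\<lambda>_. borel))),
                 sets (vimage_algebra (space M) (\<lambda>\<omega> t. Z t \<omega>) (PiM UNIV (\<lambda>_. config_space)))] ! l)
          {..<3}"
      "\<forall>n. \<forall>\<omega>\<in>space M. \<xi> n \<omega> =
           superpose {i \<in> indices (\<mu> \<omega>). U i \<omega> \<le> 1 / (real n + 1)}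
             (\<lambda>i. total_progeny e (\<lambda>k j. Z (i, k, j) \<omega>) (e i (\<mu> \<omega>)) n)"
    unfolding critical_cluster_cascade_def by blast
  interpret cluster_law ?L e
    using critical_cluster_law[OF assms(1) cascade(2)] .
  interpret cluster_cascade ?L e M \<mu> U Z c \<xi>
    by (intro cluster_cascade.intro cluster_cascade_axioms.intro cluster_law_axioms) (use cascade assms(2) in auto)
  interpret laplace_limit M \<xi> c e
    by unfold_locales
       (use enum measurable_xi assms(2) convergent_laplace_xi laplace_xi_ge in auto)
  show ?thesis
    by (rule converges_weakly_exists)
qed

end
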